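(* Fix an integer $k\ge-2$. Let $(u_n)_{n\ge0}$ be profiles and $(w_n)_{n\ge-2}$ the associated residual profiles as in the context. The following are equivalent: (i) $(I-\pi)w_j=0$ for $-2\le j\le k$; (ii) $(I-\pi)u_\ell=\sum_{n=1}^{\ell}\chi_n\,\pi u_{\ell-n}$ for $0\le\ell\le k+2$.
   Context: Let $d\ge1$, ${\mathbb T}^d$ the unit torus. Let $\rho\in L^\infty({\mathbb T}^d)$ be real valued and $a\in L^\infty({\mathbb T}^d)$ take values in real symmetric $d\times d$ matrices, with $m_1>0$ such that $a(y)\xi\cdot\xi\ge m_1|\xi|^2$ for all $\xi$ and $\rho(y)\ge m_1$ a.e. For $g(t,x,y)$ periodic in $y$, $(\pi g)(t,x)=\frac1{|{\mathbb T}^d|}\int_{{\mathbb T}^d}g(t,x,y)dy$. ${\mathcal A}_{yy}=\mathrm{div}_y a(y)\mathrm{grad}_y$, ${\mathcal A}_{xx}=\mathrm{div}_x a(y)\mathrm{grad}_x$, ${\mathcal A}_{xy}=\mathrm{div}_x a(y)\mathrm{grad}_y+\mathrm{div}_y a(y)\mathrm{grad}_x$; ${\mathcal A}_{yy}^{-1}$ is the inverse of the bijection ${\mathcal A}_{yy}:(I-\pi)H^1({\mathbb T}^d)\to(I-\pi)H^{-1}({\mathbb T}^d)$. $\chi_{-1}=0$, $\chi_0=I$, and for $k\ge1$, $\chi_k=-{\mathcal A}_{yy}^{-1}(I-\pi)[{\mathcal A}_{xy}\chi_{k-1}+({\mathcal A}_{xx}-\rho(y)\partial_t^2)\chi_{k-2}]$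 (operators from functions of $(t,x)$ to functions of $(t,x,y)$). Profiles $u_n(t,x,y)$, $n\ge0$, are functions smooth in $(t,x)$ with values in $H^1({\mathbb T}^d)$ (periodic in $y$), the coefficients of a formal series $U=\sum_{n\ge0}\epsilon^nu_n$. The residual profiles $w_n$, $n\ge-2$, are the coefficients of $\epsilon^n$ in $\big[\rho(y)\partial_t^2-\epsilon^{-2}{\mathcal A}_{yy}-\epsilon^{-1}{\mathcal A}_{xy}-{\mathcal A}_{xx}\big]U$, i.e. $w_{-2}=-{\mathcal A}_{yy}u_0$, $w_{-1}=-{\mathcal A}_{yy}u_1-{\mathcal A}_{xy}u_0$, and $w_k=\rho(y)\partial_t^2u_k-{\mathcal A}_{yy}u_{k+2}-{\mathcal A}_{xy}u_{k+1}-{\mathcal A}_{xx}u_k$ for $k\ge0$. *)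

theory Defs
  imports "HOL-Analysis.Analysis"
begin

text \<open>The unit torus is represented by periodic functions on real^'d,
  with fundamental cell T = [0,1]^d (so |T| = 1).\<close>

definition cellT :: "(real^'d) set" where
  "cellT = cbox 0 One"

definition intT :: "(real^'d \<Rightarrow> real) \<Rightarrow> real" where
  "intT f = integral cellT f"

definition periodic :: "(real^'d \<Rightarrow> 'b) \<Rightarrow> bool" where
  "periodic f \<longleftrightarrow> (\<forall>y i. f (y + axis i 1) = f y)"

definition tpd :: "'d \<Rightarrow> (real^'d \<Rightarrow> real) \<Rightarrow> real^'d \<Rightarrow> real" where
  "tpd i \<phi> y = deriv (\<lambda>s. \<phi> (y + s *\<^sub>R axis i 1)) 0"

definition tgrad :: "(real^'d \<Rightarrow> real) \<Rightarrow> real^'d \<Rightarrow> real^'d" where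
  "tgrad \<phi> y = (\<chi> i. tpd i \<phi> y)"

definition testfun :: "(real^'d \<Rightarrow> real) \<Rightarrow> bool" where
  "testfun \<phi> \<longleftrightarrow> periodic \<phi> \<and>
     (\<forall>i y. (\<lambda>s. \<phi> (y + s *\<^sub>R axis i 1)) differentiable (at 0)) \<and>
     (\<forall>i. continuous_on UNIV (tpd i \<phi>))"

definition L2T :: "(real^'d \<Rightarrow> real) \<Rightarrow> bool" where
  "L2T f \<longleftrightarrow> f measurable_on cellT \<and> (\<lambda>y. (f y)\<^sup>2) integrable_on cellT"

definition weak_grad :: "(real^'d \<Rightarrow> real) \<Rightarrow> (real^'d \<Rightarrow> real^'d) \<Rightarrow> bool" where
  "weak_grad f G \<longleftrightarrow> (\<forall>i. L2T (\<lambda>y. G y $ i)) \<and>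
     (\<forall>\<phi> i. testfun \<phi> \<longrightarrow> intT (\<lambda>y. f y * tpd i \<phi> y) = - intT (\<lambda>y. G y $ i * \<phi> y))"

definition H1 :: "(real^'d \<Rightarrow> real) \<Rightarrow> bool" where
  "H1 f \<longleftrightarrow> periodic f \<and> L2T f \<and> (\<exists>G. weak_grad f G)"

definition wgrad :: "(real^'d \<Rightarrow> real) \<Rightarrow> real^'d \<Rightarrow> real^'d" where
  "wgrad f = (SOME G. weak_grad f G)"

definition h1norm :: "(real^'d \<Rightarrow> real) \<Rightarrow> real" where
  "h1norm f = sqrt (intT (\<lambda>y. (f y)\<^sup>2) + intT (\<lambda>y. (norm (wgrad f y))\<^sup>2))"

text \<open>Smoothness in (t,x) with values in H^1: V belongs to a family S of
  H^1-valued functions, each continuous in H^1-norm and having all first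
  partial derivatives (in t and each x_i, in H^1-norm) again in S.\<close>
definition smooth_H1 :: "(real \<Rightarrow> real^'d \<Rightarrow> real^'d \<Rightarrow> real) \<Rightarrow> bool" where
  "smooth_H1 V \<longleftrightarrow> (\<exists>S. V \<in> S \<and> (\<forall>W\<in>S.
      (\<forall>t x. H1 (W t x)) \<and>
      (\<forall>t x. ((\<lambda>p. h1norm (\<lambda>y. W (fst p) (snd p) y - W t x y)) \<longlongrightarrow> 0) (at (t, x))) \<and>
      (\<exists>Wt\<in>S. \<forall>t x. ((\<lambda>s. h1norm (\<lambda>y. (W s x y - W t x y) / (s - t) - Wt t x y)) \<longlongrightarrow> 0) (at t)) \<and>
      (\<forall>i. \<exists>Wi\<in>S. \<forall>t x. ((\<lambda>s. h1norm (\<lambda>y. (W t (x + s *\<^sub>R axis i 1) y - W t x y) / s - Wi t x y))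
                               \<longlongrightarrow> 0) (at 0))))"

definition dx :: "'d \<Rightarrow> (real \<Rightarrow> real^'d \<Rightarrow> real) \<Rightarrow> real \<Rightarrow> real^'d \<Rightarrow> real" where
  "dx i g t x = deriv (\<lambda>s. g t (x + s *\<^sub>R axis i 1)) 0"

definition dt :: "(real \<Rightarrow> real^'d \<Rightarrow> real) \<Rightarrow> real \<Rightarrow> real^'d \<Rightarrow> real" where
  "dt g t x = deriv (\<lambda>s. g s x) t"

definition piT :: "(real \<Rightarrow> real^'d \<Rightarrow> real^'d \<Rightarrow> real) \<Rightarrow> real \<Rightarrow> real^'d \<Rightarrow> real" where
  "piT V t x = intT (V t x)"

text \<open>Operators applied to V(t,x,y), given as the y-distributions they define
  (pairing with a test function \<phi>), as functions of (t,x). The (t,x)-derivatives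
  are taken outside the y-integrals.\<close>
definition Ayy :: "(real^'d \<Rightarrow> real^'d^'d) \<Rightarrow> (real \<Rightarrow> real^'d \<Rightarrow> real^'d \<Rightarrow> real)
    \<Rightarrow> (real^'d \<Rightarrow> real) \<Rightarrow> real \<Rightarrow> real^'d \<Rightarrow> real" where
  "Ayy a V \<phi> t x = - intT (\<lambda>y. (a y *v wgrad (V t x) y) \<bullet> tgrad \<phi> y)"

definition Axy :: "(real^'d \<Rightarrow> real^'d^'d) \<Rightarrow> (real \<Rightarrow> real^'d \<Rightarrow> real^'d \<Rightarrow> real)
    \<Rightarrow> (real^'d \<Rightarrow> real) \<Rightarrow> real \<Rightarrow> real^'d \<Rightarrow> real" where
  "Axy a V \<phi> t x =
     (\<Sum>i\<in>UNIV. dx i (\<lambda>t' x'. intT (\<lambda>y. (a y *v wgrad (V t' x') y) $ i * \<phi> y)) t x)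
   - (\<Sum>i\<in>UNIV. dx i (\<lambda>t' x'. intT (\<lambda>y. V t' x' y * (tgrad \<phi> y v* a y) $ i)) t x)"

definition Axx :: "(real^'d \<Rightarrow> real^'d^'d) \<Rightarrow> (real \<Rightarrow> real^'d \<Rightarrow> real^'d \<Rightarrow> real)
    \<Rightarrow> (real^'d \<Rightarrow> real) \<Rightarrow> real \<Rightarrow> real^'d \<Rightarrow> real" where
  "Axx a V \<phi> t x =
     (\<Sum>i\<in>UNIV. \<Sum>j\<in>UNIV. dx i (dx j (\<lambda>t' x'. intT (\<lambda>y. a y $ i $ j * V t' x' y * \<phi> y))) t x)"

definition Rtt :: "(real^'d \<Rightarrow> real) \<Rightarrow> (real \<Rightarrow> real^'d \<Rightarrow> real^'d \<Rightarrow> real)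
    \<Rightarrow> (real^'d \<Rightarrow> real) \<Rightarrow> real \<Rightarrow> real^'d \<Rightarrow> real" where
  "Rtt \<rho> V \<phi> t x = dt (dt (\<lambda>t' x'. intT (\<lambda>y. \<rho> y * V t' x' y * \<phi> y))) t x"

text \<open>A_yy^{-1}(I-pi): given a y-distribution F (pairing form, as function of (t,x)),
  the mean-zero H^1 solution v of A_yy v = (I-pi) F.\<close>
definition AyyInv :: "(real^'d \<Rightarrow> real^'d^'d) \<Rightarrow> ((real^'d \<Rightarrow> real) \<Rightarrow> real \<Rightarrow> real^'d \<Rightarrow> real)
    \<Rightarrow> real \<Rightarrow> real^'d \<Rightarrow> real^'d \<Rightarrow> real" where
  "AyyInv a F t x = (SOME v. H1 v \<and> intT v = 0 \<and>
      (\<forall>\<phi>. testfun \<phi> \<longrightarrow>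
         - intT (\<lambda>y. (a y *v wgrad v y) \<bullet> tgrad \<phi> y) = F \<phi> t x - F (\<lambda>_. 1) t x * intT \<phi>))"

text \<open>chi_n (chi_{-1} = 0, chi_0 = I).\<close>
fun chi :: "(real^'d \<Rightarrow> real^'d^'d) \<Rightarrow> (real^'d \<Rightarrow> real) \<Rightarrow> nat
    \<Rightarrow> (real \<Rightarrow> real^'d \<Rightarrow> real) \<Rightarrow> real \<Rightarrow> real^'d \<Rightarrow> real^'d \<Rightarrow> real" where
  "chi a \<rho> 0 f = (\<lambda>t x y. f t x)"
| "chi a \<rho> (Suc 0) f = (\<lambda>t x y. - AyyInv a (\<lambda>\<phi> t x. Axy a (chi a \<rho> 0 f) \<phi> t x) t x y)"
| "chi a \<rho> (Suc (Suc k)) f = (\<lambda>t x y. - AyyInv a (\<lambda>\<phi> t x.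
      Axy a (chi a \<rho> (Suc k) f) \<phi> t x + Axx a (chi a \<rho> k f) \<phi> t x - Rtt \<rho> (chi a \<rho> k f) \<phi> t x) t x y)"

definition wres :: "(real^'d \<Rightarrow> real^'d^'d) \<Rightarrow> (real^'d \<Rightarrow> real)
    \<Rightarrow> (nat \<Rightarrow> real \<Rightarrow> real^'d \<Rightarrow> real^'d \<Rightarrow> real) \<Rightarrow> int
    \<Rightarrow> (real^'d \<Rightarrow> real) \<Rightarrow> real \<Rightarrow> real^'d \<Rightarrow> real" where
  "wres a \<rho> u j \<phi> t x =
     (if j = -2 then - Ayy a (u 0) \<phi> t x
      else if j = -1 then - Ayy a (u 1) \<phi> t x - Axy a (u 0) \<phi> t x
      else Rtt \<rho> (u (nat j)) \<phi> t x - Ayy a (u (nat j + 2)) \<phi> t x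
           - Axy a (u (nat j + 1)) \<phi> t x - Axx a (u (nat j)) \<phi> t x)"

text \<open>(I - pi) W = 0 for a distribution-valued W: W is y-constant.\<close>
definition Ipi_zero :: "((real^'d \<Rightarrow> real) \<Rightarrow> real \<Rightarrow> real^'d \<Rightarrow> real) \<Rightarrow> bool" where
  "Ipi_zero W \<longleftrightarrow> (\<forall>t x \<phi>. testfun \<phi> \<longrightarrow> W \<phi> t x = W (\<lambda>_. 1) t x * intT \<phi>)"

end

theory Submission
  imports Defs
begin

text \<open>Write \<open>F(V, Z) = A\<^sub>x\<^sub>y V + (A\<^sub>x\<^sub>x - \<rho> \<partial>\<^sub>t\<^sup>2) Z\<close>.  With \<open>l = j + 2\<close> and \<open>u\<^sub>-\<^sub>1 = u\<^sub>-\<^sub>2 = 0\<close>, the condition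
  \<open>(I - \<pi>) w\<^sub>j = 0\<close> says that \<open>-(I - \<pi>) u\<^sub>l\<close> solves the mean-zero elliptic cell problem with right-hand side
  \<open>(I - \<pi>) F(u\<^sub>l\<^sub>-\<^sub>1, u\<^sub>l\<^sub>-\<^sub>2)\<close>, while \<open>-\<chi>\<^sub>n\<^sub>+\<^sub>1 f\<close> solves it with right-hand side \<open>(I - \<pi>) F(\<chi>\<^sub>n f, \<chi>\<^sub>n\<^sub>-\<^sub>1 f)\<close>.
  If the expansion of \<open>u\<^sub>m\<close> is known for \<open>m < l\<close>, linearity of \<open>F\<close> and unique solvability show that
  the expansion of \<open>u\<^sub>l\<close> is equivalent to \<open>(I - \<pi>) w\<^sub>l\<^sub>-\<^sub>2 = 0\<close>; strong induction on \<open>l\<close> finishes the proof.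

  Existence in the cell problem comes from a minimising sequence of test functions together with the
  Poincare inequality.  Uniqueness needs test functions to be dense in \<open>H\<^sup>1\<close>: a weakly harmonic periodic
  function is orthogonal to every nonconstant trigonometric function, hence constant.  The solution
  operator is bounded, so it preserves smoothness in \<open>(t, x)\<close>, which makes every \<open>\<chi>\<^sub>n \<pi> u\<^sub>m\<close> smooth.\<close>

section \<open>Square integrable functions\<close>

text \<open>The matrix \<open>a\<close> is merely bounded and measurable, so it enters only through
  integrals against test functions, and every equality of profiles is an equality almost everywhere.
  Weak gradients, solutions of the cell problem and derivatives in (t,x) are fixed by choice and
  determined only up to null sets, so none of them can be computed pointwise. Two devices keep this
  under control. All operators are read off one kind of bounded bilinear form in first-order jets,
  which does not see null sets. Derivatives in (t,x) of an almost everywhere identity are taken only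
  after pairing with a fixed test function, where they become derivatives of real functions. Density
  of test functions is obtained for the Dirichlet form alone and then serves every
  \<open>a\<close>.\<close>

definition sqint :: "'a measure \<Rightarrow> ('a \<Rightarrow> real) \<Rightarrow> bool" where
  "sqint M f \<longleftrightarrow> f \<in> borel_measurable M \<and> integrable M (\<lambda>x. (f x)\<^sup>2)"

definition l2 :: "'a measure \<Rightarrow> ('a \<Rightarrow> real) \<Rightarrow> real" where
  "l2 M f = sqrt (LINT x|M. (f x)\<^sup>2)"

lemma l2_nonneg [simp]: "0 \<le> l2 M f"
  by (simp add: l2_def)

lemma l2_sq: "(l2 M f)\<^sup>2 = (LINT x|M. (f x)\<^sup>2)"
  by (simp add: l2_def)

lemma sqint_measurable: "sqint M f \<Longrightarrow> f \<in> borel_measurable M"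
  by (simp add: sqint_def)

lemma sqint_mult:
  assumes "sqint M f" "sqint M g"
  shows "integrable M (\<lambda>x. f x * g x)"
proof (rule Bochner_Integration.integrable_bound)
  show "integrable M (\<lambda>x. (f x)\<^sup>2 + (g x)\<^sup>2)"
    using assms by (auto simp: sqint_def)
  show "(\<lambda>x. f x * g x) \<in> borel_measurable M"
    using assms by (auto simp: sqint_def)
  have "\<bar>a * b\<bar> \<le> a\<^sup>2 + b\<^sup>2" for a b :: real
  proof -
    have "0 \<le> (\<bar>a\<bar> - \<bar>b\<bar>)\<^sup>2" by simp
    then have "2 * (\<bar>a\<bar> * \<bar>b\<bar>) \<le> a\<^sup>2 + b\<^sup>2"
      by (simp add: power2_diff)
    moreover have "0 \<le> \<bar>a\<bar> * \<bar>b\<bar>" by simp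
    ultimately show ?thesis unfolding abs_mult by linarith
  qed
  then show "AE x in M. norm (f x * g x) \<le> norm ((f x)\<^sup>2 + (g x)\<^sup>2)"
    by (simp add: real_norm_def)
qed

lemma sqint_cmult: "sqint M f \<Longrightarrow> sqint M (\<lambda>x. c * f x)"
  by (auto simp: sqint_def power_mult_distrib)

lemma sqint_add: "sqint M f \<Longrightarrow> sqint M g \<Longrightarrow> sqint M (\<lambda>x. f x + g x)"
  using sqint_mult[of M f g]
  by (auto simp: sqint_def power2_sum mult.assoc)

lemma sqint_diff: "sqint M f \<Longrightarrow> sqint M g \<Longrightarrow> sqint M (\<lambda>x. f x - g x)"
  using sqint_add[of M f "\<lambda>x. -1 * g x"] sqint_cmult[of M g "-1"] by simp

lemma sqint_bounded_mult:
  assumes "sqint M f" "c \<in> borel_measurable M" "AE x in M. \<bar>c x\<bar> \<le> K"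
  shows "sqint M (\<lambda>x. c x * f x)"
  unfolding sqint_def
proof
  show meas: "(\<lambda>x. c x * f x) \<in> borel_measurable M"
    using assms by (auto simp: sqint_def)
  show "integrable M (\<lambda>x. (c x * f x)\<^sup>2)"
  proof (rule Bochner_Integration.integrable_bound)
    show "integrable M (\<lambda>x. K\<^sup>2 * (f x)\<^sup>2)"
      using assms by (auto simp: sqint_def)
    show "(\<lambda>x. (c x * f x)\<^sup>2) \<in> borel_measurable M"
      using meas by simp
    show "AE x in M. norm ((c x * f x)\<^sup>2) \<le> norm (K\<^sup>2 * (f x)\<^sup>2)"
      using assms(3)
    proof eventually_elim
      case (elim x)
      then have "(c x)\<^sup>2 \<le> K\<^sup>2"
        using abs_le_square_iff[of "c x" K] by auto
      then show ?case
        by (simp add: power_mult_distrib mult_right_mono)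
    qed
  qed
qed

lemma l2_cong_AE:
  assumes "f \<in> borel_measurable M" "g \<in> borel_measurable M" "AE x in M. f x = g x"
  shows "l2 M f = l2 M g"
  unfolding l2_def using assms by (auto intro!: integral_cong_AE arg_cong[where f=sqrt])

lemma l2_zero [simp]: "l2 M (\<lambda>x. 0) = 0"
  by (simp add: l2_def)

lemma l2_eq_0:
  assumes "sqint M f" "l2 M f = 0"
  shows "AE x in M. f x = 0"
proof -
  have "(LINT x|M. (f x)\<^sup>2) = 0" using assms(2) by (simp add: l2_def)
  then have "AE x in M. (f x)\<^sup>2 = 0"
    using integral_nonneg_eq_0_iff_AE[of M "\<lambda>x. (f x)\<^sup>2"] assms(1)
    by (auto simp: sqint_def)
  then show ?thesis by simp
qed

lemma l2_cmult: "l2 M (\<lambda>x. c * f x) = \<bar>c\<bar> * l2 M f"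
  by (simp add: l2_def power_mult_distrib real_sqrt_mult)

lemma l2_Cauchy_Schwarz:
  assumes f: "sqint M f" and g: "sqint M g"
  shows "\<bar>LINT x|M. f x * g x\<bar> \<le> l2 M f * l2 M g"
proof -
  have zero: "(LINT x|M. f x * g x) = 0" if "sqint M f" "l2 M f = 0" for f g
  proof -
    have "AE x in M. f x * g x = 0" using l2_eq_0[OF that] by auto
    then show ?thesis by (simp add: integral_eq_zero_AE)
  qed
  have le: "(LINT x|M. f x * g x) \<le> l2 M f * l2 M g"
    if f: "sqint M f" and g: "sqint M g" for f g
  proof (cases "l2 M f = 0 \<or> l2 M g = 0")
    case True
    then show ?thesis
      using zero[OF f, of g] zero[OF g, of f] by (auto simp: mult.commute)
  next
    case False
    define r s where "r = l2 M f" and "s = l2 M g"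
    have pos: "r > 0" "s > 0"
      using False l2_nonneg[of M f] l2_nonneg[of M g] unfolding r_def s_def by linarith+
    \<comment> \<open>Weighting each function by the norm of the other balances the expanded square
      and yields the sharp cross term; the final division by \<open>s * r\<close> is why zero norms
      were split off.\<close>
    have "0 \<le> (LINT x|M. (s * f x - r * g x)\<^sup>2)" by simp
    also have "(\<lambda>x. (s * f x - r * g x)\<^sup>2) =
        (\<lambda>x. s\<^sup>2 * (f x)\<^sup>2 - 2 * s * r * (f x * g x) + r\<^sup>2 * (g x)\<^sup>2)"
      by (auto simp: power2_eq_square algebra_simps)
    also have "(LINT x|M. s\<^sup>2 * (f x)\<^sup>2 - 2 * s * r * (f x * g x) + r\<^sup>2 * (g x)\<^sup>2) =
        s\<^sup>2 * r\<^sup>2 - 2 * s * r * (LINT x|M. f x * g x) + r\<^sup>2 * s\<^sup>2"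
      using f g sqint_mult[OF f g] by (simp add: sqint_def r_def s_def l2_sq)
    finally have "2 * s * r * (LINT x|M. f x * g x) \<le> 2 * s * r * (r * s)"
      by (simp add: power2_eq_square algebra_simps)
    then show ?thesis using pos unfolding r_def s_def by simp
  qed
  have "- (LINT x|M. f x * g x) \<le> l2 M f * l2 M g"
    using le[OF sqint_cmult[OF f, of "-1"] g] l2_cmult[of M "-1" f] by simp
  with le[OF f g] show ?thesis by linarith
qed

lemma l2_triangle:
  assumes f: "sqint M f" and g: "sqint M g"
  shows "l2 M (\<lambda>x. f x + g x) \<le> l2 M f + l2 M g"
proof -
  have "(l2 M (\<lambda>x. f x + g x))\<^sup>2 = (LINT x|M. (f x)\<^sup>2 + 2 * (f x * g x) + (g x)\<^sup>2)"
    unfolding l2_sq by (simp add: power2_sum algebra_simps)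
  also have "\<dots> = (l2 M f)\<^sup>2 + 2 * (LINT x|M. f x * g x) + (l2 M g)\<^sup>2"
    using f g sqint_mult[OF f g] by (simp add: sqint_def l2_sq)
  also have "\<dots> \<le> (l2 M f + l2 M g)\<^sup>2"
    using l2_Cauchy_Schwarz[OF f g] by (simp add: power2_sum)
  finally show ?thesis by (rule power2_le_imp_le) simp
qed

lemma (in finite_measure) sqint_integrable: "sqint M f \<Longrightarrow> integrable M f"
  by (auto simp: sqint_def intro: square_integrable_imp_integrable)

lemma (in finite_measure) sqint_const [simp]: "sqint M (\<lambda>x. c)"
  by (simp add: sqint_def)

lemma (in finite_measure) sqint_bounded:
  assumes "f \<in> borel_measurable M" "AE x in M. \<bar>f x\<bar> \<le> K"
  shows "sqint M f"
  using sqint_bounded_mult[OF sqint_const[of 1] assms] by simp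

text \<open>Riesz-Fischer on a finite measure space. Cauchy-Schwarz against 1 turns the L2 Cauchy
  property into an L1 one, which provides an almost everywhere convergent subsequence; Fatou's lemma
  then upgrades its pointwise limit to an L2 limit of the whole sequence.\<close>

lemma (in finite_measure) l2_complete:
  assumes f: "\<And>n::nat. sqint M (f n)"
    and cau: "\<And>e. e > 0 \<Longrightarrow> \<exists>N. \<forall>i\<ge>N. \<forall>j\<ge>N. l2 M (\<lambda>x. f i x - f j x) < e"
  obtains g where "sqint M g" "(\<lambda>n. l2 M (\<lambda>x. f n x - g x)) \<longlonglongrightarrow> 0"
proof -
  have [measurable]: "f n \<in> borel_measurable M" for n using f by (simp add: sqint_def)
  \<comment> \<open>The added 1 makes \<open>m\<close> positive even on a null space, so that
    \<open>e / m\<close> makes sense.\<close>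
  define m where "m = l2 M (\<lambda>_. 1) + 1"
  have "m > 0" by (simp add: m_def add_nonneg_pos)
  have "\<exists>N. \<forall>i\<ge>N. \<forall>j\<ge>N. LINT x|M. norm (f i x - f j x) < e" if "e > 0" for e
  proof -
    obtain N where N: "\<And>i j. i \<ge> N \<Longrightarrow> j \<ge> N \<Longrightarrow> l2 M (\<lambda>x. f i x - f j x) < e / m"
      using cau[of "e/m"] \<open>e > 0\<close> \<open>m > 0\<close> by auto
    have "(LINT x|M. norm (f i x - f j x)) < e" if "i \<ge> N" "j \<ge> N" for i j
    proof -
      have sq: "sqint M (\<lambda>x. \<bar>f i x - f j x\<bar>)"
        using sqint_diff[OF f f] by (simp add: sqint_def)
      have "(LINT x|M. norm (f i x - f j x)) \<le> l2 M (\<lambda>x. \<bar>f i x - f j x\<bar>) * l2 M (\<lambda>_. 1)"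
        using l2_Cauchy_Schwarz[OF sq sqint_const[of 1]] by simp
      also have "\<dots> \<le> l2 M (\<lambda>x. f i x - f j x) * m"
        by (auto simp: m_def l2_def intro!: mult_left_mono)
      also have "\<dots> < e / m * m"
        using N[OF that] \<open>m > 0\<close> by (intro mult_strict_right_mono) auto
      finally show ?thesis using \<open>m > 0\<close> by simp
    qed
    then show ?thesis by blast
  qed
  then obtain r where r: "strict_mono r" "AE x in M. Cauchy (\<lambda>i. f (r i) x)"
    using cauchy_L1_AE_cauchy_subseq[of M f] sqint_integrable[OF f] by blast
  define g where "g = (\<lambda>x. lim (\<lambda>i. f (r i) x))"
  have [measurable]: "g \<in> borel_measurable M"
    unfolding g_def by (rule borel_measurable_lim_metric) simp
  have lim: "AE x in M. (\<lambda>i. f (r i) x) \<longlonglongrightarrow> g x"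
    using r(2) by eventually_elim (simp add: g_def Cauchy_convergent_iff convergent_LIMSEQ_iff)
  have key: "\<exists>N. \<forall>n\<ge>N. (\<integral>\<^sup>+x. ennreal ((f n x - g x)\<^sup>2) \<partial>M) \<le> ennreal (e\<^sup>2)" if "e > 0" for e
  proof -
    obtain N where N: "\<And>i j. i \<ge> N \<Longrightarrow> j \<ge> N \<Longrightarrow> l2 M (\<lambda>x. f i x - f j x) < e"
      using cau[OF \<open>e > 0\<close>] by blast
    \<comment> \<open>The index \<open>n\<close> stays fixed while the other one runs along the
      subsequence, so Fatou gives the estimate for every \<open>n \<ge> N\<close> and not only for
      members of the subsequence.\<close>
    have "(\<integral>\<^sup>+x. ennreal ((f n x - g x)\<^sup>2) \<partial>M) \<le> ennreal (e\<^sup>2)" if "n \<ge> N" for n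
    proof -
      have "(\<integral>\<^sup>+x. ennreal ((f n x - g x)\<^sup>2) \<partial>M) =
          (\<integral>\<^sup>+x. liminf (\<lambda>j. ennreal ((f n x - f (r j) x)\<^sup>2)) \<partial>M)"
      proof (rule nn_integral_cong_AE)
        show "AE x in M. ennreal ((f n x - g x)\<^sup>2) = liminf (\<lambda>j. ennreal ((f n x - f (r j) x)\<^sup>2))"
          using lim
        proof eventually_elim
          case (elim x)
          then have "(\<lambda>j. ennreal ((f n x - f (r j) x)\<^sup>2)) \<longlonglongrightarrow> ennreal ((f n x - g x)\<^sup>2)"
            by (intro tendsto_ennrealI tendsto_intros)
          then show ?case
            using lim_imp_Liminf[OF sequentially_bot] by metis
        qed
      qed
      also have "\<dots> \<le> liminf (\<lambda>j. \<integral>\<^sup>+x. ennreal ((f n x - f (r j) x)\<^sup>2) \<partial>M)"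
        by (rule nn_integral_liminf) simp
      also have "\<dots> \<le> ennreal (e\<^sup>2)"
      proof (rule Liminf_le)
        show "\<forall>\<^sub>F j in sequentially. (\<integral>\<^sup>+x. ennreal ((f n x - f (r j) x)\<^sup>2) \<partial>M) \<le> ennreal (e\<^sup>2)"
          using eventually_ge_at_top[of N]
        proof eventually_elim
          case (elim j)
          then have "r j \<ge> N" using seq_suble[OF r(1), of j] by linarith
          have "(\<integral>\<^sup>+x. ennreal ((f n x - f (r j) x)\<^sup>2) \<partial>M) = ennreal ((l2 M (\<lambda>x. f n x - f (r j) x))\<^sup>2)"
            unfolding l2_sq using sqint_diff[OF f[of n] f[of "r j"]]
            by (intro nn_integral_eq_integral) (auto simp: sqint_def)
          also have "\<dots> \<le> ennreal (e\<^sup>2)"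
            using N[OF that \<open>r j \<ge> N\<close>] by (intro ennreal_leI power_mono) auto
          finally show ?case .
        qed
      qed simp
      finally show ?thesis .
    qed
    then show ?thesis by blast
  qed
  have sqd: "\<exists>N. \<forall>n\<ge>N. sqint M (\<lambda>x. f n x - g x) \<and> l2 M (\<lambda>x. f n x - g x) \<le> e" if "e > 0" for e
  proof -
    obtain N where N: "\<And>n. n \<ge> N \<Longrightarrow> (\<integral>\<^sup>+x. ennreal ((f n x - g x)\<^sup>2) \<partial>M) \<le> ennreal (e\<^sup>2)"
      using key[OF \<open>e > 0\<close>] by auto
    have "sqint M (\<lambda>x. f n x - g x) \<and> l2 M (\<lambda>x. f n x - g x) \<le> e" if "n \<ge> N" for n
    proof
      have "(\<integral>\<^sup>+x. ennreal (norm ((f n x - g x)\<^sup>2)) \<partial>M) < \<infinity>"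
        using N[OF that] by (simp add: le_less_trans)
      then show sq: "sqint M (\<lambda>x. f n x - g x)"
        unfolding sqint_def by (simp add: integrable_iff_bounded)
      have "ennreal (LINT x|M. (f n x - g x)\<^sup>2) \<le> ennreal (e\<^sup>2)"
        using N[OF that] nn_integral_eq_integral[of M "\<lambda>x. (f n x - g x)\<^sup>2"] sq
        by (simp add: sqint_def)
      then have "(l2 M (\<lambda>x. f n x - g x))\<^sup>2 \<le> e\<^sup>2"
        unfolding l2_sq by (simp add: ennreal_le_iff)
      then show "l2 M (\<lambda>x. f n x - g x) \<le> e"
        by (rule power2_le_imp_le) (use \<open>e > 0\<close> in simp)
    qed
    then show ?thesis by blast
  qed
  obtain N where "sqint M (\<lambda>x. f N x - g x)" using sqd[of 1] by auto
  from sqint_diff[OF f[of N] this] have "sqint M g" by simp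
  moreover have "(\<lambda>n. l2 M (\<lambda>x. f n x - g x)) \<longlonglongrightarrow> 0"
  proof (rule LIMSEQ_I)
    fix e :: real assume "e > 0"
    then obtain N where "\<forall>n\<ge>N. l2 M (\<lambda>x. f n x - g x) \<le> e/2" using sqd[of "e/2"] by auto
    then show "\<exists>N. \<forall>n\<ge>N. norm (l2 M (\<lambda>x. f n x - g x) - 0) < e"
      using \<open>e > 0\<close> by (intro exI[of _ N]) fastforce
  qed
  ultimately show ?thesis using that by blast
qed

lemma sqint_integral_tendsto:
  assumes "\<And>n. sqint M (f n)" "sqint M g" "sqint M h"
    and lim: "(\<lambda>n. l2 M (\<lambda>x. f n x - g x)) \<longlonglongrightarrow> 0"
  shows "(\<lambda>n. LINT x|M. f n x * h x) \<longlonglongrightarrow> (LINT x|M. g x * h x)"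
proof -
  have "(\<lambda>n. (LINT x|M. f n x * h x) - (LINT x|M. g x * h x)) \<longlonglongrightarrow> 0"
  proof (rule Lim_null_comparison)
    show "(\<lambda>n. l2 M (\<lambda>x. f n x - g x) * l2 M h) \<longlonglongrightarrow> 0"
      using tendsto_mult_left_zero[OF lim] .
    show "\<forall>\<^sub>F n in sequentially. norm ((LINT x|M. f n x * h x) - (LINT x|M. g x * h x))
            \<le> l2 M (\<lambda>x. f n x - g x) * l2 M h"
    proof (rule always_eventually, rule allI)
      fix n
      have "(LINT x|M. f n x * h x) - (LINT x|M. g x * h x) = (LINT x|M. (f n x - g x) * h x)"
        using sqint_mult[OF assms(1)[of n] assms(3)] sqint_mult[OF assms(2) assms(3)]
        by (simp add: left_diff_distrib)
      then show "norm ((LINT x|M. f n x * h x) - (LINT x|M. g x * h x)) \<le> l2 M (\<lambda>x. f n x - g x) * l2 M h"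
        using l2_Cauchy_Schwarz[OF sqint_diff[OF assms(1)[of n] assms(2)] assms(3)] by simp
    qed
  qed
  then show ?thesis by (simp add: LIM_zero_iff)
qed

section \<open>The unit cell\<close>

abbreviation cellM :: "(real^'d) measure" where
  "cellM \<equiv> lebesgue_on cellT"

lemma cellT_iff: "y \<in> cellT \<longleftrightarrow> (\<forall>i. 0 \<le> y $ i \<and> y $ i \<le> 1)"
proof -
  have "y \<in> cellT \<longleftrightarrow> (\<forall>b\<in>Basis. 0 \<le> y \<bullet> b \<and> y \<bullet> b \<le> 1)"
    by (simp add: cellT_def mem_box)
  then show ?thesis by (auto simp: Basis_vec_def inner_axis)
qed

lemma cellT_sets [simp]: "cellT \<in> sets lebesgue"
  by (simp add: cellT_def)

lemma cellT_lmeasurable [simp]: "cellT \<in> lmeasurable"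
  by (simp add: cellT_def)

lemma cellT_compact: "compact cellT"
  by (simp add: cellT_def)

lemma cellT_measure: "measure lebesgue (cellT :: (real^'d) set) = 1"
  by (simp add: cellT_def)

lemma cellM_finite: "finite_measure cellM"
  by (simp add: finite_measure_lebesgue_on)

interpretation cellM: finite_measure "cellM :: (real^'d) measure"
  by (rule cellM_finite)

lemma cellM_measure_space [simp]: "measure cellM (cellT :: (real^'d) set) = 1"
  using cellT_measure[where 'd='d] measure_restrict_space[of "cellT :: (real^'d) set" lebesgue cellT] by simp

lemma cellM_integral_const [simp]: "(LINT y|(cellM :: (real^'d) measure). c) = (c::real)"
  by simp

lemma intT_eq: "integrable cellM f \<Longrightarrow> intT f = (LINT y|cellM. f y)"
  unfolding intT_def by (simp add: lebesgue_integral_eq_integral)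

lemma L2T_iff: "L2T f \<longleftrightarrow> sqint cellM f"
proof
  assume f: "L2T f"
  then have m: "f \<in> borel_measurable cellM"
    by (simp add: L2T_def measurable_on_iff_borel_measurable)
  have "(\<lambda>y. (f y)\<^sup>2) absolutely_integrable_on cellT"
    using f by (intro nonnegative_absolutely_integrable_1) (auto simp: L2T_def)
  then have "integrable cellM (\<lambda>y. (f y)\<^sup>2)"
    by (simp add: integrable_restrict_space set_integrable_def)
  with m show "sqint cellM f" by (simp add: sqint_def)
next
  assume f: "sqint cellM f"
  then have "(\<lambda>y. (f y)\<^sup>2) integrable_on cellT"
    by (auto simp: sqint_def intro: integrable_on_lebesgue_on)
  with f show "L2T f"
    by (simp add: L2T_def measurable_on_iff_borel_measurable sqint_def)
qed

lemma cellM_continuous_measurable: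
  fixes f :: "real^'d \<Rightarrow> real"
  assumes "continuous_on UNIV f"
  shows "f \<in> borel_measurable cellM"
  using assms continuous_on_subset[OF assms subset_UNIV]
  by (intro continuous_imp_measurable_on_sets_lebesgue) auto

lemma continuous_bounded_cell:
  fixes f :: "real^'d \<Rightarrow> real"
  assumes "continuous_on UNIV f"
  obtains K where "\<And>y. y \<in> cellT \<Longrightarrow> \<bar>f y\<bar> \<le> K"
proof -
  have "compact (f ` cellT)"
    using assms cellT_compact by (intro compact_continuous_image) (auto intro: continuous_on_subset)
  then have "bounded (f ` cellT)" by (rule compact_imp_bounded)
  then show ?thesis using that by (auto simp: bounded_iff)
qed

lemma sqint_continuous:
  fixes f :: "real^'d \<Rightarrow> real"
  assumes "continuous_on UNIV f"
  shows "sqint cellM f"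
proof -
  obtain K where K: "\<And>y. y \<in> cellT \<Longrightarrow> \<bar>f y\<bar> \<le> K"
    using continuous_bounded_cell[OF assms] by blast
  show ?thesis
    by (rule cellM.sqint_bounded[OF cellM_continuous_measurable[OF assms]])
       (use K in \<open>auto intro!: AE_I2\<close>)
qed

lemma integrable_continuous_cell:
  fixes f :: "real^'d \<Rightarrow> real"
  shows "continuous_on UNIV f \<Longrightarrow> integrable cellM f"
  by (intro cellM.sqint_integrable sqint_continuous)

section \<open>Periodicity\<close>

lemma periodic_int:
  fixes g :: "real^'d \<Rightarrow> 'b"
  assumes "periodic g"
  shows "g (y + (\<chi> i. of_int (k i))) = g y"
proof -
  have nat: "g (y + real n *\<^sub>R axis i 1) = g y" for y i n
  proof (induction n)
    case (Suc n)
    have "y + real (Suc n) *\<^sub>R axis i 1 = (y + real n *\<^sub>R axis i 1) + axis i 1"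
      by (simp add: algebra_simps)
    then show ?case using Suc assms by (simp only: periodic_def)
  qed simp
  have int: "g (y + of_int m *\<^sub>R axis i 1) = g y" for y i m
  proof (cases "m \<ge> 0")
    case True
    then show ?thesis using nat[of y "nat m" i] by simp
  next
    case False
    then show ?thesis using nat[of "y + of_int m *\<^sub>R axis i 1" "nat (-m)" i]
      by simp
  qed
  have "g (y + (\<Sum>i\<in>A. of_int (k i) *\<^sub>R axis i 1)) = g y" if "finite A" for A y
    using that
  proof (induction A arbitrary: y)
    case (insert j A)
    have eq: "y + (\<Sum>i\<in>insert j A. of_int (k i) *\<^sub>R axis i 1) =
       (y + of_int (k j) *\<^sub>R axis j 1) + (\<Sum>i\<in>A. of_int (k i) *\<^sub>R axis i 1)"
      using insert by (simp add: add_ac)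
    show ?case by (simp only: eq insert.IH int)
  qed simp
  moreover have "(\<chi> i. of_int (k i)) = (\<Sum>i\<in>UNIV. of_int (k i) *\<^sub>R axis i (1::real))"
    by (simp add: vec_eq_iff sum.delta axis_def if_distrib cong: if_cong)
  ultimately show ?thesis by simp
qed

definition fracv :: "real^'d \<Rightarrow> real^'d" where
  "fracv y = (\<chi> i. frac (y $ i))"

lemma fracv_in_cell: "fracv y \<in> cellT"
  by (auto simp: cellT_iff fracv_def frac_lt_1 less_imp_le)

lemma periodic_fracv:
  assumes "periodic g"
  shows "g (fracv y) = g y"
proof -
  have "y = fracv y + (\<chi> i. of_int \<lfloor>y $ i\<rfloor>)"
    by (simp add: vec_eq_iff fracv_def frac_def)
  then show ?thesis using periodic_int[OF assms, of "fracv y" "\<lambda>i. \<lfloor>y $ i\<rfloor>"] by simp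
qed

lemma fracv_periodic: "periodic fracv"
  by (auto simp: periodic_def fracv_def vec_eq_iff axis_def frac_1_eq)

lemma negligible_cell_boundary: "negligible {y :: real^'d. \<exists>i. y $ i = 0 \<or> y $ i = 1}"
proof -
  have "negligible {y :: real^'d. y $ i = c}" for i c
    using negligible_standard_hyperplane[of "axis i 1 :: real^'d" c] by (simp add: inner_axis)
  then have "negligible (\<Union>i. {y :: real^'d. y $ i = 0} \<union> {y. y $ i = 1})"
    by (intro negligible_Union) auto
  moreover have "{y :: real^'d. \<exists>i. y $ i = 0 \<or> y $ i = 1} = (\<Union>i. {y. y $ i = 0} \<union> {y. y $ i = 1})"
    by auto
  ultimately show ?thesis by simp
qed

lemma AE_cellI: "AE y in lebesgue. P y \<Longrightarrow> AE y in cellM. P y"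
  by (auto simp: AE_restrict_space_iff elim: eventually_mono)

lemma AE_cell_interior:
  "AE y in cellM. \<forall>i. 0 < y $ i \<and> y $ i < (1::real)"
proof -
  have "AE y in lebesgue. \<not> (\<exists>i. y $ i = 0 \<or> y $ i = (1::real))"
    using negligible_cell_boundary
    by (auto simp: negligible_iff_null_sets dest!: AE_not_in)
  then have "AE y in lebesgue. y \<in> cellT \<longrightarrow> (\<forall>i. 0 < y $ i \<and> y $ i < (1::real))"
    by eventually_elim (auto simp: cellT_iff less_le)
  then show ?thesis
    by (simp add: AE_restrict_space_iff)
qed

text \<open>The expansion is asserted almost everywhere in the whole space while all integrals live
  on the cell. The exceptional set of a periodic property is covered by countably many integer
  translates of its part in the cell.\<close>

lemma AE_cell_iff_periodic:
  fixes P :: "real^'d \<Rightarrow> bool"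
  assumes "periodic P"
  shows "(AE y in cellM. P y) \<longleftrightarrow> (AE y in lebesgue. P y)"
proof
  assume "AE y in lebesgue. P y"
  then show "AE y in cellM. P y"
    by (auto simp: AE_restrict_space_iff)
next
  assume "AE y in cellM. P y"
  then have "AE y in lebesgue. y \<in> cellT \<longrightarrow> P y"
    by (simp add: AE_restrict_space_iff)
  then have N: "negligible {y. \<not> (y \<in> cellT \<longrightarrow> P y)}"
    by (auto simp: eventually_ae_filter simp flip: negligible_iff_null_sets intro: negligible_subset)
  have "{y. \<not> P y} \<subseteq> (\<Union>k::'d \<Rightarrow> int. (+) (\<chi> i. of_int (k i)) ` {y. \<not> (y \<in> cellT \<longrightarrow> P y)})"
  proof
    fix y assume y: "y \<in> {y. \<not> P y}"
    have "y = (\<chi> i. of_int \<lfloor>y $ i\<rfloor>) + fracv y"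
      by (simp add: vec_eq_iff fracv_def frac_def)
    moreover have "fracv y \<in> {y. \<not> (y \<in> cellT \<longrightarrow> P y)}"
      using y periodic_fracv[OF assms] fracv_in_cell by auto
    ultimately show "y \<in> (\<Union>k::'d \<Rightarrow> int. (+) (\<chi> i. of_int (k i)) ` {y. \<not> (y \<in> cellT \<longrightarrow> P y)})"
      by (intro UN_I[of "\<lambda>i. \<lfloor>y $ i\<rfloor>"]) auto
  qed
  moreover have "negligible (\<Union>k::'d \<Rightarrow> int. (+) (\<chi> i. of_int (k i)) ` {y. \<not> (y \<in> cellT \<longrightarrow> P y)})"
    by (intro negligible_countable_Union countable_image) (use negligible_translation[OF N] in auto)
  ultimately have "negligible {y. \<not> P y}" by (rule negligible_subset[rotated])
  then show "AE y in lebesgue. P y"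
    by (auto simp: eventually_ae_filter negligible_iff_null_sets)
qed

section \<open>Translation invariance of integrals over the cell\<close>

lemma lborel_integral_translate:
  fixes f :: "'a::euclidean_space \<Rightarrow> real"
  assumes "f \<in> borel_measurable borel"
  shows "(LINT y|lborel. f (y + c)) = (LINT y|lborel. f y)"
proof -
  have "(LINT y|lborel. f y) = (LINT y|distr lborel borel ((+) c). f y)"
    by (simp add: lborel_distr_plus)
  also have "\<dots> = (LINT y|lborel. f (c + y))"
    using assms by (intro integral_distr) auto
  finally show ?thesis by (simp add: add.commute)
qed

text \<open>Passing to the half-open cell costs a null set and makes integer translates disjoint, so
  that cutting and pasting pieces is exact.\<close>

lemma integral_cell_lborel:
  fixes f :: "real^'d \<Rightarrow> real"
  assumes "f \<in> borel_measurable borel"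
  shows "(LINT y|cellM. f y) = (LINT y|lborel. indicator {y. \<forall>i. 0 \<le> y $ i \<and> y $ i < 1} y * f y)"
proof -
  have [measurable]: "{y :: real^'d. \<forall>i. 0 \<le> y $ i \<and> y $ i < 1} \<in> sets borel"
    by measurable
  have [measurable]: "(cellT :: (real^'d) set) \<in> sets borel" by (simp add: cellT_def)
  have "(LINT y|cellM. f y) = (LINT y|lebesgue. indicator cellT y * f y)"
    by (simp add: integral_restrict_space)
  also have "\<dots> = (LINT y|lborel. indicator cellT y * f y)"
    using assms by (intro integral_completion) measurable
  also have "\<dots> = (LINT y|lborel. indicator {y. \<forall>i. 0 \<le> y $ i \<and> y $ i < 1} y * f y)"
  proof (rule integral_cong_AE)
    have "AE y in lebesgue. \<not> (\<exists>i. y $ i = 0 \<or> y $ i = (1::real))"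
      using negligible_cell_boundary
      by (auto simp: negligible_iff_null_sets dest!: AE_not_in)
    then have "AE y in lborel. \<not> (\<exists>i. y $ i = 0 \<or> y $ i = (1::real))"
      by (simp add: AE_completion_iff)
    then show "AE y in lborel. indicator cellT y * f y =
        indicator {y. \<forall>i. 0 \<le> y $ i \<and> y $ i < 1} y * f y"
      by eventually_elim (auto simp: cellT_iff indicator_def less_le)
  qed (use assms in measurable)
  finally show ?thesis .
qed

text \<open>Shifting the half-open cell by \<open>s\<close> along axis \<open>j\<close> cuts it at
  height \<open>1 - s\<close>: the lower piece lands on \<open>A\<close>, the upper piece leaves the
  cell and returns onto \<open>B\<close> after a unit translation that the periodic \<open>g\<close>
  does not notice.\<close>

lemma cell_integral_shift_axis:
  fixes g :: "real^'d \<Rightarrow> real"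
  assumes cont: "continuous_on UNIV g" and per: "periodic g" and s: "0 \<le> s" "s \<le> 1"
  shows "(LINT y|cellM. g (y + s *\<^sub>R axis j 1)) = (LINT y|cellM. g y)"
proof -
  have [measurable]: "g \<in> borel_measurable borel"
    using cont by (rule borel_measurable_continuous_onI)
  obtain K where K: "\<And>y. y \<in> cellT \<Longrightarrow> \<bar>g y\<bar> \<le> K"
    using continuous_bounded_cell[OF cont] by blast
  have K': "\<bar>g y\<bar> \<le> K" for y
    using K[OF fracv_in_cell] periodic_fracv[OF per] by metis
  define C where "C = {y :: real^'d. \<forall>i. 0 \<le> y $ i \<and> y $ i < 1}"
  define A where "A = {y \<in> C. s \<le> y $ j}"
  define B where "B = {y \<in> C. y $ j < s}"
  have [measurable]: "C \<in> sets borel" "A \<in> sets borel" "B \<in> sets borel"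
    unfolding A_def B_def C_def by measurable
  have "C \<subseteq> cellT" by (auto simp: C_def cellT_iff less_imp_le)
  then have sub: "A \<subseteq> cellT" "B \<subseteq> cellT" by (auto simp: A_def B_def)
  have int: "integrable lborel (\<lambda>y. indicator S y * g y)" if "S \<in> sets borel" "S \<subseteq> cellT" for S
  proof (rule Bochner_Integration.integrable_bound)
    have "emeasure lborel S < \<infinity>"
    proof -
      have "emeasure lborel S \<le> emeasure lborel (cellT :: (real^'d) set)"
        by (intro emeasure_mono that) (simp add: cellT_def)
      also have "\<dots> < \<infinity>" by (simp add: cellT_def emeasure_lborel_cbox_eq)
      finally show ?thesis .
    qed
    then show "integrable lborel (\<lambda>y. K * indicator S y)"
      using that by (simp add: integrable_real_indicator)
    show "(\<lambda>y. indicator S y * g y) \<in> borel_measurable lborel" using that by simp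
    show "AE y in lborel. norm (indicator S y * g y) \<le> norm (K * indicator S y)"
      using K' order_trans[OF K' abs_ge_self] by (auto simp: indicator_def)
  qed
  have shiftset: "(indicator C y :: real) = indicator A (y + s *\<^sub>R axis j 1) + indicator B (y + s *\<^sub>R axis j 1 - axis j 1 :: real^'d)"
    for y :: "real^'d"
  proof -
    have comp: "(y + s *\<^sub>R axis j 1) $ i = (if i = j then y $ j + s else y $ i)" 
       "(y + s *\<^sub>R axis j 1 - axis j 1) $ i = (if i = j then y $ j + s - 1 else y $ i)" for i
      by (auto simp: axis_def)
    define R where "R \<longleftrightarrow> (\<forall>i. i \<noteq> j \<longrightarrow> 0 \<le> y $ i \<and> y $ i < 1)"
    have "y \<in> C \<longleftrightarrow> R \<and> 0 \<le> y $ j \<and> y $ j < 1"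
      unfolding C_def R_def by auto
    moreover have "y + s *\<^sub>R axis j 1 \<in> A \<longleftrightarrow> R \<and> 0 \<le> y $ j \<and> y $ j + s < 1"
      unfolding A_def C_def R_def mem_Collect_eq comp using s by (auto split: if_splits)
    moreover have "y + s *\<^sub>R axis j 1 - axis j 1 \<in> B \<longleftrightarrow> R \<and> 1 \<le> y $ j + s \<and> y $ j < 1"
      unfolding B_def C_def R_def mem_Collect_eq comp using s by (auto split: if_splits)
    ultimately have iff: "y \<in> C \<longleftrightarrow> y + s *\<^sub>R axis j 1 \<in> A \<or> y + s *\<^sub>R axis j 1 - axis j 1 \<in> B"
      "\<not> (y + s *\<^sub>R axis j 1 \<in> A \<and> y + s *\<^sub>R axis j 1 - axis j 1 \<in> B)"
      using s by auto
    show ?thesis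
      using iff by (auto simp: indicator_def)
  qed
  have "(LINT y|cellM. g (y + s *\<^sub>R axis j 1)) = (LINT y|lborel. indicator C y * g (y + s *\<^sub>R axis j 1))"
    unfolding C_def by (rule integral_cell_lborel) measurable
  also have "\<dots> = (LINT y|lborel. (\<lambda>z. indicator A z * g z + indicator B (z - axis j 1) * g (z - axis j 1)) (y + s *\<^sub>R axis j 1))"
  proof (rule Bochner_Integration.integral_cong[OF refl])
    fix y :: "real^'d"
    have "g (y + s *\<^sub>R axis j 1 - axis j 1) = g (y + s *\<^sub>R axis j 1)"
      using per[unfolded periodic_def, rule_format, of "y + s *\<^sub>R axis j 1 - axis j 1" j] by simp
    then show "indicator C y * g (y + s *\<^sub>R axis j 1) = (\<lambda>z. indicator A z * g z + indicator B (z - axis j 1) * g (z - axis j 1)) (y + s *\<^sub>R axis j 1)"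
      by (simp only: shiftset distrib_right)
  qed
  also have "\<dots> = (LINT z|lborel. indicator A z * g z + indicator B (z - axis j 1) * g (z - axis j 1))"
    by (rule lborel_integral_translate) measurable
  also have "\<dots> = (LINT z|lborel. indicator A (z + axis j 1) * g (z + axis j 1) + indicator B z * g z)"
    by (subst lborel_integral_translate[symmetric, where c = "axis j 1"]) simp_all
  also have "\<dots> = (LINT z|lborel. indicator A (z + axis j 1) * g (z + axis j 1)) + (LINT z|lborel. indicator B z * g z)"
  proof (rule Bochner_Integration.integral_add)
    have "integrable (distr lborel borel ((+) (axis j 1))) (\<lambda>z. indicator A z * g z)"
      using int[of A] sub by (simp add: lborel_distr_plus)
    then show "integrable lborel (\<lambda>z. indicator A (z + axis j 1) * g (z + axis j 1))"
      by (subst (asm) integrable_distr_eq) (auto simp: add.commute)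
  qed (use int[of B] sub in auto)
  also have "(LINT z|lborel. indicator A (z + axis j 1) * g (z + axis j 1)) = (LINT z|lborel. indicator A z * g z)"
    by (rule lborel_integral_translate) measurable
  also have "(LINT z|lborel. indicator A z * g z) + (LINT z|lborel. indicator B z * g z) =
      (LINT z|lborel. indicator A z * g z + indicator B z * g z)"
    using int[of A] int[of B] sub by simp
  also have "\<dots> = (LINT z|lborel. indicator C z * g z)"
    by (rule Bochner_Integration.integral_cong) (auto simp: A_def B_def indicator_def)
  also have "\<dots> = (LINT y|cellM. g y)"
    unfolding C_def by (rule integral_cell_lborel[symmetric]) measurable
  finally show ?thesis .
qed

lemma continuous_shift:
  fixes g :: "real^'d \<Rightarrow> real"
  shows "continuous_on UNIV g \<Longrightarrow> continuous_on UNIV (\<lambda>y. g (y + h))"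
  by (rule continuous_on_compose2[of UNIV g]) (auto intro!: continuous_intros)

lemma periodic_shift: "periodic g \<Longrightarrow> periodic (\<lambda>y. g (y + h))"
  unfolding periodic_def by (metis add.assoc add.commute)

lemma vec_sum_axis: "(\<Sum>i\<in>UNIV. h $ i *\<^sub>R axis i 1) = (h :: real^'d)"
  by (simp add: vec_eq_iff axis_def if_distrib sum.delta cong: if_cong)

lemma cell_integral_shift:
  fixes g :: "real^'d \<Rightarrow> real"
  assumes cont: "continuous_on UNIV g" and per: "periodic g" and h: "h \<in> cellT"
  shows "(LINT y|cellM. g (y + h)) = (LINT y|cellM. g y)"
proof -
  have "(LINT y|cellM. g (y + (\<Sum>i\<in>A. h $ i *\<^sub>R axis i 1))) = (LINT y|cellM. g y)" if "finite A" for A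
    using that
  proof (induction A)
    case (insert j A)
    have "(LINT y|cellM. g (y + (\<Sum>i\<in>insert j A. h $ i *\<^sub>R axis i 1))) =
      (LINT y|cellM. (\<lambda>z. g (z + (\<Sum>i\<in>A. h $ i *\<^sub>R axis i 1))) (y + h $ j *\<^sub>R axis j 1))"
      using insert by (simp add: add_ac)
    also have "\<dots> = (LINT y|cellM. g (y + (\<Sum>i\<in>A. h $ i *\<^sub>R axis i 1)))"
      using h by (intro cell_integral_shift_axis continuous_shift cont periodic_shift per) (auto simp: cellT_iff)
    finally show ?case using insert.IH by simp
  qed simp
  from this[of UNIV] show ?thesis by (simp add: vec_sum_axis)
qed

section \<open>Test functions\<close>

lemma testfun_periodic: "testfun \<phi> \<Longrightarrow> periodic \<phi>"
  and testfun_tpd_cont: "testfun \<phi> \<Longrightarrow> continuous_on UNIV (tpd i \<phi>)"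
  by (simp_all add: testfun_def)

text \<open>\<open>testfun\<close> speaks of derivatives at the base point of a line only; rebasing
  the line at \<open>y + s *\<^sub>R axis i 1\<close> gives them along all of it.\<close>

lemma testfun_has_derivative:
  assumes "testfun \<phi>"
  shows "((\<lambda>r. \<phi> (y + r *\<^sub>R axis i 1)) has_real_derivative tpd i \<phi> (y + s *\<^sub>R axis i 1)) (at s)"
proof -
  have "(\<lambda>r. \<phi> ((y + s *\<^sub>R axis i 1) + r *\<^sub>R axis i 1)) differentiable (at 0)"
    using assms by (simp add: testfun_def)
  then have "((\<lambda>r. \<phi> ((y + s *\<^sub>R axis i 1) + r *\<^sub>R axis i 1)) has_real_derivative tpd i \<phi> (y + s *\<^sub>R axis i 1)) (at 0)"
    unfolding tpd_def by (simp add: DERIV_deriv_iff_real_differentiable)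
  then have "((\<lambda>r. \<phi> ((y + s *\<^sub>R axis i 1) + (r - s) *\<^sub>R axis i 1)) has_real_derivative tpd i \<phi> (y + s *\<^sub>R axis i 1)) (at (s + 0))"
    using DERIV_shift[of "\<lambda>r. \<phi> ((y + s *\<^sub>R axis i 1) + (r - s) *\<^sub>R axis i 1)" _ 0 s]
    by (simp add: add.commute)
  then show ?thesis by (simp add: algebra_simps)
qed

lemma tpd_eqI:
  assumes "((\<lambda>s. \<phi> (y + s *\<^sub>R axis i 1)) has_real_derivative D) (at 0)"
  shows "tpd i \<phi> y = D"
  unfolding tpd_def by (rule DERIV_imp_deriv[OF assms])

lemma testfunI:
  assumes "periodic \<phi>" "\<And>i. continuous_on UNIV (D i)"
    and "\<And>i y. ((\<lambda>s. \<phi> (y + s *\<^sub>R axis i 1)) has_real_derivative D i y) (at 0)"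
  shows "testfun \<phi>" "tpd i \<phi> = D i"
proof -
  show *: "tpd i \<phi> = D i" for i using tpd_eqI[OF assms(3)] by blast
  show "testfun \<phi>"
    unfolding testfun_def * using assms by (auto simp: real_differentiable_def)
qed

lemma testfun_has_derivative_0:
  "testfun \<phi> \<Longrightarrow> ((\<lambda>s. \<phi> (y + s *\<^sub>R axis i 1)) has_real_derivative tpd i \<phi> y) (at 0)"
  using testfun_has_derivative[of \<phi> y i 0] by simp

lemma testfun_add:
  assumes "testfun \<phi>" "testfun \<psi>"
  shows "testfun (\<lambda>y. \<phi> y + \<psi> y)" "tpd i (\<lambda>y. \<phi> y + \<psi> y) = (\<lambda>y. tpd i \<phi> y + tpd i \<psi> y)"
proof -
  have *: "periodic (\<lambda>y. \<phi> y + \<psi> y)" using assms by (auto simp: testfun_def periodic_def)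
  have **: "continuous_on UNIV (\<lambda>y. tpd i \<phi> y + tpd i \<psi> y)" for i
    using assms by (intro continuous_intros) (auto simp: testfun_def)
  have ***: "((\<lambda>s. \<phi> (y + s *\<^sub>R axis i 1) + \<psi> (y + s *\<^sub>R axis i 1)) has_real_derivative tpd i \<phi> y + tpd i \<psi> y) (at 0)" for y i
    by (intro DERIV_add testfun_has_derivative_0 assms)
  show "testfun (\<lambda>y. \<phi> y + \<psi> y)" "tpd i (\<lambda>y. \<phi> y + \<psi> y) = (\<lambda>y. tpd i \<phi> y + tpd i \<psi> y)"
    by (rule testfunI[OF * ** ***])+
qed

lemma testfun_const: "testfun (\<lambda>y. c)" "tpd i (\<lambda>y. c) = (\<lambda>y. 0)"
proof -
  have *: "periodic (\<lambda>y. c)" by (auto simp: periodic_def)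
  have **: "continuous_on UNIV (\<lambda>y. 0::real)" by simp
  show "testfun (\<lambda>y. c)" "tpd i (\<lambda>y. c) = (\<lambda>y. 0)"
    by (rule testfunI[OF * **]; simp)+
qed

lemma tpd_periodic:
  assumes "testfun \<phi>"
  shows "periodic (tpd i \<phi>)"
  unfolding tpd_def[abs_def] using periodic_shift[OF testfun_periodic[OF assms]]
  by (auto simp: periodic_def)

text \<open>\<open>testfun\<close> asks for continuity of the partial derivatives only. By
  periodicity they are bounded, so the mean value theorem along the axes, one coordinate at a time,
  yields a Lipschitz estimate.\<close>

lemma testfun_cont:
  fixes \<phi> :: "real^'d \<Rightarrow> real"
  assumes "testfun \<phi>"
  shows "continuous_on UNIV \<phi>"
proof -
  have "\<exists>K. \<forall>y. \<bar>tpd i \<phi> y\<bar> \<le> K" for i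
    using continuous_bounded_cell[OF testfun_tpd_cont[OF assms, of i]]
    by (metis periodic_fracv[OF tpd_periodic[OF assms]] fracv_in_cell)
  then obtain K where K: "\<And>i y. \<bar>tpd i \<phi> y\<bar> \<le> K i" by metis
  have one: "\<bar>\<phi> (y + s *\<^sub>R axis i 1) - \<phi> y\<bar> \<le> K i * \<bar>s\<bar>" for y s i
  proof -
    have "norm (\<phi> (y + s *\<^sub>R axis i 1) - \<phi> (y + 0 *\<^sub>R axis i 1)) \<le> K i * norm (s - 0)"
      by (rule field_differentiable_bound[of UNIV "\<lambda>r. \<phi> (y + r *\<^sub>R axis i 1)" "\<lambda>r. tpd i \<phi> (y + r *\<^sub>R axis i 1)"])
         (use testfun_has_derivative[OF assms] K in auto)
    then show ?thesis by simp
  qed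
  have *: "\<bar>\<phi> (y + (\<Sum>i\<in>A. h $ i *\<^sub>R axis i 1)) - \<phi> y\<bar> \<le> (\<Sum>i\<in>A. K i * \<bar>h $ i\<bar>)" if "finite A" for A y h
    using that
  proof (induction A arbitrary: y)
    case (insert j A)
    have eq: "y + (\<Sum>i\<in>insert j A. h $ i *\<^sub>R axis i 1) = (y + h $ j *\<^sub>R axis j 1) + (\<Sum>i\<in>A. h $ i *\<^sub>R axis i 1)"
      using insert by (simp add: add_ac)
    show ?case
      using insert.IH[of "y + h $ j *\<^sub>R axis j 1"] one[of y "h $ j" j] insert.hyps
      unfolding eq by simp
  qed simp
  have bound: "\<bar>\<phi> (y + h) - \<phi> y\<bar> \<le> (\<Sum>i\<in>UNIV. K i * \<bar>h $ i\<bar>)" for y h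
    using *[of UNIV y h] by (simp add: vec_sum_axis)
  have "(\<phi> \<longlongrightarrow> \<phi> y) (at y)" for y
  proof -
    have "((\<lambda>h. \<Sum>i\<in>UNIV. K i * \<bar>h $ i\<bar>) \<longlongrightarrow> (\<Sum>i\<in>UNIV. K i * \<bar>(0::real^'d) $ i\<bar>)) (at 0)"
      by (intro tendsto_intros)
    then have lim: "((\<lambda>h::real^'d. \<Sum>i\<in>UNIV. K i * \<bar>h $ i\<bar>) \<longlongrightarrow> 0) (at 0)" by simp
    have "((\<lambda>h. \<phi> (y + h) - \<phi> y) \<longlongrightarrow> 0) (at 0)"
      by (rule Lim_null_comparison[OF _ lim]) (use bound[of y] in simp)
    then have "((\<lambda>h. \<phi> (y + h)) \<longlongrightarrow> \<phi> y) (at 0)" by (rule LIM_zero_cancel)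
    then show ?thesis by (rule LIM_offset_zero_cancel)
  qed
  then show ?thesis by (simp add: continuous_on_def)
qed

lemma testfun_mult:
  assumes "testfun \<phi>" "testfun \<psi>"
  shows "testfun (\<lambda>y. \<phi> y * \<psi> y)" "tpd i (\<lambda>y. \<phi> y * \<psi> y) = (\<lambda>y. tpd i \<phi> y * \<psi> y + tpd i \<psi> y * \<phi> y)"
proof -
  have *: "periodic (\<lambda>y. \<phi> y * \<psi> y)" using assms by (auto simp: testfun_def periodic_def)
  have **: "continuous_on UNIV (\<lambda>y. tpd i \<phi> y * \<psi> y + tpd i \<psi> y * \<phi> y)" for i
    using assms by (intro continuous_intros testfun_cont testfun_tpd_cont)
  have ***: "((\<lambda>s. \<phi> (y + s *\<^sub>R axis i 1) * \<psi> (y + s *\<^sub>R axis i 1)) has_real_derivative tpd i \<phi> y * \<psi> y + tpd i \<psi> y * \<phi> y) (at 0)" for y i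
    using DERIV_mult[OF testfun_has_derivative_0[OF assms(1), of y i] testfun_has_derivative_0[OF assms(2), of y i]]
    by (simp add: algebra_simps)
  show "testfun (\<lambda>y. \<phi> y * \<psi> y)" "tpd i (\<lambda>y. \<phi> y * \<psi> y) = (\<lambda>y. tpd i \<phi> y * \<psi> y + tpd i \<psi> y * \<phi> y)"
    by (rule testfunI[OF * ** ***])+
qed

lemma testfun_cmult:
  assumes "testfun \<phi>"
  shows "testfun (\<lambda>y. c * \<phi> y)" "tpd i (\<lambda>y. c * \<phi> y) = (\<lambda>y. c * tpd i \<phi> y)"
  using testfun_mult[OF testfun_const(1)[of c] assms] by (simp_all add: testfun_const mult.commute)

lemma testfun_diff:
  assumes "testfun \<phi>" "testfun \<psi>"
  shows "testfun (\<lambda>y. \<phi> y - \<psi> y)" "tpd i (\<lambda>y. \<phi> y - \<psi> y) = (\<lambda>y. tpd i \<phi> y - tpd i \<psi> y)"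
  using testfun_add[OF assms(1) testfun_cmult(1)[OF assms(2), of "-1"]] testfun_cmult(2)[OF assms(2), of _ "-1"]
  by (simp_all)

text \<open>Difference quotients have integral zero by shift invariance; the mean value theorem
  bounds them by a bound of the derivative, and dominated convergence passes to the limit.\<close>

lemma testfun_tpd_integral:
  fixes \<phi> :: "real^'d \<Rightarrow> real"
  assumes "testfun \<phi>"
  shows "(LINT y|cellM. tpd i \<phi> y) = 0"
proof -
  have cont: "continuous_on UNIV \<phi>" by (rule testfun_cont[OF assms])
  obtain K where K: "\<And>y. y \<in> cellT \<Longrightarrow> \<bar>tpd i \<phi> y\<bar> \<le> K"
    using continuous_bounded_cell[OF testfun_tpd_cont[OF assms, of i]] by blast
  then have K: "\<And>y. \<bar>tpd i \<phi> y\<bar> \<le> K" 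
    by (metis periodic_fracv[OF tpd_periodic[OF assms]] fracv_in_cell)
  \<comment> \<open>The step sizes are at most 1, the range in which
    \<open>cell_integral_shift_axis\<close> applies.\<close>
  define q where "q = (\<lambda>n y. (\<phi> (y + inverse (real (Suc n)) *\<^sub>R axis i 1) - \<phi> y) / inverse (real (Suc n)))"
  have "(\<lambda>n. LINT y|cellM. q n y) \<longlonglongrightarrow> (LINT y|cellM. tpd i \<phi> y)"
  proof (rule integral_dominated_convergence)
    show "tpd i \<phi> \<in> borel_measurable cellM"
      by (intro cellM_continuous_measurable testfun_tpd_cont assms)
    show "q n \<in> borel_measurable cellM" for n
      unfolding q_def by (intro cellM_continuous_measurable continuous_intros continuous_shift cont) auto
    show "integrable cellM (\<lambda>y :: real^'d. K)" by simp
    show "AE y in cellM. (\<lambda>n. q n y) \<longlonglongrightarrow> tpd i \<phi> y"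
    proof (rule AE_I2)
      fix y
      have "((\<lambda>h. (\<phi> (y + h *\<^sub>R axis i 1) - \<phi> y) / h) \<longlongrightarrow> tpd i \<phi> y) (at 0)"
        using testfun_has_derivative_0[OF assms, of y i] by (simp add: DERIV_def)
      moreover have "filterlim (\<lambda>n. inverse (real (Suc n))) (at 0) sequentially"
        unfolding filterlim_at using LIMSEQ_inverse_real_of_nat by auto
      ultimately show "(\<lambda>n. q n y) \<longlonglongrightarrow> tpd i \<phi> y"
        unfolding q_def by (rule filterlim_compose)
    qed
    show "AE y in cellM. norm (q n y) \<le> K" for n
    proof (rule AE_I2)
      fix y
      let ?s = "inverse (real (Suc n))"
      have "norm (\<phi> (y + ?s *\<^sub>R axis i 1) - \<phi> (y + 0 *\<^sub>R axis i 1)) \<le> K * norm (?s - 0)"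
        by (rule field_differentiable_bound[of UNIV "\<lambda>r. \<phi> (y + r *\<^sub>R axis i 1)" "\<lambda>r. tpd i \<phi> (y + r *\<^sub>R axis i 1)"])
           (use testfun_has_derivative[OF assms] K in auto)
      then have "\<bar>\<phi> (y + ?s *\<^sub>R axis i 1) - \<phi> y\<bar> / ?s \<le> K"
        by (subst pos_divide_le_eq) simp_all
      moreover have "norm (q n y) = \<bar>\<phi> (y + ?s *\<^sub>R axis i 1) - \<phi> y\<bar> / ?s"
        unfolding q_def real_norm_def abs_divide by simp
      ultimately show "norm (q n y) \<le> K" by linarith
    qed
  qed
  moreover have "(LINT y|cellM. q n y) = 0" for n
  proof -
    have "(LINT y|cellM. q n y) = ((LINT y|cellM. \<phi> (y + inverse (real (Suc n)) *\<^sub>R axis i 1)) - (LINT y|cellM. \<phi> y)) / inverse (real (Suc n))"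
      unfolding q_def
      using integrable_continuous_cell[OF continuous_shift[OF cont]] integrable_continuous_cell[OF cont]
      by simp
    also have "\<dots> = 0"
      using cell_integral_shift_axis[OF cont testfun_periodic[OF assms], of "inverse (real (Suc n))" i]
      by (simp add: inverse_le_1_iff)
    finally show ?thesis .
  qed
  ultimately show ?thesis by (simp add: LIMSEQ_const_iff)
qed

lemma testfun_by_parts:
  fixes \<phi> :: "real^'d \<Rightarrow> real"
  assumes "testfun \<phi>" "testfun \<psi>"
  shows "(LINT y|cellM. \<phi> y * tpd i \<psi> y) = - (LINT y|cellM. tpd i \<phi> y * \<psi> y)"
proof -
  have "(LINT y|cellM. tpd i \<phi> y * \<psi> y + tpd i \<psi> y * \<phi> y) = 0"
    using testfun_tpd_integral[OF testfun_mult(1)[OF assms], of i] unfolding testfun_mult(2)[OF assms] .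
  moreover have "integrable cellM (\<lambda>y. tpd i \<phi> y * \<psi> y)" "integrable cellM (\<lambda>y. tpd i \<psi> y * \<phi> y)"
    by (intro integrable_continuous_cell continuous_intros testfun_cont testfun_tpd_cont assms)+
  ultimately show ?thesis by (simp add: mult.commute)
qed

section \<open>The Poincare inequality for test functions\<close>

text \<open>Cauchy-Schwarz against the constant 1 on an interval of length \<open>s \<le> 1\<close>,
  followed by enlarging the interval, so that the bound no longer depends on
  \<open>s\<close>.\<close>

lemma integral_square_le:
  fixes f :: "real \<Rightarrow> real"
  assumes "continuous_on UNIV f" "0 \<le> s" "s \<le> 1"
  shows "(integral {0..s} f)\<^sup>2 \<le> integral {0..1} (\<lambda>r. (f r)\<^sup>2)"
proof -
  have cont: "continuous_on S f" for S using assms(1) continuous_on_subset by blast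
  let ?M = "lebesgue_on {0..s}"
  have meas: "f \<in> borel_measurable ?M"
    by (intro continuous_imp_measurable_on_sets_lebesgue cont) auto
  have int: "integrable ?M g" if "continuous_on {0..s} g" for g :: "real \<Rightarrow> real"
    using absolutely_integrable_continuous_real[OF that] 
    by (simp add: integrable_restrict_space set_integrable_def)
  have sq: "sqint ?M f" "sqint ?M (\<lambda>_. 1)"
    by (auto simp: sqint_def meas intro!: int continuous_intros cont)
  have m: "measure ?M (space ?M) = s"
    using assms by (simp add: measure_restrict_space)
  have "\<bar>LINT r|?M. 1 * f r\<bar> \<le> l2 ?M (\<lambda>_. 1) * l2 ?M f"
    by (rule l2_Cauchy_Schwarz[OF sq(2,1)])
  also have "l2 ?M (\<lambda>_. 1) \<le> 1"
    using m assms by (simp add: l2_def)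
  finally have "\<bar>LINT r|?M. f r\<bar> \<le> l2 ?M f" by (simp add: mult_right_mono)
  then have "(LINT r|?M. f r)\<^sup>2 \<le> (l2 ?M f)\<^sup>2"
    using abs_le_square_iff[of "LINT r|?M. f r" "l2 ?M f"] by simp
  also have "\<dots> = integral {0..s} (\<lambda>r. (f r)\<^sup>2)"
    unfolding l2_sq by (intro lebesgue_integral_eq_integral int continuous_intros cont) auto
  also have "\<dots> \<le> integral {0..1} (\<lambda>r. (f r)\<^sup>2)"
    using assms by (intro integral_subset_le integrable_continuous_real continuous_intros cont) auto
  also have "(LINT r|?M. f r) = integral {0..s} f"
    by (intro lebesgue_integral_eq_integral int cont) auto
  finally show ?thesis .
qed

text \<open>The increment is the integral of the partial derivative over a segment of length at most
  1. After squaring and exchanging the two integrals, shift invariance makes the inner one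
  independent of the position on the segment, so the constant is 1.\<close>

lemma testfun_shift_axis_l2:
  fixes \<phi> :: "real^'d \<Rightarrow> real"
  assumes "testfun \<phi>" "0 \<le> s" "s \<le> 1"
  shows "l2 cellM (\<lambda>y. \<phi> (y + s *\<^sub>R axis i 1) - \<phi> y) \<le> l2 cellM (tpd i \<phi>)"
proof (rule power2_le_imp_le)
  have cont: "continuous_on UNIV \<phi>" "continuous_on UNIV (tpd i \<phi>)"
    by (intro testfun_cont testfun_tpd_cont assms)+
  have contr: "continuous_on UNIV (\<lambda>r. tpd i \<phi> (y + r *\<^sub>R axis i 1))" for y
    by (rule continuous_on_compose2[OF cont(2)]) (auto intro!: continuous_intros)
  have ftc: "\<phi> (y + s *\<^sub>R axis i 1) - \<phi> y = integral {0..s} (\<lambda>r. tpd i \<phi> (y + r *\<^sub>R axis i 1))" for y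
  proof -
    have "((\<lambda>r. tpd i \<phi> (y + r *\<^sub>R axis i 1)) has_integral
        (\<phi> (y + s *\<^sub>R axis i 1) - \<phi> (y + 0 *\<^sub>R axis i 1))) {0..s}"
      using assms testfun_has_derivative[OF assms(1)]
      by (intro fundamental_theorem_of_calculus)
         (auto simp: has_real_derivative_iff_has_vector_derivative[symmetric] intro: has_field_derivative_at_within)
    then show ?thesis by (simp add: integral_unique)
  qed
  have c2: "continuous_on UNIV (\<lambda>p::(real^'d) \<times> real. (tpd i \<phi> (fst p + snd p *\<^sub>R axis i 1))\<^sup>2)"
    by (intro continuous_intros continuous_on_compose2[OF cont(2)]) auto
  have per2: "periodic (\<lambda>y. (tpd i \<phi> y)\<^sup>2)"
    using tpd_periodic[OF assms(1)] by (simp add: periodic_def)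
  have cont2: "continuous_on UNIV (\<lambda>y. (tpd i \<phi> y)\<^sup>2)" by (intro continuous_intros cont)
  have cI: "continuous_on cellT (\<lambda>y. integral (cbox 0 1) (\<lambda>r. (tpd i \<phi> (y + r *\<^sub>R axis i 1))\<^sup>2))"
    unfolding cellT_def
    by (rule integral_continuous_on_param) (use continuous_on_subset[OF c2 subset_UNIV] in \<open>simp add: case_prod_beta\<close>)
  have iI: "(\<lambda>y. integral {0..1} (\<lambda>r. (tpd i \<phi> (y + r *\<^sub>R axis i 1))\<^sup>2)) integrable_on cellT"
    using integrable_continuous[of 0 One "\<lambda>y. integral {0..1} (\<lambda>r. (tpd i \<phi> (y + r *\<^sub>R axis i 1))\<^sup>2)"] cI
    by (simp add: cellT_def)
  have cL: "continuous_on UNIV (\<lambda>y. (\<phi> (y + s *\<^sub>R axis i 1) - \<phi> y)\<^sup>2)"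
    by (intro continuous_intros continuous_shift cont)
  have "(l2 cellM (\<lambda>y. \<phi> (y + s *\<^sub>R axis i 1) - \<phi> y))\<^sup>2 = integral cellT (\<lambda>y. (\<phi> (y + s *\<^sub>R axis i 1) - \<phi> y)\<^sup>2)"
    unfolding l2_sq by (intro lebesgue_integral_eq_integral integrable_continuous_cell cL) auto
  also have "\<dots> \<le> integral cellT (\<lambda>y. integral {0..1} (\<lambda>r. (tpd i \<phi> (y + r *\<^sub>R axis i 1))\<^sup>2))"
  proof (rule Henstock_Kurzweil_Integration.integral_le)
    show "(\<lambda>y. (\<phi> (y + s *\<^sub>R axis i 1) - \<phi> y)\<^sup>2) integrable_on cellT"
      by (intro integrable_on_lebesgue_on integrable_continuous_cell cL) auto
  qed (use iI ftc integral_square_le[OF contr assms(2,3)] in auto)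
  also have "\<dots> = integral (cbox 0 1) (\<lambda>r. integral cellT (\<lambda>y. (tpd i \<phi> (y + r *\<^sub>R axis i 1))\<^sup>2))"
    unfolding cellT_def box_real[symmetric]
    by (rule integral_swap_continuous) (use continuous_on_subset[OF c2 subset_UNIV] in \<open>simp add: case_prod_beta\<close>)
  also have "\<dots> = integral (cbox 0 1) (\<lambda>r::real. (l2 cellM (tpd i \<phi>))\<^sup>2)"
  proof (rule Henstock_Kurzweil_Integration.integral_cong)
    fix r :: real assume r: "r \<in> cbox 0 1"
    have "integral cellT (\<lambda>y. (tpd i \<phi> (y + r *\<^sub>R axis i 1))\<^sup>2) = (LINT y|cellM. (tpd i \<phi> (y + r *\<^sub>R axis i 1))\<^sup>2)"
      by (intro lebesgue_integral_eq_integral[symmetric] integrable_continuous_cell continuous_shift[OF cont2]) auto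
    also have "\<dots> = (LINT y|cellM. (tpd i \<phi> y)\<^sup>2)"
      using r by (intro cell_integral_shift_axis[OF cont2 per2]) auto
    finally show "integral cellT (\<lambda>y. (tpd i \<phi> (y + r *\<^sub>R axis i 1))\<^sup>2) = (l2 cellM (tpd i \<phi>))\<^sup>2"
      by (simp add: l2_sq)
  qed
  also have "\<dots> = (l2 cellM (tpd i \<phi>))\<^sup>2" by simp
  finally show "(l2 cellM (\<lambda>y. \<phi> (y + s *\<^sub>R axis i 1) - \<phi> y))\<^sup>2 \<le> (l2 cellM (tpd i \<phi>))\<^sup>2" .
qed simp

text \<open>The shift is performed one axis at a time; invariance of the L2 norm under shifts lets
  the increments telescope.\<close>

lemma testfun_shift_l2:
  fixes \<phi> :: "real^'d \<Rightarrow> real"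
  assumes \<phi>: "testfun \<phi>" and h: "h \<in> cellT"
  shows "l2 cellM (\<lambda>y. \<phi> (y + h) - \<phi> y) \<le> (\<Sum>i\<in>UNIV. l2 cellM (tpd i \<phi>))"
proof -
  have cont: "continuous_on UNIV \<phi>" by (intro testfun_cont assms)
  have "l2 cellM (\<lambda>y. \<phi> (y + (\<Sum>i\<in>A. h $ i *\<^sub>R axis i 1)) - \<phi> y) \<le> (\<Sum>i\<in>A. l2 cellM (tpd i \<phi>))"
    if "finite A" for A
    using that
  proof (induction A)
    case (insert j A)
    define H where "H = (\<Sum>i\<in>A. h $ i *\<^sub>R axis i (1::real))"
    have hj: "0 \<le> h $ j" "h $ j \<le> 1" using h by (auto simp: cellT_iff)
    have c1: "continuous_on UNIV (\<lambda>y. \<phi> (y + H) - \<phi> y)"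
      by (intro continuous_intros continuous_shift cont)
    have c2: "continuous_on UNIV (\<lambda>y. \<phi> (y + h $ j *\<^sub>R axis j 1) - \<phi> y)"
      by (intro continuous_intros continuous_shift cont)
    have "l2 cellM (\<lambda>y. \<phi> (y + (\<Sum>i\<in>insert j A. h $ i *\<^sub>R axis i 1)) - \<phi> y) =
       l2 cellM (\<lambda>y. (\<lambda>z. \<phi> (z + H) - \<phi> z) (y + h $ j *\<^sub>R axis j 1) + (\<phi> (y + h $ j *\<^sub>R axis j 1) - \<phi> y))"
      using insert.hyps by (simp add: H_def add_ac)
    also have "\<dots> \<le> l2 cellM (\<lambda>y. (\<lambda>z. \<phi> (z + H) - \<phi> z) (y + h $ j *\<^sub>R axis j 1)) + l2 cellM (\<lambda>y. \<phi> (y + h $ j *\<^sub>R axis j 1) - \<phi> y)"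
      by (intro l2_triangle sqint_continuous continuous_shift[OF c1] c2)
    also have "l2 cellM (\<lambda>y. (\<lambda>z. \<phi> (z + H) - \<phi> z) (y + h $ j *\<^sub>R axis j 1)) = l2 cellM (\<lambda>z. \<phi> (z + H) - \<phi> z)"
      unfolding l2_def
    proof (rule arg_cong[where f = sqrt], rule cell_integral_shift_axis[OF _ _ hj])
      show "continuous_on UNIV (\<lambda>z. (\<phi> (z + H) - \<phi> z)\<^sup>2)" by (intro continuous_intros c1)
      show "periodic (\<lambda>z. (\<phi> (z + H) - \<phi> z)\<^sup>2)"
        using periodic_shift[OF testfun_periodic[OF \<phi>], of H] testfun_periodic[OF \<phi>]
        by (auto simp: periodic_def)
    qed
    also have "\<dots> + l2 cellM (\<lambda>y. \<phi> (y + h $ j *\<^sub>R axis j 1) - \<phi> y) \<le> (\<Sum>i\<in>A. l2 cellM (tpd i \<phi>)) + l2 cellM (tpd j \<phi>)"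
      using insert.IH testfun_shift_axis_l2[OF \<phi> hj] unfolding H_def by (rule add_mono)
    finally show ?case using insert.hyps by (simp add: add.commute)
  qed simp
  from this[of UNIV] show ?thesis by (simp add: vec_sum_axis)
qed

text \<open>The double integral of the squared increments over base point \<open>y\<close> and shift
  \<open>h\<close> is twice the squared L2 distance of \<open>\<phi>\<close> from its mean, while
  each slice at fixed \<open>h\<close> is bounded by \<open>testfun_shift_l2\<close>. No compactness
  is involved and the constant is explicit.\<close>

lemma testfun_Poincare:
  fixes \<phi> :: "real^'d \<Rightarrow> real"
  assumes \<phi>: "testfun \<phi>"
  shows "l2 cellM (\<lambda>y. \<phi> y - (LINT y|cellM. \<phi> y)) \<le> (\<Sum>i\<in>UNIV. l2 cellM (tpd i \<phi>))"
proof (rule power2_le_imp_le)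
  let ?D = "\<Sum>i\<in>UNIV. l2 cellM (tpd i \<phi>)"
  define m where "m = (LINT y|cellM. \<phi> y)"
  have cont: "continuous_on UNIV \<phi>" by (intro testfun_cont assms)
  have per: "periodic \<phi>" by (rule testfun_periodic[OF \<phi>])
  have int: "integrable cellM \<phi>" "integrable cellM (\<lambda>y. (\<phi> y)\<^sup>2)"
    by (intro integrable_continuous_cell continuous_intros cont)+
  have v: "(l2 cellM (\<lambda>y. \<phi> y - c))\<^sup>2 = (LINT y|cellM. (\<phi> y)\<^sup>2) - 2 * c * m + c\<^sup>2" for c
  proof -
    have "(l2 cellM (\<lambda>y. \<phi> y - c))\<^sup>2 = (LINT y|cellM. (\<phi> y)\<^sup>2 - 2 * c * \<phi> y + c\<^sup>2)"
      unfolding l2_sq by (simp add: power2_diff algebra_simps)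
    also have "\<dots> = (LINT y|cellM. (\<phi> y)\<^sup>2) - 2 * c * m + c\<^sup>2"
      using int by (simp add: m_def)
    finally show ?thesis .
  qed
  have hk: "integral cellT f = (LINT y|cellM. f y)" if "continuous_on UNIV f" for f :: "real^'d \<Rightarrow> real"
    by (intro lebesgue_integral_eq_integral[symmetric] integrable_continuous_cell that) auto
  have c2: "continuous_on UNIV (\<lambda>p::(real^'d) \<times> (real^'d). (\<phi> (snd p + fst p) - \<phi> (snd p))\<^sup>2)"
    by (intro continuous_intros continuous_on_compose2[OF cont]) auto
  \<comment> \<open>For fixed \<open>y\<close> the points \<open>y + h\<close> run over the whole
    torus, so this is the second moment of \<open>\<phi>\<close> about the value
    \<open>\<phi> y\<close>.\<close>
  have inner: "integral cellT (\<lambda>h. (\<phi> (y + h) - \<phi> y)\<^sup>2) = (LINT y|cellM. (\<phi> y)\<^sup>2) - 2 * \<phi> y * m + (\<phi> y)\<^sup>2"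
    if "y \<in> cellT" for y
  proof -
    have c: "continuous_on UNIV (\<lambda>z. (\<phi> z - \<phi> y)\<^sup>2)" by (intro continuous_intros cont)
    have p: "periodic (\<lambda>z. (\<phi> z - \<phi> y)\<^sup>2)" using per by (simp add: periodic_def)
    have "integral cellT (\<lambda>h. (\<phi> (y + h) - \<phi> y)\<^sup>2) = integral cellT (\<lambda>h. (\<phi> (h + y) - \<phi> y)\<^sup>2)"
      by (simp add: add.commute)
    also have "\<dots> = (LINT h|cellM. (\<phi> (h + y) - \<phi> y)\<^sup>2)"
      by (intro hk continuous_shift[OF c])
    also have "\<dots> = (LINT h|cellM. (\<phi> h - \<phi> y)\<^sup>2)"
      by (rule cell_integral_shift[OF c p that])
    finally show ?thesis using v[of "\<phi> y"] by (simp add: l2_sq)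
  qed
  have "integral cellT (\<lambda>h. integral cellT (\<lambda>y. (\<phi> (y + h) - \<phi> y)\<^sup>2)) \<le> integral cellT (\<lambda>h::real^'d. ?D\<^sup>2)"
  proof (rule Henstock_Kurzweil_Integration.integral_le)
    have "continuous_on (cbox 0 One) (\<lambda>h. integral (cbox 0 One) (\<lambda>y. (\<phi> (y + h) - \<phi> y)\<^sup>2))"
      by (rule integral_continuous_on_param) (use continuous_on_subset[OF c2 subset_UNIV] in \<open>simp add: case_prod_beta\<close>)
    then show "(\<lambda>h. integral cellT (\<lambda>y. (\<phi> (y + h) - \<phi> y)\<^sup>2)) integrable_on cellT"
      unfolding cellT_def by (rule integrable_continuous)
    show "(\<lambda>h::real^'d. ?D\<^sup>2) integrable_on cellT" unfolding cellT_def by (rule integrable_const)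
    fix h :: "real^'d" assume h: "h \<in> cellT"
    have "integral cellT (\<lambda>y. (\<phi> (y + h) - \<phi> y)\<^sup>2) = (l2 cellM (\<lambda>y. \<phi> (y + h) - \<phi> y))\<^sup>2"
      unfolding l2_sq by (intro hk continuous_intros continuous_shift cont)
    also have "\<dots> \<le> ?D\<^sup>2"
      by (intro power_mono testfun_shift_l2[OF \<phi> h]) simp
    finally show "integral cellT (\<lambda>y. (\<phi> (y + h) - \<phi> y)\<^sup>2) \<le> ?D\<^sup>2" .
  qed
  also have "integral cellT (\<lambda>h::real^'d. ?D\<^sup>2) = ?D\<^sup>2"
    by (simp add: cellT_def)
  also have "integral cellT (\<lambda>h. integral cellT (\<lambda>y. (\<phi> (y + h) - \<phi> y)\<^sup>2)) =
      integral cellT (\<lambda>y. integral cellT (\<lambda>h. (\<phi> (y + h) - \<phi> y)\<^sup>2))"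
    unfolding cellT_def
    by (rule integral_swap_continuous) (use continuous_on_subset[OF c2 subset_UNIV] in \<open>simp add: case_prod_beta\<close>)
  also have "\<dots> = integral cellT (\<lambda>y. (LINT y|cellM. (\<phi> y)\<^sup>2) - 2 * \<phi> y * m + (\<phi> y)\<^sup>2)"
    by (rule Henstock_Kurzweil_Integration.integral_cong[OF inner])
  also have "\<dots> = (LINT y|cellM. (LINT y|cellM. (\<phi> y)\<^sup>2) - 2 * \<phi> y * m + (\<phi> y)\<^sup>2)"
    by (intro hk continuous_intros cont)
  also have "\<dots> = 2 * (l2 cellM (\<lambda>y. \<phi> y - m))\<^sup>2"
    using int v[of m] by (simp add: m_def[symmetric] power2_eq_square)
  finally have "2 * (l2 cellM (\<lambda>y. \<phi> y - m))\<^sup>2 \<le> ?D\<^sup>2" .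
  then show "(l2 cellM (\<lambda>y. \<phi> y - (LINT y|cellM. \<phi> y)))\<^sup>2 \<le> ?D\<^sup>2"
    unfolding m_def using zero_le_power2[of "l2 cellM (\<lambda>y. \<phi> y - (LINT y|cellM. \<phi> y))"] by linarith
qed (simp add: sum_nonneg)

section \<open>Completeness of the trigonometric system\<close>

text \<open>Boxes generate the Borel sets and are stable under intersection, so Dynkin's argument
  carries the vanishing to Borel sets and completion carries it to Lebesgue sets; then
  \<open>f\<close> and 0 have the same integral over every set. The total integral appears
  separately because complements use it and the whole space is not a box.\<close>

lemma AE_zero_if_box_integrals_zero:
  fixes f :: "'a::euclidean_space \<Rightarrow> real"
  assumes f: "integrable lebesgue f" and zero: "(LINT x|lebesgue. f x) = 0"
    and box: "\<And>a b. (LINT x:box a b|lebesgue. f x) = 0"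
  shows "AE x in lebesgue. f x = 0"
proof -
  have set: "set_integrable lebesgue A f" if "A \<in> sets lebesgue" for A
    using that f unfolding set_integrable_def by (rule integrable_mult_indicator)
  have borel: "(LINT x:A|lebesgue. f x) = 0" if A: "A \<in> sets borel" for A
  proof -
    have stable: "Int_stable (range (\<lambda>(a, b). box a b :: 'a set))"
      by (auto simp: Int_stable_def box_Int_box)
    have sig: "sigma_sets UNIV (range (\<lambda>(a, b). box a b :: 'a set)) = sets borel"
      unfolding borel_eq_box by simp
    have subset_Pow: "range (\<lambda>(a, b). box a b :: 'a set) \<subseteq> Pow UNIV" by simp
    have "A \<in> sigma_sets UNIV (range (\<lambda>(a, b). box a b))"
      using A unfolding sig .
    from stable subset_Pow this show ?thesis
    proof (induction rule: sigma_sets_induct_disjoint)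
      case (basic A) then show ?case using box by auto
    next
      case empty then show ?case by (simp add: set_lebesgue_integral_def)
    next
      case (compl A)
      then have A: "A \<in> sets lebesgue" unfolding sig by simp
      have "(LINT x:(UNIV - A) \<union> A|lebesgue. f x) = (LINT x:UNIV - A|lebesgue. f x) + (LINT x:A|lebesgue. f x)"
        by (rule set_integral_Un) (use set[OF A] set[of "UNIV - A"] Compl_in_sets_lebesgue[of A] A in \<open>auto simp: Compl_eq_Diff_UNIV\<close>)
      then show ?case using compl zero by (simp add: set_lebesgue_integral_def)
    next
      case (union A)
      then have A: "A i \<in> sets lebesgue" for i unfolding sig by auto
      have "(LINT x:(\<Union>i. A i)|lebesgue. f x) = (\<Sum>i. (LINT x:A i|lebesgue. f x))"
        using union(1) A by (intro lebesgue_integral_countable_add set) (auto simp: disjoint_family_on_def)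
      then show ?case using union by simp
    qed
  qed
  have "(LINT x:A|lebesgue. f x) = 0" if A: "A \<in> sets lebesgue" for A
  proof -
    obtain S N N' where S: "A = S \<union> N" "N \<subseteq> N'" "N' \<in> null_sets lborel" "S \<in> sets lborel"
      using sets_completionE[OF A] .
    have "N' \<in> null_sets lebesgue" using S(3) by (rule null_sets_completionI)
    then have "AE x in lebesgue. x \<notin> N'" by (rule AE_not_in)
    then have "AE x in lebesgue. x \<in> A \<longleftrightarrow> x \<in> S"
      by eventually_elim (use S in auto)
    then have "AE x in lebesgue. indicator A x *\<^sub>R f x = indicator S x *\<^sub>R f x"
      by eventually_elim (simp add: indicator_def)
    moreover have "S \<in> sets lebesgue" using S(4) by simp
    ultimately have "(LINT x:A|lebesgue. f x) = (LINT x:S|lebesgue. f x)"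
      using set[OF A] set[of S] unfolding set_lebesgue_integral_def set_integrable_def
      by (intro integral_cong_AE borel_measurable_integrable)
    then show ?thesis using borel S(4) by simp
  qed
  then show ?thesis
    using f by (intro density_unique_real[of lebesgue f "\<lambda>_. 0"]) (auto simp: set_lebesgue_integral_def)
qed

text \<open>The cosine and sine of this phase are the real and imaginary parts of the character of
  the torus with frequency \<open>k\<close>; the factor \<open>2 * pi\<close> fits period 1.\<close>

definition phase :: "('d \<Rightarrow> int) \<Rightarrow> real^'d \<Rightarrow> real" where
  "phase k y = 2 * pi * (\<Sum>i\<in>UNIV. of_int (k i) * y $ i)"

lemma phase_axis: "phase k (y + s *\<^sub>R axis j 1) = phase k y + 2 * pi * of_int (k j) * s"
proof -
  have "(\<Sum>i\<in>UNIV. of_int (k i) * (y + s *\<^sub>R axis j 1) $ i) =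
    (\<Sum>i\<in>UNIV. of_int (k i) * y $ i + (if i = j then of_int (k i) * s else 0))"
    by (intro sum.cong) (auto simp: axis_def algebra_simps)
  then show ?thesis
    unfolding phase_def by (simp add: sum.distrib algebra_simps)
qed

lemma phase_continuous: "continuous_on S (phase k)"
  unfolding phase_def[abs_def] by (intro continuous_intros)

lemma phase_periodic:
  "cos (phase k (y + axis j 1)) = cos (phase k y)" "sin (phase k (y + axis j 1)) = sin (phase k y)"
  using phase_axis[of k y 1 j] by (simp_all add: cos_add sin_add)

lemma testfun_cos_phase:
  "testfun (\<lambda>y. cos (phase k y))" "tpd i (\<lambda>y. cos (phase k y)) = (\<lambda>y. - 2 * pi * of_int (k i) * sin (phase k y))"
proof -
  have *: "periodic (\<lambda>y. cos (phase k y))" by (simp add: periodic_def phase_periodic)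
  have **: "continuous_on UNIV (\<lambda>y. - 2 * pi * of_int (k i) * sin (phase k y))" for i
    by (intro continuous_intros phase_continuous)
  have ***: "((\<lambda>s. cos (phase k (y + s *\<^sub>R axis i 1))) has_real_derivative - 2 * pi * of_int (k i) * sin (phase k y)) (at 0)" for i y
    unfolding phase_axis by (auto intro!: derivative_eq_intros)
  show "testfun (\<lambda>y. cos (phase k y))" "tpd i (\<lambda>y. cos (phase k y)) = (\<lambda>y. - 2 * pi * of_int (k i) * sin (phase k y))"
    by (rule testfunI[OF * ** ***])+
qed

lemma testfun_sin_phase:
  "testfun (\<lambda>y. sin (phase k y))" "tpd i (\<lambda>y. sin (phase k y)) = (\<lambda>y. 2 * pi * of_int (k i) * cos (phase k y))"
proof -
  have *: "periodic (\<lambda>y. sin (phase k y))" by (simp add: periodic_def phase_periodic)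
  have **: "continuous_on UNIV (\<lambda>y. 2 * pi * of_int (k i) * cos (phase k y))" for i
    by (intro continuous_intros phase_continuous)
  have ***: "((\<lambda>s. sin (phase k (y + s *\<^sub>R axis i 1))) has_real_derivative 2 * pi * of_int (k i) * cos (phase k y)) (at 0)" for i y
    unfolding phase_axis by (auto intro!: derivative_eq_intros)
  show "testfun (\<lambda>y. sin (phase k y))" "tpd i (\<lambda>y. sin (phase k y)) = (\<lambda>y. 2 * pi * of_int (k i) * cos (phase k y))"
    by (rule testfunI[OF * ** ***])+
qed

text \<open>Closure under products is not a rule but is derived from the product-to-sum formulas, so
  that vanishing integrals against the generators pass to all members by linearity alone.\<close>

inductive trigpoly :: "(real^'d \<Rightarrow> real) \<Rightarrow> bool" where
  trig_cos: "trigpoly (\<lambda>y. cos (phase k y))"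
| trig_sin: "trigpoly (\<lambda>y. sin (phase k y))"
| trig_add: "trigpoly p \<Longrightarrow> trigpoly q \<Longrightarrow> trigpoly (\<lambda>y. p y + q y)"
| trig_scale: "trigpoly p \<Longrightarrow> trigpoly (\<lambda>y. c * p y)"

lemma phase_add: "phase (\<lambda>i. k i + l i) y = phase k y + phase l y"
  and phase_diff: "phase (\<lambda>i. k i - l i) y = phase k y - phase l y"
  by (simp_all add: phase_def algebra_simps sum.distrib sum_subtractf)

lemma trigpoly_cong: "trigpoly p \<Longrightarrow> (\<And>y. q y = p y) \<Longrightarrow> trigpoly q"
  by (metis ext)

lemma trigpoly_const: "trigpoly (\<lambda>y. c)"
  using trig_scale[OF trig_cos[of "\<lambda>_. 0"], of c] by (simp add: phase_def)

lemma trigpoly_cos_mult: "trigpoly q \<Longrightarrow> trigpoly (\<lambda>y. cos (phase k y) * q y)"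
proof (induction rule: trigpoly.induct)
  case (trig_cos l)
  show ?case
    by (rule trigpoly_cong[OF trig_scale[OF trig_add[OF trigpoly.trig_cos[of "\<lambda>i. k i - l i"] trigpoly.trig_cos[of "\<lambda>i. k i + l i"]], of "1/2"]])
       (simp add: phase_add phase_diff cos_add cos_diff)
next
  case (trig_sin l)
  show ?case
    by (rule trigpoly_cong[OF trig_scale[OF trig_add[OF trigpoly.trig_sin[of "\<lambda>i. l i - k i"] trigpoly.trig_sin[of "\<lambda>i. l i + k i"]], of "1/2"]])
       (simp add: phase_add phase_diff sin_add sin_diff)
next
  case (trig_add p q)
  then show ?case by (auto simp: distrib_left intro: trigpoly.trig_add)
next
  case (trig_scale p c)
  then show ?case using trigpoly.trig_scale by (simp add: mult.left_commute)
qed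

lemma trigpoly_sin_mult: "trigpoly q \<Longrightarrow> trigpoly (\<lambda>y. sin (phase k y) * q y)"
proof (induction rule: trigpoly.induct)
  case (trig_cos l)
  show ?case
    by (rule trigpoly_cong[OF trig_scale[OF trig_add[OF trigpoly.trig_sin[of "\<lambda>i. k i - l i"] trigpoly.trig_sin[of "\<lambda>i. k i + l i"]], of "1/2"]])
       (simp add: phase_add phase_diff sin_add sin_diff)
next
  case (trig_sin l)
  show ?case
    by (rule trigpoly_cong[OF trig_scale[OF trig_add[OF trigpoly.trig_cos[of "\<lambda>i. k i - l i"] trig_scale[OF trigpoly.trig_cos[of "\<lambda>i. k i + l i"], of "-1"]], of "1/2"]])
       (simp add: phase_add phase_diff cos_add cos_diff)
next
  case (trig_add p q)
  then show ?case by (auto simp: distrib_left intro: trigpoly.trig_add)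
next
  case (trig_scale p c)
  then show ?case using trigpoly.trig_scale by (simp add: mult.left_commute)
qed

lemma trigpoly_mult: "trigpoly p \<Longrightarrow> trigpoly q \<Longrightarrow> trigpoly (\<lambda>y. p y * q y)"
proof (induction rule: trigpoly.induct)
  case (trig_add p r)
  then show ?case by (auto simp: distrib_right intro: trigpoly.trig_add)
next
  case (trig_scale p c)
  then show ?case using trigpoly.trig_scale by (simp add: mult.assoc)
qed (auto intro: trigpoly_cos_mult trigpoly_sin_mult)

lemma trigpoly_sum: "(\<And>i. i \<in> I \<Longrightarrow> trigpoly (f i)) \<Longrightarrow> trigpoly (\<lambda>y. \<Sum>i\<in>I. f i y)"
  by (induction I rule: infinite_finite_induct) (auto intro: trigpoly_const trig_add)

text \<open>The standard embedding of the torus as a product of circles; opposite faces of the cell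
  receive the same image. Continuous functions on the target pull back to periodic functions, and on
  the compact image of the cell they can be approximated by polynomials.\<close>

definition circ :: "real^'d \<Rightarrow> (real^'d) \<times> (real^'d)" where
  "circ y = (\<chi> i. cos (2 * pi * y $ i), \<chi> i. sin (2 * pi * y $ i))"

lemma circ_continuous: "continuous_on S circ"
  unfolding circ_def[abs_def] by (intro continuous_intros)

lemma phase_axis_vec: "phase (\<lambda>j. if j = i then 1 else 0) y = 2 * pi * y $ i"
  by (simp add: phase_def if_distrib[of of_int] if_distrib[of "\<lambda>x. x * _"] cong: if_cong)

text \<open>A linear functional of \<open>circ y\<close> is a combination of its coordinates, which
  are cosines and sines whose frequency is a unit vector; constants, sums and products are covered
  by the closure properties of \<open>trigpoly\<close>.\<close>

lemma trigpoly_circ: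
  fixes q :: "(real^'d) \<times> (real^'d) \<Rightarrow> real"
  assumes "real_polynomial_function q"
  shows "trigpoly (\<lambda>y. q (circ y))"
  using assms
proof (induction rule: real_polynomial_function.induct)
  case (linear h)
  interpret h: bounded_linear h by fact
  have "circ y = (\<Sum>i\<in>UNIV. cos (2 * pi * y $ i) *\<^sub>R (axis i 1, 0) + sin (2 * pi * y $ i) *\<^sub>R (0, axis i 1))"
    for y :: "real^'d"
  proof -
    have "(\<Sum>i\<in>UNIV. cos (2 * pi * y $ i) *\<^sub>R axis i 1) = (\<chi> i. cos (2 * pi * y $ i))"
      "(\<Sum>i\<in>UNIV. sin (2 * pi * y $ i) *\<^sub>R axis i 1) = (\<chi> i. sin (2 * pi * y $ i))"
      using vec_sum_axis[of "\<chi> i. cos (2 * pi * y $ i)"] vec_sum_axis[of "\<chi> i. sin (2 * pi * y $ i)"] by simp_all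
    then show ?thesis
      by (simp add: circ_def sum_prod sum.distrib prod_eq_iff fst_sum snd_sum)
  qed
  then have eq: "h (circ y) = (\<Sum>i\<in>UNIV. h (axis i 1, 0) * cos (phase (\<lambda>j. if j = i then 1 else 0) y) +
      h (0, axis i 1) * sin (phase (\<lambda>j. if j = i then 1 else 0) y))" for y
    unfolding phase_axis_vec by (simp only: h.sum h.add h.scaleR real_scaleR_def mult.commute)
  show ?case
    unfolding eq by (intro trigpoly_sum trig_add trig_scale trig_cos trig_sin)
qed (auto intro: trigpoly_const trig_add trigpoly_mult)

lemma trigpoly_continuous: "trigpoly p \<Longrightarrow> continuous_on UNIV p"
  by (induction rule: trigpoly.induct) (auto intro!: continuous_intros phase_continuous)

lemma integrable_mult_continuous:
  fixes g p :: "real^'d \<Rightarrow> real"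
  assumes "integrable cellM g" "continuous_on UNIV p"
  shows "integrable cellM (\<lambda>y. g y * p y)"
proof -
  obtain K where K: "\<And>y. y \<in> cellT \<Longrightarrow> \<bar>p y\<bar> \<le> K"
    using continuous_bounded_cell[OF assms(2)] by blast
  show ?thesis
  proof (rule Bochner_Integration.integrable_bound)
    show "integrable cellM (\<lambda>y. K * g y)" using assms by simp
    show "(\<lambda>y. g y * p y) \<in> borel_measurable cellM"
      using assms cellM_continuous_measurable by (intro borel_measurable_times) auto
    show "AE y in cellM. norm (g y * p y) \<le> norm (K * g y)"
      using K order_trans[OF K abs_ge_self]
      by (intro AE_I2) (auto simp: abs_mult mult.commute[of _ "\<bar>g _\<bar>"] intro!: mult_left_mono)
  qed
qed

text \<open>A window \<open>(p, q)\<close> inside the unit interval is a superlevel set of a shifted cosine.  This turns the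
  indicator of a box into a limit of continuous functions of \<open>circ\<close>, to which Stone--Weierstrass applies.\<close>

lemma cos_arc_iff:
  assumes p: "0 \<le> p" "p < q" "q \<le> 1" and y: "0 < y" "y < (1::real)"
  shows "cos (2 * pi * ((q - p) / 2)) < cos (2 * pi * (y - (p + q) / 2)) \<longleftrightarrow> p < y \<and> y < q"
proof -
  define r m t where "r = (q - p) / 2" and "m = (p + q) / 2" and "t = \<bar>y - m\<bar>"
  have r: "0 < r" "r \<le> 1/2" "r \<le> m" "m + r \<le> 1" using p by (auto simp: r_def m_def field_simps)
  have t: "0 \<le> t" "t < 1 - r" using r y by (auto simp: t_def)
  have mono: "cos (2 * pi * x) < cos (2 * pi * z) \<longleftrightarrow> z < x" if "0 \<le> x" "x \<le> 1/2" "0 \<le> z" "z \<le> 1/2" for x z :: real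
    using that cos_mono_less_eq[of "2 * pi * x" "2 * pi * z"] by simp
  have "cos (2 * pi * (y - m)) = cos (2 * pi * t)"
  proof -
    have "cos (2 * pi * t) = cos \<bar>2 * pi * (y - m)\<bar>" by (simp add: t_def abs_mult)
    then show ?thesis by simp
  qed
  moreover have "cos (2 * pi * r) < cos (2 * pi * t) \<longleftrightarrow> t < r"
  proof (cases "t \<le> 1/2")
    case True
    then show ?thesis using mono r t by simp
  next
    case False
    have "cos (2 * pi * t) = cos (2 * pi * (1 - t))"
      by (simp add: right_diff_distrib cos_diff)
    then show ?thesis using mono[of r "1 - t"] r t False by simp
  qed
  moreover have "t < r \<longleftrightarrow> p < y \<and> y < q"
    by (auto simp: t_def r_def m_def abs_if field_simps)
  ultimately show ?thesis by (simp add: r_def m_def)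
qed

lemma clamp_tendsto_indicator:
  fixes z :: real
  shows "(\<lambda>n. min 1 (max 0 (real n * z))) \<longlonglongrightarrow> (if z > 0 then 1 else 0)"
proof (cases "z > 0")
  case True
  then obtain N where N: "1 / z < real N" using reals_Archimedean2 by blast
  have "\<forall>\<^sub>F n in sequentially. 1 = min 1 (max 0 (real n * z))"
    using eventually_ge_at_top[of N]
  proof eventually_elim
    case (elim n)
    then have "1 / z < real n" using N by linarith
    then show ?case using True by (simp add: field_simps)
  qed
  then show ?thesis using True by (simp add: tendsto_eventually eventually_mono)
next
  case False
  then have "min 1 (max 0 (real n * z)) = 0" for n
    using mult_nonneg_nonpos[of "real n" z] by auto
  then show ?thesis using False by simp
qed

text \<open>Orthogonality spreads from the characters to continuous functions of \<open>circ\<close>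
  by uniform approximation, and from there to indicators of boxes by dominated convergence. A
  uniform error is paired with the integral of the absolute value of \<open>g\<close>, so
  integrability of \<open>g\<close> suffices.\<close>

lemma trig_complete:
  fixes g :: "real^'d \<Rightarrow> real"
  assumes g: "integrable cellM g"
    and c: "\<And>k. (LINT y|cellM. g y * cos (phase k y)) = 0"
    and s: "\<And>k. (LINT y|cellM. g y * sin (phase k y)) = 0"
  shows "AE y in cellM. g y = 0"
proof -
  note intc = integrable_mult_continuous[OF g]
  have poly: "(LINT y|cellM. g y * p y) = 0" if "trigpoly p" for p
    using that
  proof (induction rule: trigpoly.induct)
    case (trig_add p q)
    then show ?case
      using intc[OF trigpoly_continuous[OF trig_add(1)]] intc[OF trigpoly_continuous[OF trig_add(2)]]
      by (simp add: distrib_left)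
  next
    case (trig_scale p c)
    then show ?case by (simp add: mult.left_commute[of _ c])
  qed (use c s in auto)
  have cont: "(LINT y|cellM. g y * F (circ y)) = 0" if F: "continuous_on UNIV F" for F
  proof -
    have Fc: "continuous_on UNIV (\<lambda>y. F (circ y))"
      by (rule continuous_on_compose2[OF F circ_continuous]) auto
    define G where "G = (LINT y|cellM. \<bar>g y\<bar>)"
    have "G \<ge> 0" by (simp add: G_def)
    have small: "\<bar>LINT y|cellM. g y * F (circ y)\<bar> \<le> e * G" if "e > 0" for e
    proof -
      have "compact (circ ` (cellT :: (real^'d) set))"
        by (rule compact_continuous_image[OF circ_continuous cellT_compact])
      then obtain q where q: "real_polynomial_function q" "\<And>x. x \<in> circ ` cellT \<Longrightarrow> \<bar>F x - q x\<bar> < e"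
        using Stone_Weierstrass_real_polynomial_function[of "circ ` cellT" F e] continuous_on_subset[OF F] \<open>e > 0\<close>
        by (metis subset_UNIV)
      have qc: "trigpoly (\<lambda>y. q (circ y))" using q(1) by (rule trigpoly_circ)
      have "(LINT y|cellM. g y * F (circ y)) = (LINT y|cellM. g y * (F (circ y) - q (circ y)))"
        using intc[OF Fc] intc[OF trigpoly_continuous[OF qc]] poly[OF qc]
        by (simp add: right_diff_distrib)
      also have "\<bar>\<dots>\<bar> \<le> (LINT y|cellM. \<bar>g y * (F (circ y) - q (circ y))\<bar>)"
        by (rule integral_abs_bound)
      also have "\<dots> \<le> (LINT y|cellM. e * \<bar>g y\<bar>)"
      proof (rule integral_mono)
        show "integrable cellM (\<lambda>y. \<bar>g y * (F (circ y) - q (circ y))\<bar>)"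
          by (intro integrable_abs intc continuous_intros Fc trigpoly_continuous[OF qc])
        show "integrable cellM (\<lambda>y. e * \<bar>g y\<bar>)" using g by simp
        show "\<bar>g y * (F (circ y) - q (circ y))\<bar> \<le> e * \<bar>g y\<bar>" if "y \<in> space cellM" for y
          using q(2)[of "circ y"] that by (simp add: abs_mult mult.commute[of e] mult_left_mono less_imp_le)
      qed
      finally show ?thesis by (simp add: G_def)
    qed
    have "\<bar>LINT y|cellM. g y * F (circ y)\<bar> \<le> 0"
    proof (rule field_le_epsilon)
      fix e :: real assume "e > 0"
      \<comment> \<open>\<open>G + 1\<close> in place of \<open>G\<close> covers the case
        \<open>G = 0\<close>.\<close>
      then have "\<bar>LINT y|cellM. g y * F (circ y)\<bar> \<le> e / (G + 1) * G"
        using \<open>G \<ge> 0\<close> by (intro small) simp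
      also have "\<dots> \<le> e" using \<open>G \<ge> 0\<close> \<open>e > 0\<close> by (simp add: field_simps)
      finally show "\<bar>LINT y|cellM. g y * F (circ y)\<bar> \<le> 0 + e" by simp
    qed
    then show ?thesis by simp
  qed
  have box: "(LINT y|cellM. g y * indicator (box a b) y) = 0" for a b
  proof (cases "\<exists>i. min 1 (b $ i) \<le> max 0 (a $ i)")
    case True
    have "AE y in cellM. indicator (box a b) y = (0 :: real)"
      using AE_cell_interior
    proof eventually_elim
      case (elim y)
      obtain i where i: "min 1 (b $ i) \<le> max 0 (a $ i)" using True by blast
      have "\<not> (a $ i < y $ i \<and> y $ i < b $ i)"
        using elim[rule_format, of i] i by linarith
      then have "y \<notin> box a b" by (auto simp: mem_box_cart)
      then show ?case by simp
    qed
    then show ?thesis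
      by (intro integral_eq_zero_AE) auto
  next
    case False
    \<comment> \<open>The sides of the box clipped to the unit interval. A box with an empty clipped
      side misses the interior of the cell and has been disposed of above.\<close>
    define p q where "p i = max 0 (a $ i)" and "q i = min 1 (b $ i)" for i
    have pq: "0 \<le> p i" "p i < q i" "q i \<le> 1" for i
      using False by (auto simp: p_def q_def not_le)
    \<comment> \<open>By the addition formula each factor compares the cosine of the offset from the
      midpoint of the window with the cosine of half its width, written in the coordinates of
      \<open>circ\<close>; the clamps sharpen to an indicator as \<open>n\<close> grows.\<close>
    define F where "F n = (\<lambda>x :: (real^'d) \<times> (real^'d).
       \<Prod>i\<in>UNIV. min 1 (max 0 (real n * (fst x $ i * cos (2 * pi * ((p i + q i) / 2)) +
          snd x $ i * sin (2 * pi * ((p i + q i) / 2)) - cos (2 * pi * ((q i - p i) / 2))))))" for n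
    have Fcont: "continuous_on UNIV (F n)" for n
      unfolding F_def by (intro continuous_intros)
    have Fy: "F n (circ y) = (\<Prod>i\<in>UNIV. min 1 (max 0 (real n * (cos (2 * pi * (y $ i - (p i + q i) / 2)) - cos (2 * pi * ((q i - p i) / 2))))))" for n y
      by (simp only: F_def circ_def fst_conv snd_conv vec_lambda_beta right_diff_distrib cos_diff)
    have "(\<lambda>n. LINT y|cellM. g y * F n (circ y)) \<longlonglongrightarrow> (LINT y|cellM. g y * indicator (box a b) y)"
    proof (rule integral_dominated_convergence)
      have "box a b \<in> sets lebesgue" by simp
      then show "(\<lambda>y. g y * indicator (box a b) y) \<in> borel_measurable cellM"
        using g by (intro borel_measurable_times measurable_restrict_space1 borel_measurable_indicator borel_measurable_integrable)
      show "(\<lambda>y. g y * F n (circ y)) \<in> borel_measurable cellM" for n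
        by (intro borel_measurable_integrable intc continuous_on_compose2[OF Fcont circ_continuous]) auto
      show "integrable cellM (\<lambda>y. \<bar>g y\<bar>)" using g by simp
      show "AE y in cellM. (\<lambda>n. g y * F n (circ y)) \<longlonglongrightarrow> g y * indicator (box a b) y"
        using AE_cell_interior
      proof eventually_elim
        case (elim y)
        have "(\<lambda>n. F n (circ y)) \<longlonglongrightarrow> (\<Prod>i\<in>UNIV. if p i < y $ i \<and> y $ i < q i then 1 else 0)"
          unfolding Fy
        proof (rule tendsto_prod)
          fix i
          have "(cos (2 * pi * (y $ i - (p i + q i) / 2)) - cos (2 * pi * ((q i - p i) / 2)) > 0) = (p i < y $ i \<and> y $ i < q i)"
            using cos_arc_iff[OF pq[of i], of "y $ i"] elim by auto
          then show "(\<lambda>n. min 1 (max 0 (real n * (cos (2 * pi * (y $ i - (p i + q i) / 2)) - cos (2 * pi * ((q i - p i) / 2)))))) \<longlonglongrightarrow>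
              (if p i < y $ i \<and> y $ i < q i then 1 else 0)"
            using clamp_tendsto_indicator[of "cos (2 * pi * (y $ i - (p i + q i) / 2)) - cos (2 * pi * ((q i - p i) / 2))"] by simp
        qed
        also have "(\<Prod>i\<in>UNIV. if p i < y $ i \<and> y $ i < q i then 1 else 0) = (indicator (box a b) y :: real)"
        proof (cases "y \<in> box a b")
          case True
          then show ?thesis using elim by (simp add: mem_box_cart p_def q_def)
        next
          case False
          then obtain i where "\<not> (a $ i < y $ i \<and> y $ i < b $ i)" by (auto simp: mem_box_cart)
          then have "\<exists>i. \<not> (p i < y $ i \<and> y $ i < q i)" by (auto simp: p_def q_def)
          then show ?thesis using False by (auto simp: prod_zero_iff)
        qed
        finally show ?case by (intro tendsto_mult tendsto_const)
      qed
      show "AE y in cellM. norm (g y * F n (circ y)) \<le> \<bar>g y\<bar>" for n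
      proof (rule AE_I2)
        fix y
        have "0 \<le> F n (circ y)" unfolding Fy by (intro prod_nonneg) auto
        moreover have "F n (circ y) \<le> 1" unfolding Fy by (intro prod_le_1) auto
        ultimately show "norm (g y * F n (circ y)) \<le> \<bar>g y\<bar>"
          by (simp add: abs_mult mult_left_le)
      qed
    qed
    then show ?thesis by (simp add: cont[OF Fcont] LIMSEQ_const_iff)
  qed
  define f where "f = (\<lambda>y. indicator cellT y * g y)"
  have fint: "integrable lebesgue f"
    using g unfolding f_def by (simp add: integrable_restrict_space)
  have "AE y in lebesgue. f y = 0"
  proof (rule AE_zero_if_box_integrals_zero[OF fint])
    \<comment> \<open>Frequency zero gives the constant 1, so orthogonality to it is the vanishing
      of the total integral.\<close>
    show "(LINT y|lebesgue. f y) = 0"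
      using c[of "\<lambda>_. 0"] by (simp add: phase_def f_def integral_restrict_space)
    show "(LINT y:box a b|lebesgue. f y) = 0" for a b
      using box[of a b] by (simp add: f_def integral_restrict_space set_lebesgue_integral_def mult_ac)
  qed
  then show ?thesis by (auto simp: AE_restrict_space_iff f_def indicator_def elim: eventually_mono)
qed

lemma testfun_separating:
  fixes g :: "real^'d \<Rightarrow> real"
  assumes "integrable cellM g" "\<And>\<phi>. testfun \<phi> \<Longrightarrow> (LINT y|cellM. g y * \<phi> y) = 0"
  shows "AE y in cellM. g y = 0"
  using assms by (intro trig_complete) (auto intro: testfun_cos_phase testfun_sin_phase)

section \<open>The Sobolev space\<close>

text \<open>Turns the gauge integrals of the definition into Lebesgue integrals, which is legitimate
  because products of square integrable functions are integrable.\<close>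

lemma weak_grad_iff:
  assumes "sqint cellM f"
  shows "weak_grad f G \<longleftrightarrow> (\<forall>i. sqint cellM (\<lambda>y. G y $ i)) \<and>
     (\<forall>\<phi> i. testfun \<phi> \<longrightarrow> (LINT y|cellM. f y * tpd i \<phi> y) = - (LINT y|cellM. G y $ i * \<phi> y))"
proof -
  have a: "intT (\<lambda>y. f y * tpd i \<phi> y) = (LINT y|cellM. f y * tpd i \<phi> y)" if "testfun \<phi>" for \<phi> i
    by (intro intT_eq sqint_mult assms sqint_continuous testfun_tpd_cont that)
  have b: "intT (\<lambda>y. G y $ i * \<phi> y) = (LINT y|cellM. G y $ i * \<phi> y)"
    if "testfun \<phi>" "\<forall>i. sqint cellM (\<lambda>y. G y $ i)" for \<phi> i
    by (rule intT_eq, rule sqint_mult) (use that sqint_continuous[OF testfun_cont] in auto)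
  show ?thesis
    unfolding weak_grad_def L2T_iff by (rule conj_cong[OF refl]) (simp add: a b)
qed

text \<open>\<open>wgrad\<close> picks some weak gradient, so its values can be known only up to
  null sets. Test functions separate integrable functions, which forces any two candidates to agree,
  even for representatives \<open>f\<close> and \<open>g\<close> that differ on a null set.\<close>

lemma weak_grad_unique:
  fixes f :: "real^'d \<Rightarrow> real"
  assumes f: "sqint cellM f" "weak_grad f G" and g: "sqint cellM g" "weak_grad g H"
    and eq: "AE y in cellM. f y = g y"
  shows "AE y in cellM. \<forall>i. G y $ i = H y $ i"
proof -
  have "AE y in cellM. G y $ i - H y $ i = 0" for i
  proof (rule testfun_separating)
    have sq: "sqint cellM (\<lambda>y. G y $ i)" "sqint cellM (\<lambda>y. H y $ i)"
      using f g by (auto simp: weak_grad_iff)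
    then show "integrable cellM (\<lambda>y. G y $ i - H y $ i)"
      by (intro cellM.sqint_integrable sqint_diff)
    fix \<phi> :: "real^'d \<Rightarrow> real" assume \<phi>: "testfun \<phi>"
    then have "sqint cellM \<phi>" "sqint cellM (tpd i \<phi>)"
      by (intro sqint_continuous testfun_cont testfun_tpd_cont; assumption)+
    then have "(LINT y|cellM. (G y $ i - H y $ i) * \<phi> y) =
       (LINT y|cellM. G y $ i * \<phi> y) - (LINT y|cellM. H y $ i * \<phi> y)"
      using sq by (simp add: left_diff_distrib sqint_mult)
    also have "\<dots> = (LINT y|cellM. g y * tpd i \<phi> y) - (LINT y|cellM. f y * tpd i \<phi> y)"
      using f g \<phi> by (simp add: weak_grad_iff)
    also have "(LINT y|cellM. g y * tpd i \<phi> y) = (LINT y|cellM. f y * tpd i \<phi> y)"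
    proof (rule integral_cong_AE)
      show "AE y in cellM. g y * tpd i \<phi> y = f y * tpd i \<phi> y"
        using eq by eventually_elim simp
    qed (intro borel_measurable_times sqint_measurable f g \<open>sqint cellM (tpd i \<phi>)\<close>)+
    finally show "(LINT y|cellM. (G y $ i - H y $ i) * \<phi> y) = 0" by simp
  qed
  then show ?thesis by (simp add: AE_all_countable)
qed

lemma H1_iff: "H1 f \<longleftrightarrow> periodic f \<and> sqint cellM f \<and> (\<exists>G. weak_grad f G)"
  by (simp add: H1_def L2T_iff)

lemma H1_periodic: "H1 f \<Longrightarrow> periodic f"
  and H1_sqint: "H1 f \<Longrightarrow> sqint cellM f"
  by (simp_all add: H1_iff)

lemma H1_wgrad: "H1 f \<Longrightarrow> weak_grad f (wgrad f)"
  unfolding wgrad_def H1_def by (metis someI_ex)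

text \<open>The index \<open>None\<close> for the function and \<open>Some i\<close> for its partial
  derivatives lets terms of order zero and one be handled by a single sum over a finite
  type.\<close>

definition jet :: "(real^'d \<Rightarrow> real) \<Rightarrow> 'd option \<Rightarrow> real^'d \<Rightarrow> real" where
  "jet f \<alpha> y = (case \<alpha> of None \<Rightarrow> f y | Some i \<Rightarrow> wgrad f y $ i)"

lemma jet_None [simp]: "jet f None = f"
  and jet_Some: "jet f (Some i) y = wgrad f y $ i"
  by (simp_all add: jet_def fun_eq_iff)

lemma jet_sqint: "H1 f \<Longrightarrow> sqint cellM (jet f \<alpha>)"
  using H1_wgrad[of f] H1_sqint[of f]
  by (cases \<alpha>) (auto simp: weak_grad_iff jet_Some[abs_def])

text \<open>The way to evaluate the chosen gradient: any explicit weak gradient of an almost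
  everywhere equal function determines the jet up to a null set.\<close>

lemma jet_eqI:
  assumes "H1 f" "sqint cellM g" "weak_grad g G" "AE y in cellM. f y = g y"
  shows "AE y in cellM. \<forall>\<alpha>. jet f \<alpha> y = (case \<alpha> of None \<Rightarrow> g y | Some i \<Rightarrow> G y $ i)"
  using weak_grad_unique[OF H1_sqint[OF assms(1)] H1_wgrad[OF assms(1)] assms(2-4)] assms(4)
  by eventually_elim (auto simp: jet_def split: option.splits)

lemma jet_cong:
  assumes "H1 f" "H1 g" "AE y in cellM. f y = g y"
  shows "AE y in cellM. \<forall>\<alpha>. jet f \<alpha> y = jet g \<alpha> y"
  using jet_eqI[OF assms(1) H1_sqint[OF assms(2)] H1_wgrad[OF assms(2)] assms(3)]
  by eventually_elim (simp add: jet_def)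

lemma H1_lincomb:
  fixes f g :: "real^'d \<Rightarrow> real"
  assumes f: "H1 f" and g: "H1 g"
  shows "H1 (\<lambda>y. b * f y + c * g y)"
    and "AE y in cellM. \<forall>\<alpha>. jet (\<lambda>y. b * f y + c * g y) \<alpha> y = b * jet f \<alpha> y + c * jet g \<alpha> y"
proof -
  have sq: "sqint cellM (\<lambda>y. b * f y + c * g y)"
    by (intro sqint_add sqint_cmult H1_sqint f g)
  have wg: "weak_grad (\<lambda>y. b * f y + c * g y) (\<lambda>y. b *\<^sub>R wgrad f y + c *\<^sub>R wgrad g y)"
    unfolding weak_grad_iff[OF sq]
  proof (intro conjI allI impI)
    fix i
    have F: "sqint cellM (\<lambda>y. wgrad f y $ i)" "sqint cellM (\<lambda>y. wgrad g y $ i)"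
      using H1_wgrad[OF f] H1_wgrad[OF g] by (simp_all add: weak_grad_iff H1_sqint f g)
    then show "sqint cellM (\<lambda>y. (b *\<^sub>R wgrad f y + c *\<^sub>R wgrad g y) $ i)"
      by (simp add: sqint_add sqint_cmult)
    fix \<phi> :: "real^'d \<Rightarrow> real" assume \<phi>: "testfun \<phi>"
    then have T: "sqint cellM \<phi>" "sqint cellM (tpd i \<phi>)"
      by (intro sqint_continuous testfun_cont testfun_tpd_cont; assumption)+
    have "(LINT y|cellM. (b * f y + c * g y) * tpd i \<phi> y) =
        b * (LINT y|cellM. f y * tpd i \<phi> y) + c * (LINT y|cellM. g y * tpd i \<phi> y)"
      using sqint_mult[OF H1_sqint[OF f] T(2)] sqint_mult[OF H1_sqint[OF g] T(2)]
      by (simp add: distrib_right mult.assoc)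
    also have "\<dots> = - (b * (LINT y|cellM. wgrad f y $ i * \<phi> y) + c * (LINT y|cellM. wgrad g y $ i * \<phi> y))"
      using H1_wgrad[OF f] H1_wgrad[OF g] \<phi> by (simp add: weak_grad_iff H1_sqint f g)
    also have "b * (LINT y|cellM. wgrad f y $ i * \<phi> y) + c * (LINT y|cellM. wgrad g y $ i * \<phi> y) =
        (LINT y|cellM. (b *\<^sub>R wgrad f y + c *\<^sub>R wgrad g y) $ i * \<phi> y)"
      using sqint_mult[OF F(1) T(1)] sqint_mult[OF F(2) T(1)]
      by (simp add: distrib_right mult.assoc)
    finally show "(LINT y|cellM. (b * f y + c * g y) * tpd i \<phi> y) =
      - (LINT y|cellM. (b *\<^sub>R wgrad f y + c *\<^sub>R wgrad g y) $ i * \<phi> y)" .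
  qed
  have per: "periodic (\<lambda>y. b * f y + c * g y)"
    using H1_periodic[OF f] H1_periodic[OF g] by (simp add: periodic_def)
  show H: "H1 (\<lambda>y. b * f y + c * g y)"
    unfolding H1_iff using per sq wg by blast
  show "AE y in cellM. \<forall>\<alpha>. jet (\<lambda>y. b * f y + c * g y) \<alpha> y = b * jet f \<alpha> y + c * jet g \<alpha> y"
    using jet_eqI[OF H sq wg] by (auto simp: jet_def split: option.splits elim!: eventually_mono)
qed

lemma H1_testfun:
  assumes "testfun \<phi>"
  shows "H1 \<phi>" "AE y in cellM. \<forall>i. jet \<phi> (Some i) y = tpd i \<phi> y"
proof -
  have sq: "sqint cellM \<phi>" by (intro sqint_continuous testfun_cont assms)
  have wg: "weak_grad \<phi> (\<lambda>y. \<chi> i. tpd i \<phi> y)"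
    unfolding weak_grad_iff[OF sq]
    using testfun_by_parts[OF assms] by (auto intro!: sqint_continuous testfun_tpd_cont assms)
  show H: "H1 \<phi>" unfolding H1_iff using sq wg testfun_periodic[OF assms] by blast
  show "AE y in cellM. \<forall>i. jet \<phi> (Some i) y = tpd i \<phi> y"
    using jet_eqI[OF H sq wg] by (auto elim!: eventually_mono)
qed

lemma H1_const: "H1 (\<lambda>y. c)" "AE y in cellM. \<forall>i. jet (\<lambda>y. c) (Some i) y = 0"
  using H1_testfun[OF testfun_const(1)[of c]] by (simp_all add: testfun_const(2))

lemma H1_add: "H1 f \<Longrightarrow> H1 g \<Longrightarrow> H1 (\<lambda>y. f y + g y)"
  and H1_diff: "H1 f \<Longrightarrow> H1 g \<Longrightarrow> H1 (\<lambda>y. f y - g y)"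
  and H1_cmult: "H1 f \<Longrightarrow> H1 (\<lambda>y. c * f y)"
  using H1_lincomb(1)[of f g 1 1] H1_lincomb(1)[of f g 1 "-1"] H1_lincomb(1)[of f f c 0] by simp_all

lemma H1_sum: "finite I \<Longrightarrow> (\<And>i. i \<in> I \<Longrightarrow> H1 (f i)) \<Longrightarrow> H1 (\<lambda>y. \<Sum>i\<in>I. f i y)"
  by (induction I rule: finite_induct) (auto intro: H1_add H1_const)

lemma sum_option: "(\<Sum>\<alpha>\<in>UNIV. f \<alpha>) = f None + (\<Sum>i\<in>UNIV. f (Some i))"
  for f :: "'d::finite option \<Rightarrow> 'b::comm_monoid_add"
  by (simp add: UNIV_option_conv sum.reindex)

text \<open>As a Euclidean norm of L2 norms over a finite index type, \<open>h1norm\<close> inherits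
  the triangle inequality from \<open>L2_set\<close>.\<close>

lemma h1norm_eq:
  assumes "H1 f"
  shows "h1norm f = L2_set (\<lambda>\<alpha>. l2 cellM (jet f \<alpha>)) UNIV"
proof -
  have int: "integrable cellM (\<lambda>y. (jet f \<alpha> y)\<^sup>2)" for \<alpha>
    using jet_sqint[OF assms, of \<alpha>] by (simp add: sqint_def)
  have n: "(norm (wgrad f y))\<^sup>2 = (\<Sum>i\<in>UNIV. (jet f (Some i) y)\<^sup>2)" for y
    by (simp add: norm_vec_def L2_set_def sum_nonneg jet_Some)
  have "intT (\<lambda>y. (norm (wgrad f y))\<^sup>2) = (LINT y|cellM. (norm (wgrad f y))\<^sup>2)"
    unfolding n by (intro intT_eq Bochner_Integration.integrable_sum int)
  also have "\<dots> = (\<Sum>i\<in>UNIV. (l2 cellM (jet f (Some i)))\<^sup>2)"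
    unfolding n l2_sq using int by simp
  finally have "intT (\<lambda>y. (norm (wgrad f y))\<^sup>2) = (\<Sum>i\<in>UNIV. (l2 cellM (jet f (Some i)))\<^sup>2)" .
  moreover have "intT (\<lambda>y. (f y)\<^sup>2) = (l2 cellM (jet f None))\<^sup>2"
    unfolding l2_sq using int[of None] by (simp add: intT_eq)
  ultimately show ?thesis by (simp add: h1norm_def L2_set_def sum_option)
qed

lemma h1norm_nonneg: "H1 f \<Longrightarrow> 0 \<le> h1norm f"
  by (simp add: h1norm_eq L2_set_nonneg)

lemma l2_jet_le: "H1 f \<Longrightarrow> l2 cellM (jet f \<alpha>) \<le> h1norm f"
  using member_le_L2_set[of UNIV \<alpha> "\<lambda>\<alpha>. l2 cellM (jet f \<alpha>)"] by (simp add: h1norm_eq)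

lemma h1norm_le_sum: "H1 f \<Longrightarrow> h1norm f \<le> l2 cellM f + (\<Sum>i\<in>UNIV. l2 cellM (jet f (Some i)))"
  using L2_set_le_sum[of UNIV "\<lambda>\<alpha>. l2 cellM (jet f \<alpha>)"] by (simp add: h1norm_eq sum_option)

lemma h1norm_cong:
  assumes "H1 f" "H1 g" "AE y in cellM. f y = g y"
  shows "h1norm f = h1norm g"
proof -
  have "l2 cellM (jet f \<alpha>) = l2 cellM (jet g \<alpha>)" for \<alpha>
    using jet_cong[OF assms] jet_sqint[OF assms(1)] jet_sqint[OF assms(2)]
    by (intro l2_cong_AE) (auto simp: sqint_def elim!: eventually_mono)
  then show ?thesis by (simp add: h1norm_eq assms)
qed

lemma h1norm_lincomb:
  assumes f: "H1 f" and g: "H1 g"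
  shows "h1norm (\<lambda>y. b * f y + c * g y) \<le> \<bar>b\<bar> * h1norm f + \<bar>c\<bar> * h1norm g"
proof -
  have "l2 cellM (jet (\<lambda>y. b * f y + c * g y) \<alpha>) \<le> \<bar>b\<bar> * l2 cellM (jet f \<alpha>) + \<bar>c\<bar> * l2 cellM (jet g \<alpha>)" for \<alpha>
  proof -
    have s: "sqint cellM (\<lambda>y. b * jet f \<alpha> y)" "sqint cellM (\<lambda>y. c * jet g \<alpha> y)"
      by (intro sqint_cmult jet_sqint f g)+
    have "l2 cellM (jet (\<lambda>y. b * f y + c * g y) \<alpha>) = l2 cellM (\<lambda>y. b * jet f \<alpha> y + c * jet g \<alpha> y)"
      using H1_lincomb(2)[OF f g, of b c] jet_sqint[OF H1_lincomb(1)[OF f g, of b c], of \<alpha>] sqint_add[OF s]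
      by (intro l2_cong_AE) (auto simp: sqint_def elim!: eventually_mono)
    also have "\<dots> \<le> \<bar>b\<bar> * l2 cellM (jet f \<alpha>) + \<bar>c\<bar> * l2 cellM (jet g \<alpha>)"
      using l2_triangle[OF s] by (simp add: l2_cmult)
    finally show ?thesis .
  qed
  then have "h1norm (\<lambda>y. b * f y + c * g y) \<le>
     L2_set (\<lambda>\<alpha>. \<bar>b\<bar> * l2 cellM (jet f \<alpha>) + \<bar>c\<bar> * l2 cellM (jet g \<alpha>)) UNIV"
    by (simp add: h1norm_eq H1_lincomb f g L2_set_mono)
  also have "\<dots> \<le> L2_set (\<lambda>\<alpha>. \<bar>b\<bar> * l2 cellM (jet f \<alpha>)) UNIV + L2_set (\<lambda>\<alpha>. \<bar>c\<bar> * l2 cellM (jet g \<alpha>)) UNIV"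
    by (rule L2_set_triangle_ineq)
  also have "\<dots> = \<bar>b\<bar> * h1norm f + \<bar>c\<bar> * h1norm g"
    by (simp add: h1norm_eq f g L2_set_right_distrib)
  finally show ?thesis .
qed

lemma h1norm_diff_triangle:
  assumes "H1 f" "H1 g"
  shows "h1norm f \<le> h1norm g + h1norm (\<lambda>y. f y - g y)"
  using h1norm_lincomb[OF assms(2) H1_diff[OF assms], of 1 1] by simp

lemma h1norm_minus: "H1 f \<Longrightarrow> h1norm (\<lambda>y. - f y) = h1norm f"
  using h1norm_lincomb[of f f "-1" 0] h1norm_lincomb[of "\<lambda>y. - f y" "\<lambda>y. - f y" "-1" 0] H1_cmult[of f "-1"]
  by simp

lemma h1norm_diff_commute:
  "H1 f \<Longrightarrow> H1 g \<Longrightarrow> h1norm (\<lambda>y. f y - g y) = h1norm (\<lambda>y. g y - f y)"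
  using h1norm_minus[OF H1_diff[of f g]] by simp

lemma l2_jet_diff_le:
  assumes "H1 f" "H1 g"
  shows "l2 cellM (\<lambda>y. jet f \<alpha> y - jet g \<alpha> y) \<le> h1norm (\<lambda>y. f y - g y)"
proof -
  have "l2 cellM (\<lambda>y. jet f \<alpha> y - jet g \<alpha> y) = l2 cellM (jet (\<lambda>y. f y - g y) \<alpha>)"
    using H1_lincomb(2)[OF assms, of 1 "-1"] jet_sqint[OF H1_diff[OF assms], of \<alpha>]
      sqint_diff[OF jet_sqint[OF assms(1), of \<alpha>] jet_sqint[OF assms(2), of \<alpha>]]
    by (intro l2_cong_AE) (auto simp: sqint_def elim!: eventually_mono)
  then show ?thesis using l2_jet_le[OF H1_diff[OF assms]] by simp
qed

section \<open>Completeness of the Sobolev space\<close>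

text \<open>\<open>H1\<close> demands periodicity at every point, whereas a limit in L2 is known
  only almost everywhere on the cell; such a limit needs a periodic representative.\<close>

lemma periodic_extension:
  assumes g: "sqint cellM (g :: real^'d \<Rightarrow> real)"
  obtains g' where "periodic g'" "sqint cellM g'" "AE y in cellM. g' y = g y"
proof -
  define I :: "(real^'d) set" where "I = {y. \<forall>i. 0 < y $ i \<and> y $ i < 1}"
  have [measurable]: "I \<in> sets borel" unfolding I_def by measurable
  \<comment> \<open>The indicator erases the faces of the cell. On the closed cell \<open>g'\<close>
    then equals \<open>g\<close> times a Borel indicator, which settles measurability although
    \<open>fracv\<close> moves the points of the upper faces.\<close>
  define g' where "g' = (\<lambda>y. indicator I (fracv y) * g (fracv y))"
  have eq: "g' y = indicator I y * g y" if "y \<in> cellT" for y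
  proof (cases "y \<in> I")
    case True
    then have "frac (y $ i) = y $ i" for i by (simp add: frac_eq less_imp_le I_def)
    then have "fracv y = y" by (simp add: fracv_def vec_eq_iff)
    then show ?thesis by (simp add: g'_def)
  next
    case False
    then obtain i where "\<not> (0 < y $ i \<and> y $ i < 1)" by (auto simp: I_def)
    then have "y $ i = 0 \<or> y $ i = 1" using that[unfolded cellT_iff, rule_format, of i] by linarith
    then have "fracv y $ i = 0" by (auto simp: fracv_def)
    then have "fracv y \<notin> I" by (metis (mono_tags, lifting) I_def less_irrefl mem_Collect_eq)
    then show ?thesis using False by (simp add: g'_def)
  qed
  have "sqint cellM (\<lambda>y. indicator I y * g y)"
  proof (rule sqint_bounded_mult[OF g])
    show "indicator I \<in> borel_measurable cellM"
      by (intro measurable_restrict_space1 borel_measurable_indicator) simp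
    show "AE y in cellM. \<bar>indicator I y\<bar> \<le> (1::real)"
      by (simp add: indicator_def)
  qed
  moreover have "sqint cellM g' \<longleftrightarrow> sqint cellM (\<lambda>y. indicator I y * g y)"
    unfolding sqint_def using eq
    by (intro arg_cong2[where f="(\<and>)"] measurable_cong Bochner_Integration.integrable_cong) auto
  moreover have "periodic g'"
    using fracv_periodic[where 'a='d] by (simp add: periodic_def g'_def)
  moreover have "AE y in cellM. g' y = g y"
    using AE_cell_interior AE_space[of cellM]
    by eventually_elim (simp add: eq I_def)
  ultimately show ?thesis using that by blast
qed

text \<open>Each component of the jets converges in L2, and the identity defining weak gradients
  passes to the limit because it is tested with fixed square integrable functions.\<close>

lemma H1_complete:
  fixes f :: "nat \<Rightarrow> real^'d \<Rightarrow> real"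
  assumes f: "\<And>n. H1 (f n)"
    and cau: "\<And>e. e > 0 \<Longrightarrow> \<exists>N. \<forall>i\<ge>N. \<forall>j\<ge>N. h1norm (\<lambda>y. f i y - f j y) < e"
  obtains v where "H1 v" "(\<lambda>n. h1norm (\<lambda>y. f n y - v y)) \<longlonglongrightarrow> 0"
proof -
  have "\<exists>g. sqint cellM g \<and> (\<lambda>n. l2 cellM (\<lambda>y. jet (f n) \<alpha> y - g y)) \<longlonglongrightarrow> 0" for \<alpha>
  proof -
    have "\<exists>N. \<forall>i\<ge>N. \<forall>j\<ge>N. l2 cellM (\<lambda>y. jet (f i) \<alpha> y - jet (f j) \<alpha> y) < e" if "e > 0" for e
    proof -
      obtain N where N: "\<And>i j. i \<ge> N \<Longrightarrow> j \<ge> N \<Longrightarrow> h1norm (\<lambda>y. f i y - f j y) < e"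
        using cau[OF \<open>e > 0\<close>] by blast
      show ?thesis
        by (intro exI[of _ N] allI impI le_less_trans[OF l2_jet_diff_le[OF f f]] N)
    qed
    then show ?thesis
      by (rule cellM.l2_complete[of "\<lambda>n. jet (f n) \<alpha>", OF jet_sqint[OF f]]) blast+
  qed
  then have ex: "\<exists>g. sqint cellM g \<and> (\<lambda>n. l2 cellM (\<lambda>y. jet (f n) \<alpha> y - g y)) \<longlonglongrightarrow> 0" for \<alpha> .
  define g where "g \<alpha> = (SOME g. sqint cellM g \<and> (\<lambda>n. l2 cellM (\<lambda>y. jet (f n) \<alpha> y - g y)) \<longlonglongrightarrow> 0)" for \<alpha>
  have g: "sqint cellM (g \<alpha>)" and lim: "(\<lambda>n. l2 cellM (\<lambda>y. jet (f n) \<alpha> y - g \<alpha> y)) \<longlonglongrightarrow> 0" for \<alpha>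
    using someI_ex[OF ex[of \<alpha>]] unfolding g_def by blast+
  obtain v where v: "periodic v" "sqint cellM v" "AE y in cellM. v y = g None y"
    using periodic_extension[OF g] .
  have vg: "(LINT y|cellM. v y * h y) = (LINT y|cellM. g None y * h y)" if "sqint cellM h" for h
  proof (rule integral_cong_AE)
    show "AE y in cellM. v y * h y = g None y * h y" using v(3) by eventually_elim simp
  qed (intro borel_measurable_times sqint_measurable v g that)+
  have wg: "weak_grad v (\<lambda>y. \<chi> i. g (Some i) y)"
    unfolding weak_grad_iff[OF v(2)]
  proof (intro conjI allI impI)
    show "sqint cellM (\<lambda>y. (\<chi> i. g (Some i) y) $ i)" for i using g by simp
    fix \<phi> :: "real^'d \<Rightarrow> real" and i assume \<phi>: "testfun \<phi>"
    then have T: "sqint cellM \<phi>" "sqint cellM (tpd i \<phi>)"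
      by (intro sqint_continuous testfun_cont testfun_tpd_cont; assumption)+
    have "(\<lambda>n. LINT y|cellM. jet (f n) None y * tpd i \<phi> y) \<longlonglongrightarrow> (LINT y|cellM. g None y * tpd i \<phi> y)"
      by (intro sqint_integral_tendsto jet_sqint f g T lim)
    moreover have "(\<lambda>n. LINT y|cellM. jet (f n) (Some i) y * \<phi> y) \<longlonglongrightarrow> (LINT y|cellM. g (Some i) y * \<phi> y)"
      by (intro sqint_integral_tendsto jet_sqint f g T lim)
    moreover have "(LINT y|cellM. jet (f n) None y * tpd i \<phi> y) = - (LINT y|cellM. jet (f n) (Some i) y * \<phi> y)" for n
      using H1_wgrad[OF f] \<phi> by (simp add: weak_grad_iff[OF H1_sqint[OF f]] jet_Some)
    ultimately have "(\<lambda>n. - (LINT y|cellM. jet (f n) (Some i) y * \<phi> y)) \<longlonglongrightarrow> (LINT y|cellM. g None y * tpd i \<phi> y)"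
      "(\<lambda>n. - (LINT y|cellM. jet (f n) (Some i) y * \<phi> y)) \<longlonglongrightarrow> - (LINT y|cellM. g (Some i) y * \<phi> y)"
      by (simp_all only: tendsto_minus)
    then have "(LINT y|cellM. g None y * tpd i \<phi> y) = - (LINT y|cellM. g (Some i) y * \<phi> y)"
      by (rule LIMSEQ_unique)
    then show "(LINT y|cellM. v y * tpd i \<phi> y) = - (LINT y|cellM. (\<chi> i. g (Some i) y) $ i * \<phi> y)"
      by (simp add: vg T)
  qed
  have H: "H1 v" unfolding H1_iff using v wg by blast
  have jv: "AE y in cellM. \<forall>\<alpha>. jet v \<alpha> y = g \<alpha> y"
    using jet_eqI[OF H v(2) wg AE_I2[OF refl]] v(3)
  proof eventually_elim
    case (elim y)
    have "jet v \<alpha> y = g \<alpha> y" for \<alpha>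
      using elim(1)[rule_format, of \<alpha>] elim(2) by (cases \<alpha>) simp_all
    then show ?case by simp
  qed
  have "(\<lambda>n. l2 cellM (jet (\<lambda>y. f n y - v y) \<alpha>)) \<longlonglongrightarrow> 0" for \<alpha>
  proof -
    have "l2 cellM (jet (\<lambda>y. f n y - v y) \<alpha>) = l2 cellM (\<lambda>y. jet (f n) \<alpha> y - g \<alpha> y)" for n
    proof (rule l2_cong_AE)
      show "AE y in cellM. jet (\<lambda>y. f n y - v y) \<alpha> y = jet (f n) \<alpha> y - g \<alpha> y"
        using H1_lincomb(2)[OF f[of n] H, of 1 "-1"] jv by eventually_elim simp
    qed (intro sqint_measurable jet_sqint H1_diff sqint_diff f H g)+
    then show ?thesis using lim by simp
  qed
  then have "(\<lambda>n. \<Sum>\<alpha>\<in>UNIV. l2 cellM (jet (\<lambda>y. f n y - v y) \<alpha>)) \<longlonglongrightarrow> (\<Sum>\<alpha>\<in>(UNIV :: 'd option set). 0)"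
    by (intro tendsto_sum)
  then have sumlim: "(\<lambda>n. \<Sum>\<alpha>\<in>UNIV. l2 cellM (jet (\<lambda>y. f n y - v y) \<alpha>)) \<longlonglongrightarrow> 0" by simp
  have "(\<lambda>n. h1norm (\<lambda>y. f n y - v y)) \<longlonglongrightarrow> 0"
  proof (rule Lim_null_comparison[OF _ sumlim], rule always_eventually, rule allI)
    show "norm (h1norm (\<lambda>y. f n y - v y)) \<le> (\<Sum>\<alpha>\<in>UNIV. l2 cellM (jet (\<lambda>y. f n y - v y) \<alpha>))" for n
      using h1norm_le_sum[OF H1_diff[OF f H]] h1norm_nonneg[OF H1_diff[OF f H]] by (simp add: sum_option)
  qed
  then show ?thesis using that H by blast
qed

section \<open>Bilinear forms in the first-order jets\<close>

abbreviation jet_sum :: "('d option \<Rightarrow> 'd option \<Rightarrow> real^'d \<Rightarrow> real) \<Rightarrow> (real^'d \<Rightarrow> real) \<Rightarrow> ('d option \<Rightarrow> real^'d \<Rightarrow> real) \<Rightarrow> real^'d \<Rightarrow> real" where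
  "jet_sum c u w y \<equiv> \<Sum>\<alpha>\<in>UNIV. \<Sum>\<beta>\<in>UNIV. c \<alpha> \<beta> y * jet u \<alpha> y * w \<beta> y"

text \<open>Up to derivatives in (t,x), all of \<open>Ayy\<close>, \<open>Axy\<close>,
  \<open>Axx\<close> and \<open>Rtt\<close> reduce to such forms, so linearity, boundedness and
  insensitivity to null sets are proved once. The order of the indices of \<open>c\<close> matters,
  since \<open>c\<close> need not be symmetric.\<close>

definition form :: "('d option \<Rightarrow> 'd option \<Rightarrow> real^'d \<Rightarrow> real) \<Rightarrow> (real^'d \<Rightarrow> real) \<Rightarrow> (real^'d \<Rightarrow> real) \<Rightarrow> real" where
  "form c u v = (LINT y|cellM. jet_sum c u (jet v) y)"

definition coef :: "real \<Rightarrow> ('d option \<Rightarrow> 'd option \<Rightarrow> real^'d \<Rightarrow> real) \<Rightarrow> bool" where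
  "coef K c \<longleftrightarrow> (\<forall>\<alpha> \<beta>. c \<alpha> \<beta> \<in> borel_measurable cellM \<and> (AE y in cellM. \<bar>c \<alpha> \<beta> y\<bar> \<le> K))"

lemma coef_sqint: "coef K c \<Longrightarrow> H1 u \<Longrightarrow> sqint cellM (\<lambda>y. c \<alpha> \<beta> y * jet u \<alpha> y)"
  by (rule sqint_bounded_mult[OF jet_sqint]) (auto simp: coef_def)

lemma form_integrable:
  "coef K c \<Longrightarrow> H1 u \<Longrightarrow> H1 v \<Longrightarrow> integrable cellM (\<lambda>y. c \<alpha> \<beta> y * jet u \<alpha> y * jet v \<beta> y)"
  by (intro sqint_mult coef_sqint jet_sqint)

lemma form_measurable:
  "coef K c \<Longrightarrow> H1 u \<Longrightarrow> H1 v \<Longrightarrow>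
    (\<lambda>y. jet_sum c u (jet v) y) \<in> borel_measurable cellM"
  by (rule borel_measurable_sum, rule borel_measurable_sum, rule borel_measurable_integrable, rule form_integrable)

lemma form_sum:
  assumes "coef K c" "H1 u" "H1 v"
  shows "form c u v = (\<Sum>\<alpha>\<in>UNIV. \<Sum>\<beta>\<in>UNIV. LINT y|cellM. c \<alpha> \<beta> y * jet u \<alpha> y * jet v \<beta> y)"
  unfolding form_def using form_integrable[OF assms] by simp

lemma form_cong:
  assumes "coef K c" "H1 u" "H1 v" "H1 u'" "H1 v'"
    "AE y in cellM. u y = u' y" "AE y in cellM. v y = v' y"
  shows "form c u v = form c u' v'"
  unfolding form_def
proof (rule integral_cong_AE)
  show "AE y in cellM. jet_sum c u (jet v) y =
      jet_sum c u' (jet v') y"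
    using jet_cong[OF assms(2,4,6)] jet_cong[OF assms(3,5,7)] by eventually_elim simp
qed (rule form_measurable[OF assms(1)]; fact assms)+

lemma form_lincomb_left:
  assumes c: "coef K c" and u: "H1 u" and u': "H1 u'" and v: "H1 v"
  shows "form c (\<lambda>y. b * u y + d * u' y) v = b * form c u v + d * form c u' v"
proof -
  note H = H1_lincomb[OF u u', of b d]
  have "form c (\<lambda>y. b * u y + d * u' y) v =
     (LINT y|cellM. (\<Sum>\<alpha>\<in>UNIV. \<Sum>\<beta>\<in>UNIV. b * (c \<alpha> \<beta> y * jet u \<alpha> y * jet v \<beta> y) + d * (c \<alpha> \<beta> y * jet u' \<alpha> y * jet v \<beta> y)))"
    unfolding form_def
  proof (rule integral_cong_AE)
    show "AE y in cellM. (\<Sum>\<alpha>\<in>UNIV. \<Sum>\<beta>\<in>UNIV. c \<alpha> \<beta> y * jet (\<lambda>y. b * u y + d * u' y) \<alpha> y * jet v \<beta> y) =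
      (\<Sum>\<alpha>\<in>UNIV. \<Sum>\<beta>\<in>UNIV. b * (c \<alpha> \<beta> y * jet u \<alpha> y * jet v \<beta> y) + d * (c \<alpha> \<beta> y * jet u' \<alpha> y * jet v \<beta> y))"
      using H(2) by eventually_elim (simp add: algebra_simps)
    show "(\<lambda>y. \<Sum>\<alpha>\<in>UNIV. \<Sum>\<beta>\<in>UNIV. b * (c \<alpha> \<beta> y * jet u \<alpha> y * jet v \<beta> y) + d * (c \<alpha> \<beta> y * jet u' \<alpha> y * jet v \<beta> y)) \<in> borel_measurable cellM"
      by (intro borel_measurable_sum borel_measurable_integrable Bochner_Integration.integrable_add
        Bochner_Integration.integrable_mult_right form_integrable[OF c u v] form_integrable[OF c u' v])
  qed (rule form_measurable[OF c H(1) v])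
  also have "\<dots> = b * form c u v + d * form c u' v"
    unfolding form_sum[OF c u v] form_sum[OF c u' v]
    using form_integrable[OF c u v] form_integrable[OF c u' v]
    by (simp add: sum.distrib sum_distrib_left)
  finally show ?thesis .
qed

text \<open>Exchanging the arguments transposes the coefficients, so statements about the right
  argument follow from those about the left one.\<close>

lemma form_flip: "form c u v = form (\<lambda>\<alpha> \<beta>. c \<beta> \<alpha>) v u"
proof -
  have "jet_sum c u (jet v) y =
      (\<Sum>\<alpha>\<in>UNIV. \<Sum>\<beta>\<in>UNIV. c \<beta> \<alpha> y * jet v \<alpha> y * jet u \<beta> y)" for y
    by (subst sum.swap) (simp add: mult_ac)
  then show ?thesis unfolding form_def by simp
qed

lemma coef_flip: "coef K c \<Longrightarrow> coef K (\<lambda>\<alpha> \<beta>. c \<beta> \<alpha>)"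
  by (simp add: coef_def)

lemma form_lincomb_right:
  assumes c: "coef K c" and v: "H1 v" and v': "H1 v'" and u: "H1 u"
  shows "form c u (\<lambda>y. b * v y + d * v' y) = b * form c u v + d * form c u v'"
  using form_lincomb_left[OF coef_flip[OF c] v v' u, of b d] by (simp add: form_flip[of c])

text \<open>The constant counts the pairs of indices in the double sum; each term is bounded by
  Cauchy-Schwarz. The absolute value of \<open>K\<close> spares a sign condition in
  \<open>coef\<close>.\<close>

lemma form_bound:
  fixes u :: "real^'d \<Rightarrow> real"
  assumes c: "coef K c" and u: "H1 u" and v: "H1 v"
  shows "\<bar>form c u v\<bar> \<le> (real CARD('d option))\<^sup>2 * \<bar>K\<bar> * h1norm u * h1norm v"
proof -
  have one: "\<bar>LINT y|cellM. c \<alpha> \<beta> y * jet u \<alpha> y * jet v \<beta> y\<bar> \<le> \<bar>K\<bar> * h1norm u * h1norm v" for \<alpha> \<beta>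
  proof -
    have "(l2 cellM (\<lambda>y. c \<alpha> \<beta> y * jet u \<alpha> y))\<^sup>2 \<le> (l2 cellM (\<lambda>y. K * jet u \<alpha> y))\<^sup>2"
      unfolding l2_sq
    proof (rule integral_mono_AE)
      show "integrable cellM (\<lambda>y. (c \<alpha> \<beta> y * jet u \<alpha> y)\<^sup>2)" "integrable cellM (\<lambda>y. (K * jet u \<alpha> y)\<^sup>2)"
        using coef_sqint[OF c u] sqint_cmult[OF jet_sqint[OF u]] by (auto simp: sqint_def)
      have "AE y in cellM. \<bar>c \<alpha> \<beta> y\<bar> \<le> K" using c by (simp add: coef_def)
      then show "AE y in cellM. (c \<alpha> \<beta> y * jet u \<alpha> y)\<^sup>2 \<le> (K * jet u \<alpha> y)\<^sup>2"
      proof eventually_elim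
        case (elim y)
        then have "\<bar>c \<alpha> \<beta> y * jet u \<alpha> y\<bar> \<le> \<bar>K * jet u \<alpha> y\<bar>"
          by (auto simp: abs_mult intro!: mult_right_mono)
        then show ?case by (simp add: abs_le_square_iff)
      qed
    qed
    then have "l2 cellM (\<lambda>y. c \<alpha> \<beta> y * jet u \<alpha> y) \<le> l2 cellM (\<lambda>y. K * jet u \<alpha> y)"
      by (rule power2_le_imp_le) simp
    also have "\<dots> \<le> \<bar>K\<bar> * h1norm u"
      unfolding l2_cmult by (intro mult_left_mono l2_jet_le u) simp
    finally have "l2 cellM (\<lambda>y. c \<alpha> \<beta> y * jet u \<alpha> y) * l2 cellM (jet v \<beta>) \<le> \<bar>K\<bar> * h1norm u * h1norm v"
      using l2_jet_le[OF v] h1norm_nonneg[OF u] by (intro mult_mono) auto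
    then show ?thesis
      using l2_Cauchy_Schwarz[OF coef_sqint[OF c u] jet_sqint[OF v], of \<alpha> \<beta> \<beta>] by linarith
  qed
  have "\<bar>form c u v\<bar> \<le> (\<Sum>\<alpha>\<in>(UNIV::'d option set). \<Sum>\<beta>\<in>(UNIV::'d option set). \<bar>K\<bar> * h1norm u * h1norm v)"
    unfolding form_sum[OF c u v] by (intro order_trans[OF sum_abs] sum_mono one)
  then show ?thesis by (simp add: power2_eq_square)
qed

lemma form_tendsto:
  fixes v :: "real^'d \<Rightarrow> real"
  assumes c: "coef K c" and u: "\<And>n. H1 (u n)" "H1 v" and w: "H1 w"
    and lim: "(\<lambda>n. h1norm (\<lambda>y. u n y - v y)) \<longlonglongrightarrow> 0"
  shows "(\<lambda>n. form c (u n) w) \<longlonglongrightarrow> form c v w" "(\<lambda>n. form c w (u n)) \<longlonglongrightarrow> form c w v"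
proof -
  have *: "(\<lambda>n. form c (u n) w) \<longlonglongrightarrow> form c v w" if c: "coef K c" for c
  proof (rule LIM_zero_cancel, rule Lim_null_comparison)
    show "(\<lambda>n. (real CARD('d option))\<^sup>2 * \<bar>K\<bar> * h1norm (\<lambda>y. u n y - v y) * h1norm w) \<longlonglongrightarrow> 0"
      using lim by (auto intro!: tendsto_eq_intros)
    show "\<forall>\<^sub>F n in sequentially. norm (form c (u n) w - form c v w) \<le>
        (real CARD('d option))\<^sup>2 * \<bar>K\<bar> * h1norm (\<lambda>y. u n y - v y) * h1norm w"
      using form_bound[OF c H1_diff[OF u(1,2)] w] form_lincomb_left[OF c u(1,2) w, where b=1 and d="-1"] by simp
  qed
  show "(\<lambda>n. form c (u n) w) \<longlonglongrightarrow> form c v w" by (rule *[OF c])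
  show "(\<lambda>n. form c w (u n)) \<longlonglongrightarrow> form c w v"
    using *[OF coef_flip[OF c]] by (simp add: form_flip[of c w])
qed

section \<open>Variational existence for elliptic problems\<close>

text \<open>Minimising sequences of \<open>B(f, f) - 2 L(f)\<close> are Cauchy by the parallelogram law, so neither
  completeness of \<open>V\<close> nor the Riesz representation theorem is needed.\<close>

lemma Ritz_sequence:
  fixes V :: "('a \<Rightarrow> real) set" and B :: "('a \<Rightarrow> real) \<Rightarrow> ('a \<Rightarrow> real) \<Rightarrow> real"
  assumes closed: "\<And>f g b c. f \<in> V \<Longrightarrow> g \<in> V \<Longrightarrow> (\<lambda>x. b * f x + c * g x) \<in> V"
    and ne: "\<phi>\<^sub>0 \<in> V"
    and B_sym: "\<And>f g. f \<in> V \<Longrightarrow> g \<in> V \<Longrightarrow> B f g = B g f"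
    and B_lin: "\<And>f g h b c. f \<in> V \<Longrightarrow> g \<in> V \<Longrightarrow> h \<in> V \<Longrightarrow> B (\<lambda>x. b * f x + c * g x) h = b * B f h + c * B g h"
    and B_nonneg: "\<And>f. f \<in> V \<Longrightarrow> 0 \<le> B f f"
    and L_lin: "\<And>f g b c. f \<in> V \<Longrightarrow> g \<in> V \<Longrightarrow> L (\<lambda>x. b * f x + c * g x) = b * L f + c * L g"
    and L_bound: "\<And>f. f \<in> V \<Longrightarrow> \<bar>L f\<bar> \<le> C * sqrt (B f f)"
  obtains \<phi> :: "nat \<Rightarrow> 'a \<Rightarrow> real" where "\<And>n. \<phi> n \<in> V"
    and "\<And>i j. B (\<lambda>x. \<phi> i x - \<phi> j x) (\<lambda>x. \<phi> i x - \<phi> j x) \<le> 2 / real (Suc i) + 2 / real (Suc j)"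
    and "\<And>\<psi>. \<psi> \<in> V \<Longrightarrow> (\<lambda>n. B (\<phi> n) \<psi>) \<longlonglongrightarrow> L \<psi>"
proof -
  have B_quad: "B (\<lambda>x. b * f x + c * g x) (\<lambda>x. b * f x + c * g x) = b\<^sup>2 * B f f + 2 * b * c * B f g + c\<^sup>2 * B g g"
    if "f \<in> V" "g \<in> V" for f g b c
  proof -
    let ?h = "\<lambda>x. b * f x + c * g x"
    have "B ?h ?h = b * B f ?h + c * B g ?h" by (intro B_lin that closed)
    also have "B f ?h = b * B f f + c * B f g"
      using B_sym[OF that(1) closed[OF that]] B_lin[OF that that(1)] B_sym[OF that] by simp
    also have "B g ?h = b * B f g + c * B g g"
      using B_sym[OF that(2) closed[OF that]] B_lin[OF that that(2)] by simp
    finally show ?thesis by (simp add: power2_eq_square algebra_simps)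
  qed
  define J where "J f = B f f - 2 * L f" for f
  \<comment> \<open>Completing the square in \<open>sqrt (B f f)\<close> bounds the functional from
    below, so that its infimum is finite.\<close>
  have J_lower: "J f \<ge> - C\<^sup>2" if "f \<in> V" for f
  proof -
    define s where "s = sqrt (B f f)"
    have "B f f = s\<^sup>2" using B_nonneg[OF that] by (simp add: s_def)
    moreover have "L f \<le> C * s" using L_bound[OF that] by (simp add: s_def)
    moreover have "0 \<le> (s - C)\<^sup>2" by simp
    ultimately show ?thesis by (simp add: J_def power2_diff algebra_simps)
  qed
  define m where "m = Inf (J ` V)"
  have bdd: "bdd_below (J ` V)" using J_lower by (auto intro!: bdd_belowI)
  have m_le: "m \<le> J f" if "f \<in> V" for f
    unfolding m_def using that bdd by (intro cInf_lower) auto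
  have "\<exists>f\<in>V. J f < m + 1 / real (Suc n)" for n
  proof -
    have "Inf (J ` V) < m + 1 / real (Suc n)" by (simp add: m_def)
    then show ?thesis using bdd ne by (subst (asm) cInf_less_iff) auto
  qed
  then obtain \<phi> where \<phi>: "\<And>n. \<phi> n \<in> V" "\<And>n. J (\<phi> n) < m + 1 / real (Suc n)" by metis
  have cau: "B (\<lambda>x. \<phi> i x - \<phi> j x) (\<lambda>x. \<phi> i x - \<phi> j x) \<le> 2 / real (Suc i) + 2 / real (Suc j)" for i j
  proof -
    have "m \<le> J (\<lambda>x. 1/2 * \<phi> i x + 1/2 * \<phi> j x)" by (intro m_le closed \<phi>)
    also have "\<dots> = 1/4 * B (\<phi> i) (\<phi> i) + 1/2 * B (\<phi> i) (\<phi> j) + 1/4 * B (\<phi> j) (\<phi> j) - L (\<phi> i) - L (\<phi> j)"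
      unfolding J_def B_quad[OF \<phi>(1,1)] L_lin[OF \<phi>(1,1)] by (simp add: power2_eq_square)
    finally have 1: "m \<le> 1/4 * B (\<phi> i) (\<phi> i) + 1/2 * B (\<phi> i) (\<phi> j) + 1/4 * B (\<phi> j) (\<phi> j) - L (\<phi> i) - L (\<phi> j)" .
    have 2: "B (\<lambda>x. \<phi> i x - \<phi> j x) (\<lambda>x. \<phi> i x - \<phi> j x) = B (\<phi> i) (\<phi> i) - 2 * B (\<phi> i) (\<phi> j) + B (\<phi> j) (\<phi> j)"
      using B_quad[OF \<phi>(1)[of i] \<phi>(1)[of j], of 1 "-1"] by simp
    have 3: "2 / real (Suc i) = 2 * (1 / real (Suc i))" "2 / real (Suc j) = 2 * (1 / real (Suc j))" by simp_all
    show ?thesis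
      unfolding 2 3 using 1 \<phi>(2)[of i] \<phi>(2)[of j] unfolding J_def by linarith
  qed
  have lim: "(\<lambda>n. B (\<phi> n) \<psi>) \<longlonglongrightarrow> L \<psi>" if \<psi>: "\<psi> \<in> V" for \<psi>
  proof -
    define b where "b = B \<psi> \<psi>"
    have b: "b \<ge> 0" using B_nonneg[OF \<psi>] by (simp add: b_def)
    have est: "norm (B (\<phi> n) \<psi> - L \<psi>) \<le> sqrt ((b + 1) / real (Suc n))" for n
    proof -
      define D where "D = B (\<phi> n) \<psi> - L \<psi>"
      \<comment> \<open>Nearly the minimiser of the quadratic
        \<open>2 * t * D + t\<^sup>2 * b\<close>; the denominator \<open>b + 1\<close> avoids
        division by zero when \<open>\<psi>\<close> has no energy.\<close>
      define t where "t = - D / (b + 1)"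
      have "m \<le> J (\<lambda>x. 1 * \<phi> n x + t * \<psi> x)" by (intro m_le closed \<phi> \<psi>)
      also have "\<dots> = J (\<phi> n) + 2 * t * D + t\<^sup>2 * b"
        unfolding J_def B_quad[OF \<phi>(1) \<psi>] L_lin[OF \<phi>(1) \<psi>] by (simp add: D_def b_def algebra_simps)
      finally have "0 \<le> 1 / real (Suc n) + 2 * t * D + t\<^sup>2 * b" using \<phi>(2)[of n] by linarith
      moreover have "t\<^sup>2 * b \<le> t\<^sup>2 * (b + 1)" by (simp add: mult_left_mono)
      moreover have "t\<^sup>2 * (b + 1) = D\<^sup>2 / (b + 1)" "2 * t * D = - 2 * (D\<^sup>2 / (b + 1))"
      proof -
        have "(- D / q)\<^sup>2 * q = D\<^sup>2 / q" "2 * (- D / q) * D = - 2 * (D\<^sup>2 / q)" if "q \<noteq> 0" for q :: real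
          using that by (simp_all add: power2_eq_square)
        then show "t\<^sup>2 * (b + 1) = D\<^sup>2 / (b + 1)" "2 * t * D = - 2 * (D\<^sup>2 / (b + 1))"
          using b by (simp_all add: t_def power2_eq_square)
      qed
      ultimately have "D\<^sup>2 / (b + 1) \<le> 1 / real (Suc n)" by linarith
      then have "D\<^sup>2 \<le> (b + 1) / real (Suc n)" using b by (simp add: field_simps)
      then show ?thesis unfolding D_def[symmetric] by (simp add: real_le_rsqrt)
    qed
    have "(\<lambda>n. sqrt ((b + 1) / real (Suc n))) \<longlonglongrightarrow> sqrt 0"
      by (intro tendsto_real_sqrt LIMSEQ_Suc[OF lim_const_over_n])
    then have "(\<lambda>n. B (\<phi> n) \<psi> - L \<psi>) \<longlonglongrightarrow> 0"
      by (intro Lim_null_comparison[OF always_eventually[OF allI[OF est]]]) simp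
    then show ?thesis by (rule LIM_zero_cancel)
  qed
  show ?thesis by (rule that[OF \<phi>(1) cau lim])
qed

text \<open>In \<open>form c u v\<close> the first index of \<open>c\<close> belongs to \<open>u\<close>, whence the transposed matrix entry.\<close>

definition acoef :: "(real^'d \<Rightarrow> real^'d^'d) \<Rightarrow> 'd option \<Rightarrow> 'd option \<Rightarrow> real^'d \<Rightarrow> real" where
  "acoef a \<alpha> \<beta> y = (case \<alpha> of None \<Rightarrow> 0 | Some i \<Rightarrow> (case \<beta> of None \<Rightarrow> 0 | Some j \<Rightarrow> a y $ j $ i))"

definition mean :: "(real^'d \<Rightarrow> real) \<Rightarrow> real" where
  "mean f = (LINT y|cellM. f y)"

lemma mean_const [simp]: "mean (\<lambda>y. c) = c"
  by (simp add: mean_def)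

lemma mean_lincomb: "H1 f \<Longrightarrow> H1 g \<Longrightarrow> mean (\<lambda>y. b * f y + c * g y) = b * mean f + c * mean g"
  by (simp add: mean_def cellM.sqint_integrable H1_sqint)

lemma mean_diff: "H1 f \<Longrightarrow> H1 g \<Longrightarrow> mean (\<lambda>y. f y - g y) = mean f - mean g"
  using mean_lincomb[of f g 1 "-1"] by simp

lemma mean_bound:
  fixes f :: "real^'d \<Rightarrow> real"
  assumes "H1 f"
  shows "\<bar>mean f\<bar> \<le> h1norm f"
proof -
  have "\<bar>LINT y|cellM. f y * 1\<bar> \<le> l2 cellM f * l2 cellM (\<lambda>y::real^'d. 1)"
    by (intro l2_Cauchy_Schwarz H1_sqint assms cellM.sqint_const)
  then have "\<bar>mean f\<bar> \<le> l2 cellM f" by (simp add: mean_def l2_def)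
  also have "\<dots> \<le> h1norm f" using l2_jet_le[OF assms, of None] by simp
  finally show ?thesis .
qed

lemma mean_intT: "H1 f \<Longrightarrow> intT f = mean f"
  by (simp add: mean_def intT_eq cellM.sqint_integrable H1_sqint)

lemma mean_cong: "H1 f \<Longrightarrow> H1 g \<Longrightarrow> AE y in cellM. f y = g y \<Longrightarrow> mean f = mean g"
  unfolding mean_def by (intro integral_cong_AE sqint_measurable H1_sqint)

lemma testfun_lincomb:
  "testfun \<phi> \<Longrightarrow> testfun \<psi> \<Longrightarrow> testfun (\<lambda>y. b * \<phi> y + c * \<psi> y)"
  by (intro testfun_add(1) testfun_cmult(1))

lemma l2_jet_testfun:
  assumes "testfun \<phi>"
  shows "l2 cellM (jet \<phi> (Some i)) = l2 cellM (tpd i \<phi>)"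
  using H1_testfun[OF assms] jet_sqint[OF H1_testfun(1)[OF assms], of "Some i"]
    sqint_continuous[OF testfun_tpd_cont[OF assms], of i]
  by (intro l2_cong_AE) (auto simp: sqint_def elim!: eventually_mono)

section \<open>Coercive forms with bounded measurable coefficients\<close>

locale elliptic =
  fixes a :: "real^'d \<Rightarrow> real^'d^'d" and m1 :: real
  assumes a_meas: "\<And>i j. (\<lambda>y. a y $ i $ j) \<in> borel_measurable lebesgue"
    and a_bdd: "\<exists>M. AE y in lebesgue. \<forall>i j. \<bar>a y $ i $ j\<bar> \<le> M"
    and a_sym: "AE y in lebesgue. \<forall>i j. a y $ i $ j = a y $ j $ i"
    and m1_pos: "m1 > 0"
    and a_ell: "AE y in lebesgue. \<forall>\<xi>. (a y *v \<xi>) \<bullet> \<xi> \<ge> m1 * (norm \<xi>)\<^sup>2"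
begin

definition aform :: "(real^'d \<Rightarrow> real) \<Rightarrow> (real^'d \<Rightarrow> real) \<Rightarrow> real" where
  "aform = form (acoef a)"

text \<open>The bound is chosen nonnegative so that the zero entries of \<open>acoef\<close> satisfy
  it as well.\<close>

definition abound :: real where
  "abound = (SOME M. M \<ge> 0 \<and> (AE y in lebesgue. \<forall>i j. \<bar>a y $ i $ j\<bar> \<le> M))"

lemma abound: "abound \<ge> 0" "AE y in lebesgue. \<forall>i j. \<bar>a y $ i $ j\<bar> \<le> abound"
proof -
  obtain M where M: "AE y in lebesgue. \<forall>i j. \<bar>a y $ i $ j\<bar> \<le> M" using a_bdd by blast
  have "AE y in lebesgue. \<forall>i j. \<bar>a y $ i $ j\<bar> \<le> max M 0"
    using M by eventually_elim (meson max.coboundedI1)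
  then have "\<exists>M. M \<ge> 0 \<and> (AE y in lebesgue. \<forall>i j. \<bar>a y $ i $ j\<bar> \<le> M)"
    by (intro exI[of _ "max M 0"]) simp
  from someI_ex[OF this] show "abound \<ge> 0" "AE y in lebesgue. \<forall>i j. \<bar>a y $ i $ j\<bar> \<le> abound"
    unfolding abound_def by blast+
qed

lemma acoef_coef: "coef abound (acoef a)"
  unfolding coef_def
proof (intro allI conjI)
  fix \<alpha> \<beta> :: "'d option"
  show "acoef a \<alpha> \<beta> \<in> borel_measurable cellM"
    using measurable_restrict_space1[OF a_meas]
    by (cases \<alpha>; cases \<beta>) (simp_all add: acoef_def[abs_def])
  show "AE y in cellM. \<bar>acoef a \<alpha> \<beta> y\<bar> \<le> abound"
    using AE_cellI[OF abound(2)]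
    by eventually_elim (use abound(1) in \<open>auto simp: acoef_def split: option.splits\<close>)
qed

lemma acoef_sum: "jet_sum (acoef a) u (jet v) y = (a y *v wgrad u y) \<bullet> wgrad v y"
proof -
  have "jet_sum (acoef a) u (jet v) y =
     (\<Sum>i\<in>UNIV. \<Sum>j\<in>UNIV. a y $ j $ i * wgrad u y $ i * wgrad v y $ j)"
    by (simp add: sum_option acoef_def jet_Some)
  also have "\<dots> = (a y *v wgrad u y) \<bullet> wgrad v y"
    by (subst sum.swap) (simp add: inner_vec_def matrix_vector_mult_def sum_distrib_right)
  finally show ?thesis .
qed

lemma aform_eq: "aform u v = (LINT y|cellM. (a y *v wgrad u y) \<bullet> wgrad v y)"
  unfolding aform_def form_def acoef_sum ..

lemma aform_integrable: "H1 u \<Longrightarrow> H1 v \<Longrightarrow> integrable cellM (\<lambda>y. (a y *v wgrad u y) \<bullet> wgrad v y)"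
  unfolding acoef_sum[symmetric]
  by (intro Bochner_Integration.integrable_sum form_integrable[OF acoef_coef])

lemma aform_sym:
  assumes "H1 u" "H1 v"
  shows "aform u v = aform v u"
  unfolding aform_eq
proof (rule integral_cong_AE)
  show "AE y in cellM. (a y *v wgrad u y) \<bullet> wgrad v y = (a y *v wgrad v y) \<bullet> wgrad u y"
    using AE_cellI[OF a_sym]
  proof eventually_elim
    case (elim y)
    then have "transpose (a y) = a y" by (simp add: transpose_def vec_eq_iff)
    then show ?case by (metis dot_lmul_matrix inner_commute transpose_matrix_vector)
  qed
qed (intro borel_measurable_integrable aform_integrable assms)+

text \<open>Ellipticity controls the gradient components only; the function itself is controlled by
  the Poincare inequality, for test functions of mean zero.\<close>

lemma aform_coercive:
  assumes "H1 u"
  shows "m1 * (\<Sum>i\<in>UNIV. (l2 cellM (jet u (Some i)))\<^sup>2) \<le> aform u u"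
proof -
  have int: "integrable cellM (\<lambda>y. (jet u (Some i) y)\<^sup>2)" for i
    using jet_sqint[OF assms, of "Some i"] by (simp add: sqint_def)
  have n: "(norm (wgrad u y))\<^sup>2 = (\<Sum>i\<in>UNIV. (jet u (Some i) y)\<^sup>2)" for y
    by (simp add: norm_vec_def L2_set_def sum_nonneg jet_Some)
  have "m1 * (\<Sum>i\<in>UNIV. (l2 cellM (jet u (Some i)))\<^sup>2) = (LINT y|cellM. m1 * (norm (wgrad u y))\<^sup>2)"
    unfolding n l2_sq using int by simp
  also have "\<dots> \<le> aform u u"
    unfolding aform_eq
  proof (rule integral_mono_AE)
    show "integrable cellM (\<lambda>y. m1 * (norm (wgrad u y))\<^sup>2)" unfolding n using int by simp
    show "AE y in cellM. m1 * (norm (wgrad u y))\<^sup>2 \<le> (a y *v wgrad u y) \<bullet> wgrad u y"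
      using AE_cellI[OF a_ell] by eventually_elim simp
  qed (intro aform_integrable assms)
  finally show ?thesis .
qed

lemma aform_nonneg: "H1 u \<Longrightarrow> 0 \<le> aform u u"
  by (rule order_trans[OF _ aform_coercive]) (use m1_pos in \<open>auto intro!: mult_nonneg_nonneg sum_nonneg\<close>)

lemma aform_const [simp]: "H1 u \<Longrightarrow> aform u (\<lambda>y. c) = 0"
  unfolding aform_eq
proof (rule integral_eq_zero_AE)
  show "AE y in cellM. (a y *v wgrad u y) \<bullet> wgrad (\<lambda>y. c) y = 0"
    using H1_const(2)[of c] by eventually_elim (simp add: inner_vec_def jet_Some)
qed

text \<open>By the Poincare inequality, \<open>h1norm \<phi>\<close> is at most twice the sum of the
  gradient norms. Squaring gives 4, Cauchy-Schwarz for finite sums gives the dimension, and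
  coercivity divides by \<open>m1\<close>.\<close>

definition poinc :: real where
  "poinc = 4 * real CARD('d) / m1"

lemma poinc_pos: "poinc > 0"
  using m1_pos by (simp add: poinc_def)

lemma testfun_poinc:
  assumes \<phi>: "testfun \<phi>" and mean: "mean \<phi> = 0"
  shows "(h1norm \<phi>)\<^sup>2 \<le> poinc * aform \<phi> \<phi>"
proof -
  note H = H1_testfun(1)[OF \<phi>]
  define D where "D i = l2 cellM (jet \<phi> (Some i))" for i
  have "l2 cellM \<phi> \<le> (\<Sum>i\<in>UNIV. D i)"
    using testfun_Poincare[OF \<phi>] mean by (simp add: mean_def D_def l2_jet_testfun[OF \<phi>])
  then have "h1norm \<phi> \<le> 2 * (\<Sum>i\<in>UNIV. D i)"
    using h1norm_le_sum[OF H] by (simp add: D_def)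
  then have "(h1norm \<phi>)\<^sup>2 \<le> (2 * (\<Sum>i\<in>UNIV. D i))\<^sup>2"
    by (intro power_mono h1norm_nonneg H)
  also have "\<dots> = 4 * (\<Sum>i\<in>UNIV. 1 * D i)\<^sup>2" by (simp add: power_mult_distrib)
  also have "\<dots> \<le> 4 * ((\<Sum>i\<in>(UNIV::'d set). 1\<^sup>2) * (\<Sum>i\<in>UNIV. (D i)\<^sup>2))"
    by (intro mult_left_mono Cauchy_Schwarz_ineq_sum) simp
  also have "\<dots> = poinc * (m1 * (\<Sum>i\<in>UNIV. (D i)\<^sup>2))"
    using m1_pos by (simp add: poinc_def)
  also have "\<dots> \<le> poinc * aform \<phi> \<phi>"
    using aform_coercive[OF H] poinc_pos by (simp add: D_def)
  finally show ?thesis .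
qed

text \<open>Ritz minimisation over mean-zero test functions, where the energy dominates the
  \<open>H1\<close> norm, followed by a passage to the limit. \<open>L_1\<close> is the solvability
  condition of the periodic problem. The approximating test functions are exported because the
  density proof is built on them.\<close>

lemma solve_exists:
  assumes L_lin: "\<And>\<phi> \<psi> b c. testfun \<phi> \<Longrightarrow> testfun \<psi> \<Longrightarrow> L (\<lambda>y. b * \<phi> y + c * \<psi> y) = b * L \<phi> + c * L \<psi>"
    and L_bound: "\<And>\<phi>. testfun \<phi> \<Longrightarrow> \<bar>L \<phi>\<bar> \<le> C * h1norm \<phi>"
    and L_1: "L (\<lambda>y. 1) = 0"
  obtains v \<phi> where "H1 v" "mean v = 0" "\<And>n::nat. testfun (\<phi> n)"
    "(\<lambda>n. h1norm (\<lambda>y. \<phi> n y - v y)) \<longlonglongrightarrow> 0"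
    "\<And>\<psi>. testfun \<psi> \<Longrightarrow> aform v \<psi> = L \<psi>"
    "h1norm v \<le> poinc * C"
proof -
  define V where "V = {\<phi> :: real^'d \<Rightarrow> real. testfun \<phi> \<and> mean \<phi> = 0}"
  have V: "testfun \<phi>" "H1 \<phi>" "mean \<phi> = 0" if "\<phi> \<in> V" for \<phi>
    using that H1_testfun(1) by (auto simp: V_def)
  \<comment> \<open>Testing the bound with the constant 1, whose norm is positive, shows that
    \<open>C\<close> is nonnegative.\<close>
  have "1 \<le> h1norm (\<lambda>y::real^'d. 1)"
    by (rule order_trans[OF _ mean_bound[OF H1_const(1)]]) simp
  then have C: "0 \<le> C"
    using L_bound[of "\<lambda>y. 1"] by (auto simp: testfun_const L_1 zero_le_mult_iff)
  have Vh: "h1norm \<phi> \<le> sqrt poinc * sqrt (aform \<phi> \<phi>)" if "\<phi> \<in> V" for \<phi>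
    using testfun_poinc[OF V(1,3)[OF that]] by (simp add: real_le_rsqrt flip: real_sqrt_mult)
  obtain \<phi> where \<phi>: "\<And>n. \<phi> n \<in> V"
    and cau: "\<And>i j. aform (\<lambda>x. \<phi> i x - \<phi> j x) (\<lambda>x. \<phi> i x - \<phi> j x) \<le> 2 / real (Suc i) + 2 / real (Suc j)"
    and lim: "\<And>\<psi>. \<psi> \<in> V \<Longrightarrow> (\<lambda>n. aform (\<phi> n) \<psi>) \<longlonglongrightarrow> L \<psi>"
  proof (rule Ritz_sequence[of V "\<lambda>y. 0" aform L "C * sqrt poinc"])
    show "(\<lambda>x. b * f x + c * g x) \<in> V" if "f \<in> V" "g \<in> V" for f g b c
      using V[OF that(1)] V[OF that(2)] by (simp add: V_def testfun_lincomb mean_lincomb)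
    show "(\<lambda>y. 0) \<in> V" by (simp add: V_def testfun_const)
    show "aform f g = aform g f" if "f \<in> V" "g \<in> V" for f g
      using that by (intro aform_sym V)
    show "aform (\<lambda>x. b * f x + c * g x) h = b * aform f h + c * aform g h" if "f \<in> V" "g \<in> V" "h \<in> V" for f g h b c
      unfolding aform_def using that by (intro form_lincomb_left[OF acoef_coef] V)
    show "0 \<le> aform f f" if "f \<in> V" for f using that by (intro aform_nonneg V)
    show "L (\<lambda>x. b * f x + c * g x) = b * L f + c * L g" if "f \<in> V" "g \<in> V" for f g b c
      using that by (intro L_lin V)
    show "\<bar>L f\<bar> \<le> C * sqrt poinc * sqrt (aform f f)" if "f \<in> V" for f
      using L_bound[OF V(1)[OF that]] mult_left_mono[OF Vh[OF that] C] by simp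
  qed (rule that)
  have diffV: "(\<lambda>y. \<phi> i y - \<phi> j y) \<in> V" for i j
    using V[OF \<phi>[of i]] V[OF \<phi>[of j]] by (simp add: V_def testfun_diff mean_diff)
  have "\<exists>N. \<forall>i\<ge>N. \<forall>j\<ge>N. h1norm (\<lambda>y. \<phi> i y - \<phi> j y) < e" if "e > 0" for e
  proof -
    \<comment> \<open>For indices beyond \<open>N\<close> the energy of a difference is at most
      \<open>4 / real N\<close>; the factor \<open>poinc\<close> then asks for \<open>N\<close>
      larger than \<open>4 * poinc / e\<^sup>2\<close>.\<close>
    obtain N where N: "4 * poinc / e\<^sup>2 < real N" using reals_Archimedean2 by blast
    have "h1norm (\<lambda>y. \<phi> i y - \<phi> j y) < e" if ij: "i \<ge> N" "j \<ge> N" for i j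
    proof -
      have "0 < real N" using N poinc_pos \<open>e > 0\<close>
        by (meson divide_pos_pos less_trans mult_pos_pos zero_less_numeral zero_less_power)
      have "2 / real (Suc i) \<le> 2 / real N" "2 / real (Suc j) \<le> 2 / real N"
        using ij \<open>0 < real N\<close> by (auto intro!: divide_left_mono)
      then have "aform (\<lambda>x. \<phi> i x - \<phi> j x) (\<lambda>x. \<phi> i x - \<phi> j x) \<le> 4 / real N"
        using cau[of i j] by simp
      then have "(h1norm (\<lambda>y. \<phi> i y - \<phi> j y))\<^sup>2 \<le> poinc * (4 / real N)"
        using testfun_poinc[OF V(1,3)[OF diffV[of i j]]] poinc_pos
        by (meson mult_left_mono less_imp_le order_trans)
      also have "\<dots> < e\<^sup>2" using N \<open>0 < real N\<close> \<open>e > 0\<close> by (simp add: field_simps)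
      finally show ?thesis by (rule power2_less_imp_less) (use \<open>e > 0\<close> in simp)
    qed
    then show ?thesis by blast
  qed
  from H1_complete[of \<phi>, OF V(2)[OF \<phi>] this]
  obtain v where v: "H1 v" "(\<lambda>n. h1norm (\<lambda>y. \<phi> n y - v y)) \<longlonglongrightarrow> 0" by blast
  have mean: "mean v = 0"
  proof -
    have "norm (mean v) \<le> h1norm (\<lambda>y. \<phi> n y - v y)" for n
      using mean_bound[OF H1_diff[OF V(2)[OF \<phi>[of n]] v(1)]] mean_diff[OF V(2)[OF \<phi>[of n]] v(1)] V(3)[OF \<phi>[of n]] by simp
    then have "(\<lambda>n. mean v) \<longlonglongrightarrow> 0"
      by (intro Lim_null_comparison[OF _ v(2)]) simp
    then show ?thesis by (simp add: LIMSEQ_const_iff)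
  qed
  have eqV: "aform v \<psi> = L \<psi>" if "\<psi> \<in> V" for \<psi>
    using form_tendsto(1)[OF acoef_coef V(2)[OF \<phi>] v(1) V(2)[OF that] v(2)] lim[OF that]
    unfolding aform_def[symmetric] by (rule LIMSEQ_unique)
  have eq: "aform v \<psi> = L \<psi>" if \<psi>: "testfun \<psi>" for \<psi>
  proof -
    note H = H1_testfun(1)[OF \<psi>]
    \<comment> \<open>Subtracting the mean makes any test function admissible; neither the form nor
      \<open>L\<close> sees the constant.\<close>
    have W: "(\<lambda>y. 1 * \<psi> y + (- mean \<psi>) * 1) \<in> V"
      using mean_lincomb[OF H H1_const(1)[of 1], of 1 "- mean \<psi>"] testfun_lincomb[OF \<psi> testfun_const(1)[of 1], of 1 "- mean \<psi>"]
      by (simp add: V_def)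
    have "aform v (\<lambda>y. 1 * \<psi> y + (- mean \<psi>) * 1) = 1 * aform v \<psi> + (- mean \<psi>) * aform v (\<lambda>y. 1)"
      unfolding aform_def by (rule form_lincomb_right[OF acoef_coef H H1_const(1) v(1)])
    moreover have "L (\<lambda>y. 1 * \<psi> y + (- mean \<psi>) * 1) = 1 * L \<psi> + (- mean \<psi>) * L (\<lambda>y. 1)"
      by (rule L_lin[OF \<psi> testfun_const(1)])
    ultimately show ?thesis using eqV[OF W] v(1) by (simp add: L_1)
  qed
  have "h1norm v \<le> poinc * C"
  proof -
    define K where "K = (real CARD('d option))\<^sup>2 * \<bar>abound\<bar>"
    define \<epsilon> where "\<epsilon> n = h1norm (\<lambda>y. \<phi> n y - v y)" for n
    have \<epsilon>0: "\<epsilon> n \<ge> 0" for n unfolding \<epsilon>_def by (intro h1norm_nonneg H1_diff v V \<phi>)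
    have K0: "K \<ge> 0" by (simp add: K_def)
    \<comment> \<open>The bound on \<open>L\<close> and the equation are available on test
      functions, so the energy estimate is run for \<open>\<phi> n\<close> and carries an error
      \<open>\<epsilon> n\<close> that disappears in the limit.\<close>
    have "h1norm v \<le> \<epsilon> n + poinc * (C + K * \<epsilon> n)" for n
    proof -
      define h where "h = h1norm (\<phi> n)"
      have h0: "h \<ge> 0" unfolding h_def by (intro h1norm_nonneg V \<phi>)
      have "aform (\<phi> n) (\<phi> n) = aform v (\<phi> n) + aform (\<lambda>y. \<phi> n y - v y) (\<phi> n)"
        unfolding aform_def using form_lincomb_left[OF acoef_coef V(2)[OF \<phi>] v(1) V(2)[OF \<phi>], where b = 1 and d = "-1", of n n] by simp
      also have "\<dots> \<le> C * h + K * \<epsilon> n * h"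
        using form_bound[OF acoef_coef H1_diff[OF V(2)[OF \<phi>[of n]] v(1)] V(2)[OF \<phi>[of n]]]
          L_bound[OF V(1)[OF \<phi>[of n]]] eqV[OF \<phi>[of n]]
        unfolding aform_def h_def K_def \<epsilon>_def by linarith
      finally have "aform (\<phi> n) (\<phi> n) \<le> (C + K * \<epsilon> n) * h" by (simp add: algebra_simps)
      then have "poinc * aform (\<phi> n) (\<phi> n) \<le> poinc * ((C + K * \<epsilon> n) * h)"
        using poinc_pos by (intro mult_left_mono) auto
      then have "h\<^sup>2 \<le> poinc * (C + K * \<epsilon> n) * h"
        using testfun_poinc[OF V(1,3)[OF \<phi>[of n]]] by (simp add: h_def mult.assoc)
      then have "h \<le> poinc * (C + K * \<epsilon> n)"
        using h0 poinc_pos C K0 \<epsilon>0[of n]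
        by (cases "h = 0") (auto simp: power2_eq_square intro!: mult_nonneg_nonneg add_nonneg_nonneg)
      then show ?thesis
        using h1norm_diff_triangle[OF v(1) V(2)[OF \<phi>[of n]]] h1norm_diff_commute[OF v(1) V(2)[OF \<phi>[of n]]]
        unfolding h_def \<epsilon>_def by linarith
    qed
    moreover have "(\<lambda>n. \<epsilon> n + poinc * (C + K * \<epsilon> n)) \<longlonglongrightarrow> 0 + poinc * (C + K * 0)"
      using v(2) unfolding \<epsilon>_def by (intro tendsto_intros)
    ultimately show ?thesis by (intro LIMSEQ_le_const) auto
  qed
  then show ?thesis using that[OF v(1) mean V(1)[OF \<phi>] v(2) eq] by blast
qed

end

section \<open>Density of test functions and uniqueness\<close>

text \<open>The Dirichlet form serves as an auxiliary problem: trigonometric functions are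
  eigenfunctions of its operator, which proves density of test functions independently of
  \<open>a\<close>.\<close>

interpretation laplace: elliptic "\<lambda>_ :: real^'d. mat 1" 1
proof
  show "(\<lambda>y :: real^'d. (mat 1 :: real^'d^'d) $ i $ j) \<in> borel_measurable lebesgue" for i j by simp
  show "\<exists>M. AE y :: real^'d in lebesgue. \<forall>i j. \<bar>(mat 1 :: real^'d^'d) $ i $ j\<bar> \<le> M"
    by (intro exI[of _ 1]) (simp add: mat_def)
  show "AE y :: real^'d in lebesgue. \<forall>i j. (mat 1 :: real^'d^'d) $ i $ j = (mat 1 :: real^'d^'d) $ j $ i"
    by (simp add: mat_def)
qed (simp_all add: power2_norm_eq_inner)

lemma laplace_testfun:
  assumes w: "H1 w" and \<psi>: "testfun \<psi>"
  shows "laplace.aform w \<psi> = (\<Sum>i\<in>UNIV. LINT y|cellM. jet w (Some i) y * tpd i \<psi> y)"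
proof -
  have int: "integrable cellM (\<lambda>y. jet w (Some i) y * tpd i \<psi> y)" for i
    by (intro sqint_mult jet_sqint w sqint_continuous testfun_tpd_cont \<psi>)
  have "laplace.aform w \<psi> = (LINT y|cellM. (\<Sum>i\<in>UNIV. jet w (Some i) y * tpd i \<psi> y))"
    unfolding laplace.aform_eq
  proof (rule integral_cong_AE)
    show "AE y in cellM. (mat 1 *v wgrad w y) \<bullet> wgrad \<psi> y = (\<Sum>i\<in>UNIV. jet w (Some i) y * tpd i \<psi> y)"
      using H1_testfun(2)[OF \<psi>] by eventually_elim (simp add: inner_vec_def jet_Some)
    show "(\<lambda>y. (mat 1 *v wgrad w y) \<bullet> wgrad \<psi> y) \<in> borel_measurable cellM"
      by (intro borel_measurable_integrable laplace.aform_integrable w H1_testfun \<psi>)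
    show "(\<lambda>y. \<Sum>i\<in>UNIV. jet w (Some i) y * tpd i \<psi> y) \<in> borel_measurable cellM"
      by (intro borel_measurable_sum borel_measurable_integrable int)
  qed
  also have "\<dots> = (\<Sum>i\<in>UNIV. LINT y|cellM. jet w (Some i) y * tpd i \<psi> y)"
    using int by simp
  finally show ?thesis .
qed

text \<open>Testing with an eigenfunction of each \<open>\<partial>\<^sub>i\<^sup>2\<close> moves the whole Laplacian onto the test function,
  although \<open>w\<close> has only one weak derivative.\<close>

lemma weakly_harmonic_eigen:
  assumes w: "H1 w" and harm: "\<And>\<psi>. testfun \<psi> \<Longrightarrow> laplace.aform w \<psi> = 0"
    and \<psi>: "testfun \<psi>" and d\<psi>: "\<And>i. testfun (tpd i \<psi>)"
    and eig: "\<And>i. tpd i (tpd i \<psi>) = (\<lambda>y. - (c i)\<^sup>2 * \<psi> y)" and c: "c i \<noteq> 0"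
  shows "(LINT y|cellM. w y * \<psi> y) = 0"
proof -
  have "(LINT y|cellM. jet w (Some i) y * tpd i \<psi> y) = (c i)\<^sup>2 * (LINT y|cellM. w y * \<psi> y)" for i
  proof -
    have "- (LINT y|cellM. jet w (Some i) y * tpd i \<psi> y) = (LINT y|cellM. w y * tpd i (tpd i \<psi>) y)"
      using H1_wgrad[OF w] d\<psi>[of i] by (simp add: weak_grad_iff[OF H1_sqint[OF w]] jet_Some)
    also have "\<dots> = - (c i)\<^sup>2 * (LINT y|cellM. w y * \<psi> y)"
      unfolding eig by (simp add: mult.left_commute[of "w _"])
    finally show ?thesis by simp
  qed
  then have "(\<Sum>i\<in>UNIV. (c i)\<^sup>2) * (LINT y|cellM. w y * \<psi> y) = 0"
    using harm[OF \<psi>] laplace_testfun[OF w \<psi>] by (simp add: sum_distrib_right)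
  moreover have "(\<Sum>i\<in>UNIV. (c i)\<^sup>2) > 0"
    using c by (intro sum_pos2[of _ i]) auto
  ultimately show ?thesis by simp
qed

text \<open>Nonzero frequencies are removed by \<open>weakly_harmonic_eigen\<close> and frequency
  zero by the mean, so completeness of the trigonometric system applies.\<close>

lemma weakly_harmonic_zero:
  fixes w :: "real^'d \<Rightarrow> real"
  assumes w: "H1 w" and harm: "\<And>\<psi>. testfun \<psi> \<Longrightarrow> laplace.aform w \<psi> = 0" and mean: "mean w = 0"
  shows "AE y in cellM. w y = 0"
proof (rule trig_complete)
  show "integrable cellM w" by (intro cellM.sqint_integrable H1_sqint w)
  fix k :: "'d \<Rightarrow> int"
  have dcos: "testfun (tpd i (\<lambda>y. cos (phase k y)))"
    "tpd i (tpd i (\<lambda>y. cos (phase k y))) = (\<lambda>y. - (2 * pi * of_int (k i))\<^sup>2 * cos (phase k y))" for i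
    using testfun_cmult[OF testfun_sin_phase(1)[of k], where c = "- 2 * pi * of_int (k i)"]
    by (simp_all add: testfun_cos_phase testfun_sin_phase power2_eq_square algebra_simps)
  have dsin: "testfun (tpd i (\<lambda>y. sin (phase k y)))"
    "tpd i (tpd i (\<lambda>y. sin (phase k y))) = (\<lambda>y. - (2 * pi * of_int (k i))\<^sup>2 * sin (phase k y))" for i
    using testfun_cmult[OF testfun_cos_phase(1)[of k], where c = "2 * pi * of_int (k i)"]
    by (simp_all add: testfun_cos_phase testfun_sin_phase power2_eq_square algebra_simps)
  have "(LINT y|cellM. w y * cos (phase k y)) = 0 \<and> (LINT y|cellM. w y * sin (phase k y)) = 0"
  proof (cases "\<exists>i. k i \<noteq> 0")
    case True
    then obtain i where "2 * pi * of_int (k i) \<noteq> 0" by auto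
    then show ?thesis
      using weakly_harmonic_eigen[OF w harm testfun_cos_phase(1) dcos, of i]
        weakly_harmonic_eigen[OF w harm testfun_sin_phase(1) dsin, of i] by blast
  next
    case False
    then have "phase k y = 0" for y by (simp add: phase_def)
    then show ?thesis using mean by (simp add: mean_def)
  qed
  then show "(LINT y|cellM. w y * cos (phase k y)) = 0" "(LINT y|cellM. w y * sin (phase k y)) = 0"
    by blast+
qed

text \<open>Solving the Dirichlet problem with data \<open>laplace.aform v\<close> projects
  \<open>v\<close> onto the closure of the mean-zero test functions. What remains after restoring
  the mean is weakly harmonic with mean zero, hence vanishes; so the Ritz approximants of the
  projection, shifted by the mean, converge to \<open>v\<close>.\<close>

lemma testfun_dense:
  fixes v :: "real^'d \<Rightarrow> real"
  assumes v: "H1 v"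
  obtains \<phi> where "\<And>n::nat. testfun (\<phi> n)" "(\<lambda>n. h1norm (\<lambda>y. \<phi> n y - v y)) \<longlonglongrightarrow> 0"
proof -
  have lin: "laplace.aform v (\<lambda>y. b * f y + c * g y) = b * laplace.aform v f + c * laplace.aform v g"
    if "H1 f" "H1 g" for f g b c
    unfolding laplace.aform_def by (rule form_lincomb_right[OF laplace.acoef_coef that v])
  obtain p \<phi> where p: "H1 p" "mean p = 0" "\<And>n::nat. testfun (\<phi> n)"
    "(\<lambda>n. h1norm (\<lambda>y. \<phi> n y - p y)) \<longlonglongrightarrow> 0"
    "\<And>\<psi>. testfun \<psi> \<Longrightarrow> laplace.aform p \<psi> = laplace.aform v \<psi>"
  proof (rule laplace.solve_exists[of "laplace.aform v" "(real CARD('d option))\<^sup>2 * \<bar>laplace.abound TYPE('d)\<bar> * h1norm v"])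
    show "\<bar>laplace.aform v \<phi>\<bar> \<le> (real CARD('d option))\<^sup>2 * \<bar>laplace.abound TYPE('d)\<bar> * h1norm v * h1norm \<phi>"
      if "testfun \<phi>" for \<phi>
      unfolding laplace.aform_def by (rule form_bound[OF laplace.acoef_coef v H1_testfun(1)[OF that]])
    show "laplace.aform v (\<lambda>y. b * \<phi> y + c * \<psi> y) = b * laplace.aform v \<phi> + c * laplace.aform v \<psi>"
      if "testfun \<phi>" "testfun \<psi>" for \<phi> \<psi> b c
      using that by (intro lin H1_testfun(1))
  qed (simp add: laplace.aform_const[OF v], blast)
  define m where "m = mean v"
  define w where "w = (\<lambda>y. v y - (p y + m))"
  have pm: "H1 (\<lambda>y. p y + m)" by (intro H1_add p H1_const)
  have w: "H1 w" unfolding w_def by (intro H1_diff v pm)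
  have "AE y in cellM. w y = 0"
  proof (rule weakly_harmonic_zero[OF w])
    show "mean w = 0"
      using mean_lincomb[OF p(1) H1_const(1), of 1 1 m] p(2) unfolding w_def mean_diff[OF v pm] by (simp add: m_def)
    fix \<psi> :: "real^'d \<Rightarrow> real" assume \<psi>: "testfun \<psi>"
    have w_eq: "w = (\<lambda>y. 1 * v y + (-1) * (p y + m))" by (simp add: w_def fun_eq_iff)
    have "laplace.aform (\<lambda>y. 1 * p y + 1 * m) \<psi> = 1 * laplace.aform p \<psi> + 1 * laplace.aform (\<lambda>y. m) \<psi>"
      unfolding laplace.aform_def
      by (rule form_lincomb_left[OF laplace.acoef_coef p(1) H1_const(1) H1_testfun(1)[OF \<psi>]])
    moreover have "laplace.aform (\<lambda>y. m) \<psi> = 0"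
      using laplace.aform_sym[OF H1_const(1) H1_testfun(1)[OF \<psi>], of m] H1_testfun(1)[OF \<psi>] by simp
    moreover have "laplace.aform w \<psi> = 1 * laplace.aform v \<psi> + (-1) * laplace.aform (\<lambda>y. p y + m) \<psi>"
      unfolding laplace.aform_def w_eq
      by (rule form_lincomb_left[OF laplace.acoef_coef v pm H1_testfun(1)[OF \<psi>]])
    ultimately show "laplace.aform w \<psi> = 0"
      using p(5)[OF \<psi>] by simp
  qed
  then have eq: "AE y in cellM. \<phi> n y - p y = \<phi> n y + m - v y" for n
    by (auto simp: w_def elim!: eventually_mono)
  have T: "testfun (\<lambda>y. \<phi> n y + m)" for n by (intro testfun_add p testfun_const)
  have "h1norm (\<lambda>y. \<phi> n y - p y) = h1norm (\<lambda>y. \<phi> n y + m - v y)" for n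
    by (intro h1norm_cong[OF _ _ eq] H1_diff H1_testfun p(1,3) v T)
  with p(4) have "(\<lambda>n. h1norm (\<lambda>y. \<phi> n y + m - v y)) \<longlonglongrightarrow> 0" by simp
  then show ?thesis by (rule that[OF T])
qed

context elliptic
begin

text \<open>Density admits \<open>v\<close> itself in the equation, coercivity then removes its
  gradient, and a function without gradient is weakly harmonic for the Dirichlet form.\<close>

lemma solve_unique:
  assumes v: "H1 v" "mean v = 0" and eq: "\<And>\<psi>. testfun \<psi> \<Longrightarrow> aform v \<psi> = 0"
  shows "AE y in cellM. v y = 0"
proof (rule weakly_harmonic_zero[OF v(1) _ v(2)])
  obtain \<phi> where \<phi>: "\<And>n::nat. testfun (\<phi> n)" "(\<lambda>n. h1norm (\<lambda>y. \<phi> n y - v y)) \<longlonglongrightarrow> 0"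
    using testfun_dense[OF v(1)] by blast
  have "(\<lambda>n. aform v (\<phi> n)) \<longlonglongrightarrow> aform v v"
    unfolding aform_def by (rule form_tendsto(2)[OF acoef_coef H1_testfun(1)[OF \<phi>(1)] v(1) v(1) \<phi>(2)])
  then have "aform v v = 0" by (simp add: eq[OF \<phi>(1)] LIMSEQ_const_iff)
  then have "(\<Sum>i\<in>UNIV. (l2 cellM (jet v (Some i)))\<^sup>2) \<le> 0"
    using aform_coercive[OF v(1)] m1_pos by (simp add: mult_le_0_iff)
  then have "(l2 cellM (jet v (Some i)))\<^sup>2 \<le> 0" for i
    by (rule order_trans[rotated], intro member_le_sum) auto
  then have "l2 cellM (jet v (Some i)) = 0" for i by simp
  then have jet0: "AE y in cellM. jet v (Some i) y = 0" for i by (rule l2_eq_0[OF jet_sqint[OF v(1)]])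
  have z: "(LINT y|cellM. jet v (Some i) y * f y) = 0" for i f
  proof (rule integral_eq_zero_AE)
    show "AE y in cellM. jet v (Some i) y * f y = 0" using jet0[of i] by eventually_elim simp
  qed
  show "laplace.aform v \<psi> = 0" if "testfun \<psi>" for \<psi>
    by (simp add: laplace_testfun[OF v(1) that] z)
qed

end

section \<open>Smooth families\<close>

definition is_dt :: "(real \<Rightarrow> real^'d \<Rightarrow> real^'d \<Rightarrow> real) \<Rightarrow> (real \<Rightarrow> real^'d \<Rightarrow> real^'d \<Rightarrow> real) \<Rightarrow> bool" where
  "is_dt W W' \<longleftrightarrow> (\<forall>t x. ((\<lambda>s. h1norm (\<lambda>y. (W s x y - W t x y) / (s - t) - W' t x y)) \<longlongrightarrow> 0) (at t))"

definition is_dx :: "'d \<Rightarrow> (real \<Rightarrow> real^'d \<Rightarrow> real^'d \<Rightarrow> real) \<Rightarrow> (real \<Rightarrow> real^'d \<Rightarrow> real^'d \<Rightarrow> real) \<Rightarrow> bool" where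
  "is_dx i W W' \<longleftrightarrow> (\<forall>t x. ((\<lambda>s. h1norm (\<lambda>y. (W t (x + s *\<^sub>R axis i 1) y - W t x y) / s - W' t x y)) \<longlongrightarrow> 0) (at 0))"

definition is_cont :: "(real \<Rightarrow> real^'d \<Rightarrow> real^'d \<Rightarrow> real) \<Rightarrow> bool" where
  "is_cont W \<longleftrightarrow> (\<forall>t x. ((\<lambda>p. h1norm (\<lambda>y. W (fst p) (snd p) y - W t x y)) \<longlongrightarrow> 0) (at (t, x)))"

text \<open>\<open>smooth_H1\<close> is a greatest fixed point: any family of continuous
  \<open>H1\<close>-valued maps closed under these derivatives witnesses the smoothness of its
  members.\<close>

lemma smooth_H1_coinduct:
  assumes "V \<in> S"
    and "\<And>W t x. W \<in> S \<Longrightarrow> H1 (W t x)"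
    and "\<And>W. W \<in> S \<Longrightarrow> is_cont W"
    and "\<And>W. W \<in> S \<Longrightarrow> \<exists>W'\<in>S. is_dt W W'"
    and "\<And>W i. W \<in> S \<Longrightarrow> \<exists>W'\<in>S. is_dx i W W'"
  shows "smooth_H1 V"
  unfolding smooth_H1_def using assms unfolding is_dt_def is_dx_def is_cont_def
  by (intro exI[of _ S]) blast

lemma smooth_H1_unfold:
  assumes "smooth_H1 V"
  shows "H1 (V t x)" "is_cont V" "\<exists>W. smooth_H1 W \<and> is_dt V W" "\<exists>W. smooth_H1 W \<and> is_dx i V W"
proof -
  obtain S where S: "V \<in> S" "\<forall>W\<in>S.
      (\<forall>t x. H1 (W t x)) \<and>
      (\<forall>t x. ((\<lambda>p. h1norm (\<lambda>y. W (fst p) (snd p) y - W t x y)) \<longlongrightarrow> 0) (at (t, x))) \<and>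
      (\<exists>Wt\<in>S. \<forall>t x. ((\<lambda>s. h1norm (\<lambda>y. (W s x y - W t x y) / (s - t) - Wt t x y)) \<longlongrightarrow> 0) (at t)) \<and>
      (\<forall>i. \<exists>Wi\<in>S. \<forall>t x. ((\<lambda>s. h1norm (\<lambda>y. (W t (x + s *\<^sub>R axis i 1) y - W t x y) / s - Wi t x y)) \<longlongrightarrow> 0) (at 0))"
    using assms unfolding smooth_H1_def by blast
  have sm: "smooth_H1 W" if "W \<in> S" for W
    unfolding smooth_H1_def using S(2) that by (intro exI[of _ S] conjI)
  note V = bspec[OF S(2) S(1)]
  show "H1 (V t x)" using V by blast
  show "is_cont V" unfolding is_cont_def using V by blast
  show "\<exists>W. smooth_H1 W \<and> is_dt V W" unfolding is_dt_def using V sm by blast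
  show "\<exists>W. smooth_H1 W \<and> is_dx i V W" unfolding is_dx_def using V sm by blast
qed

lemmas smooth_H1_H1 = smooth_H1_unfold(1)

text \<open>Limits in \<open>h1norm\<close> determine a derivative only up to null sets, and
  iterating requires the derivative to be smooth again; one smooth derivative is therefore fixed by
  choice.\<close>

definition sdt :: "(real \<Rightarrow> real^'d \<Rightarrow> real^'d \<Rightarrow> real) \<Rightarrow> (real \<Rightarrow> real^'d \<Rightarrow> real^'d \<Rightarrow> real)" where
  "sdt V = (SOME W. smooth_H1 W \<and> is_dt V W)"

definition sdx :: "'d \<Rightarrow> (real \<Rightarrow> real^'d \<Rightarrow> real^'d \<Rightarrow> real) \<Rightarrow> (real \<Rightarrow> real^'d \<Rightarrow> real^'d \<Rightarrow> real)" where
  "sdx i V = (SOME W. smooth_H1 W \<and> is_dx i V W)"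

lemma sdt: "smooth_H1 V \<Longrightarrow> smooth_H1 (sdt V)" "smooth_H1 V \<Longrightarrow> is_dt V (sdt V)"
  using someI_ex[OF smooth_H1_unfold(3)[of V]] unfolding sdt_def by blast+

lemma sdx: "smooth_H1 V \<Longrightarrow> smooth_H1 (sdx i V)" "smooth_H1 V \<Longrightarrow> is_dx i V (sdx i V)"
  using someI_ex[OF smooth_H1_unfold(4)[of V i]] unfolding sdx_def by blast+

lemma h1norm_const: "h1norm (\<lambda>y::real^'d. c) = \<bar>c\<bar>"
proof -
  have z: "l2 cellM (jet (\<lambda>y::real^'d. c) (Some i)) = 0" for i
    using l2_jet_testfun[OF testfun_const(1)[of c], of i] by (simp add: testfun_const)
  have "h1norm (\<lambda>y::real^'d. c) \<le> \<bar>c\<bar>"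
    by (rule order_trans[OF h1norm_le_sum[OF H1_const(1)]]) (simp add: z, simp add: l2_def)
  moreover have "\<bar>mean (\<lambda>y::real^'d. c)\<bar> \<le> h1norm (\<lambda>y::real^'d. c)" by (rule mean_bound[OF H1_const(1)])
  ultimately show ?thesis by simp
qed

text \<open>The images under \<open>T\<close> of all smooth tuples form a family closed under
  derivatives, since \<open>T\<close> is bounded and commutes with difference quotients. Linearity
  is asked for almost everywhere only, which is what a solution operator defined by choice can
  offer; several slots admit inputs that are unrelated to each other.\<close>

lemma smooth_H1_operator:
  fixes T :: "('k::finite \<Rightarrow> real^'d \<Rightarrow> real) \<Rightarrow> real^'d \<Rightarrow> real"
  assumes H: "\<And>p. (\<And>j. H1 (p j)) \<Longrightarrow> H1 (T p)"
    and lin: "\<And>p q b c. (\<And>j. H1 (p j)) \<Longrightarrow> (\<And>j. H1 (q j)) \<Longrightarrow>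
      AE y in cellM. T (\<lambda>j y. b * p j y + c * q j y) y = b * T p y + c * T q y"
    and bound: "\<And>p. (\<And>j. H1 (p j)) \<Longrightarrow> h1norm (T p) \<le> C * (\<Sum>j\<in>UNIV. h1norm (p j))"
    and P: "\<And>j. smooth_H1 (P j)"
  shows "smooth_H1 (\<lambda>t x. T (\<lambda>j. P j t x))"
proof -
  have lin2: "h1norm (\<lambda>y. b * T p y + c * T q y) \<le> C * (\<Sum>j\<in>UNIV. h1norm (\<lambda>y. b * p j y + c * q j y))"
    if p: "\<And>j. H1 (p j)" and q: "\<And>j. H1 (q j)" for p q b c
  proof -
    have "h1norm (\<lambda>y. b * T p y + c * T q y) = h1norm (T (\<lambda>j y. b * p j y + c * q j y))"
      using lin[where p = p and q = q and b = b and c = c, OF p q] by (intro h1norm_cong H1_lincomb(1) H p q) (auto elim: eventually_mono)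
    also have "\<dots> \<le> C * (\<Sum>j\<in>UNIV. h1norm (\<lambda>y. b * p j y + c * q j y))"
      by (intro bound H1_lincomb(1) p q)
    finally show ?thesis .
  qed
  have lin3: "h1norm (\<lambda>y. (T p y - T q y) / d - T r y) \<le> C * (\<Sum>j\<in>UNIV. h1norm (\<lambda>y. (p j y - q j y) / d - r j y))"
    if p: "\<And>j. H1 (p j)" and q: "\<And>j. H1 (q j)" and r: "\<And>j. H1 (r j)" for p q r d
  proof -
    define s where "s = (\<lambda>j y. (1/d) * p j y + (- 1/d) * q j y)"
    have s: "H1 (s j)" for j unfolding s_def by (intro H1_lincomb(1) p q)
    have eq: "AE y in cellM. 1 * T s y + (-1) * T r y = (T p y - T q y) / d - T r y"
      using lin[where p = p and q = q and b = "1/d" and c = "-1/d", OF p q] unfolding s_def by eventually_elim (simp add: diff_divide_distrib)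
    have HH: "H1 (\<lambda>y. (T p y - T q y) / d - T r y)"
      using H1_diff[OF H1_cmult[OF H1_diff[OF H[OF p] H[OF q]], of "1/d"] H[OF r]] by simp
    have "h1norm (\<lambda>y. (T p y - T q y) / d - T r y) = h1norm (\<lambda>y. 1 * T s y + (-1) * T r y)"
      by (rule h1norm_cong[symmetric, OF _ HH eq]) (intro H1_lincomb(1) H s r)
    also have "\<dots> \<le> C * (\<Sum>j\<in>UNIV. h1norm (\<lambda>y. 1 * s j y + (-1) * r j y))"
      by (rule lin2[where p = s and q = r, OF s r])
    also have "\<dots> = C * (\<Sum>j\<in>UNIV. h1norm (\<lambda>y. (p j y - q j y) / d - r j y))"
      by (simp add: s_def diff_divide_distrib)
    finally show ?thesis .
  qed
  have lim: "((\<lambda>s. h1norm (G s)) \<longlongrightarrow> 0) F"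
    if g: "\<And>j. ((\<lambda>s. h1norm (g j s)) \<longlongrightarrow> 0) F" and G: "\<And>s. H1 (G s)"
      and le: "\<And>s. h1norm (G s) \<le> C * (\<Sum>j\<in>UNIV. h1norm (g j s))"
    for G and g :: "'k \<Rightarrow> 's \<Rightarrow> real^'d \<Rightarrow> real" and F
  proof (rule Lim_null_comparison[OF always_eventually])
    have "((\<lambda>s. C * (\<Sum>j\<in>UNIV. h1norm (g j s))) \<longlongrightarrow> C * (\<Sum>j\<in>(UNIV::'k set). 0)) F"
      by (intro tendsto_intros g)
    then show "((\<lambda>s. C * (\<Sum>j\<in>UNIV. h1norm (g j s))) \<longlongrightarrow> 0) F" by simp
  qed (use h1norm_nonneg[OF G] le in simp)
  have H3: "H1 (\<lambda>y. (T p y - T q y) / d - T r y)"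
    if "\<And>j. H1 (p j)" "\<And>j. H1 (q j)" "\<And>j. H1 (r j)" for p q r d
    using H1_diff[OF H1_cmult[OF H1_diff[OF H[of p] H[of q]], of "1/d"] H[of r]] that by simp
  define S where "S = {(\<lambda>t x. T (\<lambda>j. P j t x)) | P. \<forall>j. smooth_H1 (P j)}"
  show ?thesis
  proof (rule smooth_H1_coinduct[of _ S])
    show "(\<lambda>t x. T (\<lambda>j. P j t x)) \<in> S" using P by (auto simp: S_def)
    fix W assume "W \<in> S"
    then obtain P where P: "\<And>j. smooth_H1 (P j)" and W: "W = (\<lambda>t x. T (\<lambda>j. P j t x))"
      by (auto simp: S_def)
    note PH = smooth_H1_H1[OF P]
    show "H1 (W t x)" for t x unfolding W by (intro H PH)
    show "is_cont W"
      unfolding is_cont_def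
    proof (intro allI, rule lim)
      fix t x j
      show "((\<lambda>p. h1norm (\<lambda>y. P j (fst p) (snd p) y - P j t x y)) \<longlongrightarrow> 0) (at (t, x))"
        using smooth_H1_unfold(2)[OF P] unfolding is_cont_def by blast
      show "H1 (\<lambda>y. W (fst p) (snd p) y - W t x y)" for p unfolding W by (intro H1_diff H PH)
      show "h1norm (\<lambda>y. W (fst p) (snd p) y - W t x y) \<le> C * (\<Sum>j\<in>UNIV. h1norm (\<lambda>y. P j (fst p) (snd p) y - P j t x y))" for p
        using lin2[where p = "\<lambda>j. P j (fst p) (snd p)" and q = "\<lambda>j. P j t x" and b = 1 and c = "-1", OF PH PH]
        by (simp add: W)
    qed
    show "\<exists>W'\<in>S. is_dt W W'"
    proof (rule bexI)
      show "(\<lambda>t x. T (\<lambda>j. sdt (P j) t x)) \<in> S" using sdt(1)[OF P] by (auto simp: S_def)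
      note DH = smooth_H1_H1[OF sdt(1)[OF P]]
      show "is_dt W (\<lambda>t x. T (\<lambda>j. sdt (P j) t x))"
        unfolding is_dt_def W
      proof (intro allI, rule lim)
        fix t x j
        show "((\<lambda>s. h1norm (\<lambda>y. (P j s x y - P j t x y) / (s - t) - sdt (P j) t x y)) \<longlongrightarrow> 0) (at t)"
          using sdt(2)[OF P] unfolding is_dt_def by blast
      qed ((rule H3 lin3; rule PH DH)+)
    qed
    show "\<exists>W'\<in>S. is_dx i W W'" for i
    proof (rule bexI)
      show "(\<lambda>t x. T (\<lambda>j. sdx i (P j) t x)) \<in> S" using sdx(1)[OF P] by (auto simp: S_def)
      note DH = smooth_H1_H1[OF sdx(1)[OF P]]
      show "is_dx i W (\<lambda>t x. T (\<lambda>j. sdx i (P j) t x))"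
        unfolding is_dx_def W
      proof (intro allI, rule lim)
        fix t x j
        show "((\<lambda>s. h1norm (\<lambda>y. (P j t (x + s *\<^sub>R axis i 1) y - P j t x y) / s - sdx i (P j) t x y)) \<longlongrightarrow> 0) (at 0)"
          using sdx(2)[OF P] unfolding is_dx_def by blast
      qed ((rule H3 lin3; rule PH DH)+)
    qed
  qed
qed

lemma smooth_H1_zero: "smooth_H1 (\<lambda>t x y. 0)"
proof (rule smooth_H1_coinduct[of _ "{\<lambda>t x y. 0}"])
  show "W \<in> {\<lambda>t x y. 0} \<Longrightarrow> H1 (W t x)" for W t x by (auto intro: H1_const)
qed (auto simp: is_cont_def is_dt_def is_dx_def h1norm_const)

lemma smooth_H1_piT:
  fixes V :: "real \<Rightarrow> real^'d \<Rightarrow> real^'d \<Rightarrow> real"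
  assumes "smooth_H1 V"
  shows "smooth_H1 (\<lambda>t x y. piT V t x)"
proof -
  \<comment> \<open>The mean is viewed as an operator with a single slot, indexed by
    \<open>unit\<close>.\<close>
  have "smooth_H1 (\<lambda>t x. (\<lambda>(p :: unit \<Rightarrow> real^'d \<Rightarrow> real) y. mean (p ())) (\<lambda>j. V t x))"
    by (rule smooth_H1_operator[where C = 1 and P = "\<lambda>j. V" and T = "\<lambda>p y. mean (p ())"])
       (auto simp: H1_const mean_lincomb h1norm_const UNIV_unit assms intro: mean_bound)
  moreover have "piT V t x = mean (V t x)" for t x
    using mean_intT[OF smooth_H1_H1[OF assms]] by (simp add: piT_def)
  ultimately show ?thesis by simp
qed

text \<open>The operators differentiate real pairings in (t,x), outside the integral; boundedness of
  the form moves such a derivative onto the profile.\<close>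

lemma form_smooth_has_deriv:
  assumes c: "coef K c" and V: "smooth_H1 V" and w: "H1 w"
  shows "((\<lambda>s. form c (V s x) w) has_real_derivative form c (sdt V t x) w) (at t)"
    and "((\<lambda>s. form c (V t (x + s *\<^sub>R axis i 1)) w) has_real_derivative form c (sdx i V t x) w) (at 0)"
proof -
  have *: "((\<lambda>s. form c (v s) w) has_real_derivative form c d w) (at t)"
    if v: "\<And>s. H1 (v s)" and d: "H1 d"
      and lim: "((\<lambda>s. h1norm (\<lambda>y. (v s y - v t y) / (s - t) - d y)) \<longlongrightarrow> 0) (at t)" for v d and t :: real
    unfolding has_field_derivative_iff
  proof (rule LIM_zero_cancel, rule Lim_null_comparison)
    show "((\<lambda>s. (real CARD('a option))\<^sup>2 * \<bar>K\<bar> * h1norm (\<lambda>y. (v s y - v t y) / (s - t) - d y) * h1norm w) \<longlongrightarrow> 0) (at t)"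
      using lim by (auto intro!: tendsto_eq_intros)
    show "\<forall>\<^sub>F s in at t. norm ((form c (v s) w - form c (v t) w) / (s - t) - form c d w)
        \<le> (real CARD('a option))\<^sup>2 * \<bar>K\<bar> * h1norm (\<lambda>y. (v s y - v t y) / (s - t) - d y) * h1norm w"
    proof (rule always_eventually, rule allI)
      fix s
      define q where "q = (\<lambda>y. (1/(s-t)) * v s y + (- 1/(s-t)) * v t y)"
      have q: "H1 q" unfolding q_def by (intro H1_lincomb v)
      have "form c q w = (1/(s-t)) * form c (v s) w + (- 1/(s-t)) * form c (v t) w"
        unfolding q_def by (rule form_lincomb_left[OF c v v w])
      moreover have "form c (\<lambda>y. 1 * q y + (-1) * d y) w = 1 * form c q w + (-1) * form c d w"
        by (rule form_lincomb_left[OF c q d w])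
      moreover have "(\<lambda>y. 1 * q y + (-1) * d y) = (\<lambda>y. (v s y - v t y) / (s - t) - d y)"
        by (simp add: q_def diff_divide_distrib)
      ultimately have "(form c (v s) w - form c (v t) w) / (s - t) - form c d w = form c (\<lambda>y. (v s y - v t y) / (s - t) - d y) w"
        by (simp add: diff_divide_distrib)
      moreover have "H1 (\<lambda>y. (v s y - v t y) / (s - t) - d y)"
        using H1_diff[OF q d] by (simp add: q_def diff_divide_distrib)
      ultimately show "norm ((form c (v s) w - form c (v t) w) / (s - t) - form c d w)
        \<le> (real CARD('a option))\<^sup>2 * \<bar>K\<bar> * h1norm (\<lambda>y. (v s y - v t y) / (s - t) - d y) * h1norm w"
        using form_bound[OF c _ w] by simp
    qed
  qed
  show "((\<lambda>s. form c (V s x) w) has_real_derivative form c (sdt V t x) w) (at t)"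
    using sdt(2)[OF V] unfolding is_dt_def by (intro * smooth_H1_H1 sdt(1) V) blast
  show "((\<lambda>s. form c (V t (x + s *\<^sub>R axis i 1)) w) has_real_derivative form c (sdx i V t x) w) (at 0)"
    using sdx(2)[OF V] unfolding is_dx_def by (intro * smooth_H1_H1 sdx(1) V) simp
qed

lemma form_smooth_deriv:
  assumes "coef K c" "smooth_H1 V" "H1 w"
  shows "dt (\<lambda>t x. form c (V t x) w) = (\<lambda>t x. form c (sdt V t x) w)"
    and "dx i (\<lambda>t x. form c (V t x) w) = (\<lambda>t x. form c (sdx i V t x) w)"
  unfolding dt_def dx_def using form_smooth_has_deriv[OF assms] by (auto intro!: ext DERIV_imp_deriv)

text \<open>An identity between pairings valid for all (t,x) may be differentiated, and derivatives
  of real functions are unique. The chosen derivatives \<open>sdt\<close> and \<open>sdx\<close> are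
  thus compared without relating them as functions of \<open>y\<close>.\<close>

lemma form_smooth_sum_deriv:
  assumes c: "coef K c" and V: "smooth_H1 V" and Vn: "\<And>n. n \<in> A \<Longrightarrow> smooth_H1 (Vn n)" and w: "H1 w"
    and eq: "\<And>t x. form c (V t x) w = (\<Sum>n\<in>A. form c (Vn n t x) w)"
  shows "form c (sdt V t x) w = (\<Sum>n\<in>A. form c (sdt (Vn n) t x) w)"
    and "form c (sdx i V t x) w = (\<Sum>n\<in>A. form c (sdx i (Vn n) t x) w)"
proof -
  have "((\<lambda>s. \<Sum>n\<in>A. form c (Vn n s x) w) has_real_derivative (\<Sum>n\<in>A. form c (sdt (Vn n) t x) w)) (at t)"
    by (intro DERIV_sum form_smooth_has_deriv(1)[OF c _ w] Vn)
  then show "form c (sdt V t x) w = (\<Sum>n\<in>A. form c (sdt (Vn n) t x) w)"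
    using form_smooth_has_deriv(1)[OF c V w] unfolding eq[symmetric] by (metis DERIV_unique)
  have "((\<lambda>s. \<Sum>n\<in>A. form c (Vn n t (x + s *\<^sub>R axis i 1)) w) has_real_derivative (\<Sum>n\<in>A. form c (sdx i (Vn n) t x) w)) (at 0)"
    by (intro DERIV_sum form_smooth_has_deriv(2)[OF c _ w] Vn)
  then show "form c (sdx i V t x) w = (\<Sum>n\<in>A. form c (sdx i (Vn n) t x) w)"
    using form_smooth_has_deriv(2)[OF c V w] unfolding eq[symmetric] by (metis DERIV_unique)
qed

section \<open>The cell problem\<close>

text \<open>The operators use the classical gradient of the test function, the forms its chosen weak
  gradient; \<open>tjet\<close> is the classical side of the comparison made in
  \<open>form_testfun\<close>.\<close>

definition tjet :: "(real^'d \<Rightarrow> real) \<Rightarrow> 'd option \<Rightarrow> real^'d \<Rightarrow> real" where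
  "tjet \<phi> \<beta> y = (case \<beta> of None \<Rightarrow> \<phi> y | Some i \<Rightarrow> tpd i \<phi> y)"

lemma tjet_simps [simp]: "tjet \<phi> None y = \<phi> y" "tjet \<phi> (Some i) y = tpd i \<phi> y"
  by (simp_all add: tjet_def)

lemma form_testfun:
  assumes c: "coef K c" and u: "H1 u" and \<phi>: "testfun \<phi>"
  shows "intT (\<lambda>y. jet_sum c u (tjet \<phi>) y) = form c u \<phi>"
proof -
  have "continuous_on UNIV (tjet \<phi> \<beta>)" for \<beta>
    using testfun_cont[OF \<phi>] testfun_tpd_cont[OF \<phi>] by (cases \<beta>) (simp_all add: tjet_def[abs_def])
  then have int: "integrable cellM (\<lambda>y. jet_sum c u (tjet \<phi>) y)"
    by (intro Bochner_Integration.integrable_sum sqint_mult coef_sqint[OF c] u sqint_continuous)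
  have "intT (\<lambda>y. jet_sum c u (tjet \<phi>) y) =
      (LINT y|cellM. jet_sum c u (tjet \<phi>) y)"
    by (rule intT_eq[OF int])
  also have "\<dots> = form c u \<phi>"
    unfolding form_def
  proof (rule integral_cong_AE)
    show "AE y in cellM. jet_sum c u (tjet \<phi>) y =
        jet_sum c u (jet \<phi>) y"
      using H1_testfun(2)[OF \<phi>]
    proof eventually_elim
      case (elim y)
      have "jet \<phi> \<beta> y = tjet \<phi> \<beta> y" for \<beta> using elim by (cases \<beta>) simp_all
      then show ?case by simp
    qed
  qed (rule borel_measurable_integrable[OF int], rule form_measurable[OF c u H1_testfun(1)[OF \<phi>]])
  finally show ?thesis .
qed

lemma form_sum_left:
  assumes c: "coef K c" and v: "\<And>n. n \<in> A \<Longrightarrow> H1 (v n)" and w: "H1 w" and A: "finite A"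
  shows "form c (\<lambda>y. \<Sum>n\<in>A. v n y) w = (\<Sum>n\<in>A. form c (v n) w)"
  using A v
proof (induction A rule: finite_induct)
  case empty
  show ?case using form_lincomb_left[OF c H1_const(1)[of 0] H1_const(1)[of 0] w, of 0 0] by simp
next
  case (insert n A)
  have H: "H1 (\<lambda>y. \<Sum>n\<in>A. v n y)" using insert by (intro H1_sum) auto
  have "form c (\<lambda>y. 1 * v n y + 1 * (\<Sum>n\<in>A. v n y)) w = 1 * form c (v n) w + 1 * form c (\<lambda>y. \<Sum>n\<in>A. v n y) w"
    using insert by (intro form_lincomb_left[OF c _ H w]) auto
  then show ?case using insert by simp
qed

context elliptic
begin

text \<open>Subtracting \<open>L (\<lambda>_. 1) * mean \<phi>\<close> is the projection
  \<open>I - \<pi>\<close> on functionals, so \<open>L\<close> need not vanish on constants; the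
  minus sign is that of the divergence in \<open>Ayy\<close>.\<close>

definition solves :: "(real^'d \<Rightarrow> real) \<Rightarrow> ((real^'d \<Rightarrow> real) \<Rightarrow> real) \<Rightarrow> bool" where
  "solves v L \<longleftrightarrow> H1 v \<and> mean v = 0 \<and> (\<forall>\<phi>. testfun \<phi> \<longrightarrow> - aform v \<phi> = L \<phi> - L (\<lambda>_. 1) * mean \<phi>)"

definition Sol :: "((real^'d \<Rightarrow> real) \<Rightarrow> real) \<Rightarrow> real^'d \<Rightarrow> real" where
  "Sol L = (SOME v. solves v L)"

definition adm :: "real \<Rightarrow> ((real^'d \<Rightarrow> real) \<Rightarrow> real) \<Rightarrow> bool" where
  "adm K L \<longleftrightarrow> (\<forall>\<phi> \<psi> b c. testfun \<phi> \<longrightarrow> testfun \<psi> \<longrightarrow> L (\<lambda>y. b * \<phi> y + c * \<psi> y) = b * L \<phi> + c * L \<psi>) \<and>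
     (\<forall>\<phi>. testfun \<phi> \<longrightarrow> \<bar>L \<phi>\<bar> \<le> K * h1norm \<phi>)"

lemma solves_cong:
  assumes "\<And>\<phi>. testfun \<phi> \<Longrightarrow> L \<phi> = L' \<phi>"
  shows "solves v L = solves v L'"
  using assms[OF testfun_const(1)[of 1]] by (auto simp: solves_def assms)

lemma aform_lincomb_left: "H1 u \<Longrightarrow> H1 v \<Longrightarrow> H1 w \<Longrightarrow> aform (\<lambda>y. b * u y + c * v y) w = b * aform u w + c * aform v w"
  unfolding aform_def by (rule form_lincomb_left[OF acoef_coef])

lemma solves_lincomb:
  assumes "solves v L" "solves w L'"
  shows "solves (\<lambda>y. b * v y + c * w y) (\<lambda>\<phi>. b * L \<phi> + c * L' \<phi>)"
proof -
  have H: "H1 v" "H1 w" "mean v = 0" "mean w = 0" using assms by (auto simp: solves_def)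
  have "- aform (\<lambda>y. b * v y + c * w y) \<phi> = b * L \<phi> + c * L' \<phi> - (b * L (\<lambda>_. 1) + c * L' (\<lambda>_. 1)) * mean \<phi>"
    if "testfun \<phi>" for \<phi>
  proof -
    have eqs: "aform v \<phi> = - (L \<phi> - L (\<lambda>_. 1) * mean \<phi>)" "aform w \<phi> = - (L' \<phi> - L' (\<lambda>_. 1) * mean \<phi>)"
      using assms that by (auto simp: solves_def)
    show ?thesis
      unfolding aform_lincomb_left[OF H(1,2) H1_testfun(1)[OF that]] eqs by (simp add: algebra_simps)
  qed
  then show ?thesis using H by (simp add: solves_def H1_lincomb(1) mean_lincomb)
qed

lemma solves_sum:
  assumes "finite A" "\<And>n. n \<in> A \<Longrightarrow> solves (v n) (L n)"
  shows "solves (\<lambda>y. \<Sum>n\<in>A. v n y) (\<lambda>\<phi>. \<Sum>n\<in>A. L n \<phi>)"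
  using assms
proof (induction A rule: finite_induct)
  case empty
  have "aform (\<lambda>y. 0) \<phi> = 0" if "testfun \<phi>" for \<phi>
    using aform_lincomb_left[OF H1_const(1)[of 0] H1_const(1)[of 0] H1_testfun(1)[OF that], of 0 0] by simp
  then show ?case by (simp add: solves_def H1_const)
next
  case (insert n A)
  then have "solves (\<lambda>y. 1 * v n y + 1 * (\<Sum>n\<in>A. v n y)) (\<lambda>\<phi>. 1 * L n \<phi> + 1 * (\<Sum>n\<in>A. L n \<phi>))"
    by (intro solves_lincomb) auto
  then show ?case using insert by simp
qed

lemma solves_unique:
  assumes "solves v L" "solves w L"
  shows "AE y in cellM. v y = w y"
proof -
  have "solves (\<lambda>y. 1 * v y + (-1) * w y) (\<lambda>\<phi>. 1 * L \<phi> + (-1) * L \<phi>)"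
    by (rule solves_lincomb[OF assms])
  then have "H1 (\<lambda>y. v y - w y)" "mean (\<lambda>y. v y - w y) = 0" "\<And>\<phi>. testfun \<phi> \<Longrightarrow> aform (\<lambda>y. v y - w y) \<phi> = 0"
    by (simp_all add: solves_def)
  then have "AE y in cellM. v y - w y = 0" by (rule solve_unique)
  then show ?thesis by simp
qed

lemma solves_cong_AE:
  assumes "solves v L" "H1 w" "AE y in cellM. w y = v y"
  shows "solves w L"
proof -
  have v: "H1 v" using assms by (simp add: solves_def)
  have "aform w \<phi> = aform v \<phi>" if "testfun \<phi>" for \<phi>
    unfolding aform_def
    by (rule form_cong[OF acoef_coef assms(2) _ v _ assms(3)]) (auto simp: H1_testfun(1) that)
  moreover have "mean w = mean v" by (rule mean_cong[OF assms(2) v assms(3)])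
  ultimately show ?thesis using assms by (simp add: solves_def)
qed

lemma Sol_cong:
  assumes "\<And>\<phi>. testfun \<phi> \<Longrightarrow> L \<phi> = L' \<phi>"
  shows "Sol L = Sol L'"
proof -
  have "solves v L = solves v L'" for v by (rule solves_cong[OF assms])
  then show ?thesis by (simp add: Sol_def)
qed

text \<open>The factor 2 comes from projecting the functional: \<open>L\<close> and its mean part
  each contribute a bound \<open>K\<close>, the latter because the constant 1 has norm 1.\<close>

lemma Sol_solves:
  assumes L: "adm K L"
  shows "solves (Sol L) L" "h1norm (Sol L) \<le> poinc * (2 * K)"
proof -
  have "testfun (\<lambda>_ :: real^'d. 1)" by (rule testfun_const)
  then have "\<bar>L (\<lambda>_. 1)\<bar> \<le> K * h1norm (\<lambda>_ :: real^'d. 1)"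
    using L by (simp add: adm_def)
  then have one: "\<bar>L (\<lambda>_. 1)\<bar> \<le> K" by (simp add: h1norm_const)
  obtain v \<phi> where v: "H1 v" "mean v = 0" "\<And>n::nat. testfun (\<phi> n)"
    "(\<lambda>n. h1norm (\<lambda>y. \<phi> n y - v y)) \<longlonglongrightarrow> 0"
    "\<And>\<psi>. testfun \<psi> \<Longrightarrow> aform v \<psi> = - (L \<psi> - L (\<lambda>_. 1) * mean \<psi>)"
    "h1norm v \<le> poinc * (2 * K)"
  proof (rule solve_exists[of "\<lambda>\<psi>. - (L \<psi> - L (\<lambda>_. 1) * mean \<psi>)" "2 * K"])
    show "- (L (\<lambda>y. b * \<phi> y + c * \<psi> y) - L (\<lambda>_. 1) * mean (\<lambda>y. b * \<phi> y + c * \<psi> y)) =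
        b * - (L \<phi> - L (\<lambda>_. 1) * mean \<phi>) + c * - (L \<psi> - L (\<lambda>_. 1) * mean \<psi>)"
      if "testfun \<phi>" "testfun \<psi>" for \<phi> \<psi> b c
    proof -
      have "L (\<lambda>y. b * \<phi> y + c * \<psi> y) = b * L \<phi> + c * L \<psi>" using L that by (simp add: adm_def)
      moreover have "mean (\<lambda>y. b * \<phi> y + c * \<psi> y) = b * mean \<phi> + c * mean \<psi>"
        by (intro mean_lincomb H1_testfun(1) that)
      ultimately show ?thesis by (simp add: algebra_simps)
    qed
    show "\<bar>- (L \<psi> - L (\<lambda>_. 1) * mean \<psi>)\<bar> \<le> 2 * K * h1norm \<psi>" if "testfun \<psi>" for \<psi>
    proof -
      have "\<bar>L \<psi>\<bar> \<le> K * h1norm \<psi>" using L that by (simp add: adm_def)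
      moreover have "\<bar>L (\<lambda>_. 1) * mean \<psi>\<bar> \<le> K * h1norm \<psi>"
        unfolding abs_mult using one mean_bound[OF H1_testfun(1)[OF that]] by (intro mult_mono) auto
      ultimately show ?thesis by linarith
    qed
    show "- (L (\<lambda>y. 1) - L (\<lambda>_. 1) * mean (\<lambda>y::real^'d. 1)) = 0" by simp
  qed (rule that)
  have "solves v L" using v by (simp add: solves_def)
  then show S: "solves (Sol L) L" unfolding Sol_def by (rule someI[where P = "\<lambda>v. solves v L"])
  have "h1norm (Sol L) = h1norm v"
    using S v(1) by (intro h1norm_cong solves_unique[OF S \<open>solves v L\<close>]) (auto simp: solves_def)
  then show "h1norm (Sol L) \<le> poinc * (2 * K)" using v by simp
qed

lemma Ayy_eq:
  assumes "H1 v" "testfun \<phi>"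
  shows "intT (\<lambda>y. (a y *v wgrad v y) \<bullet> tgrad \<phi> y) = aform v \<phi>"
proof -
  have "(a y *v wgrad v y) \<bullet> tgrad \<phi> y = jet_sum (acoef a) v (tjet \<phi>) y" for y
    by (simp add: sum_option acoef_def jet_Some inner_vec_def matrix_vector_mult_def sum_distrib_right tgrad_def)
       (rule sum.swap)
  then show ?thesis unfolding aform_def using form_testfun[OF acoef_coef assms] by simp
qed

text \<open>Both sides choose from predicates that agree on every function, so the choices coincide
  exactly and not merely almost everywhere.\<close>

lemma AyyInv_eq: "AyyInv a F t x = Sol (\<lambda>\<phi>. F \<phi> t x)"
  unfolding AyyInv_def Sol_def solves_def
  by (intro arg_cong[where f = Eps] ext conj_cong refl)
     (auto simp: mean_intT Ayy_eq H1_testfun(1))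

end

section \<open>The operators of the expansion as bilinear forms\<close>

locale cell_problem = elliptic a m1 for a :: "real^'d \<Rightarrow> real^'d^'d" and m1 :: real +
  fixes \<rho> :: "real^'d \<Rightarrow> real"
  assumes rho_meas: "\<rho> \<in> borel_measurable lebesgue"
    and rho_bdd: "\<exists>M. AE y in lebesgue. \<bar>\<rho> y\<bar> \<le> M"
begin

text \<open>\<open>cgrad i\<close> and \<open>cdiv i\<close> encode the two halves of
  \<open>Axy\<close> before the derivative in direction \<open>i\<close> is taken;
  \<open>cxx\<close> and \<open>crho\<close> encode the order-zero pairings behind
  \<open>Axx\<close> and \<open>Rtt\<close>. The first index belongs to the profile, the second to
  the test function.\<close>

definition cgrad :: "'d \<Rightarrow> 'd option \<Rightarrow> 'd option \<Rightarrow> real^'d \<Rightarrow> real" where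
  "cgrad i \<alpha> \<beta> y = (case (\<alpha>, \<beta>) of (Some j, None) \<Rightarrow> a y $ i $ j | _ \<Rightarrow> 0)"

definition cdiv :: "'d \<Rightarrow> 'd option \<Rightarrow> 'd option \<Rightarrow> real^'d \<Rightarrow> real" where
  "cdiv i \<alpha> \<beta> y = (case (\<alpha>, \<beta>) of (None, Some j) \<Rightarrow> a y $ j $ i | _ \<Rightarrow> 0)"

definition cxx :: "'d \<Rightarrow> 'd \<Rightarrow> 'd option \<Rightarrow> 'd option \<Rightarrow> real^'d \<Rightarrow> real" where
  "cxx i j \<alpha> \<beta> y = (case (\<alpha>, \<beta>) of (None, None) \<Rightarrow> a y $ i $ j | _ \<Rightarrow> 0)"

definition crho :: "'d option \<Rightarrow> 'd option \<Rightarrow> real^'d \<Rightarrow> real" where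
  "crho \<alpha> \<beta> y = (case (\<alpha>, \<beta>) of (None, None) \<Rightarrow> \<rho> y | _ \<Rightarrow> 0)"

definition rbound :: real where
  "rbound = (SOME M. AE y in lebesgue. \<bar>\<rho> y\<bar> \<le> M)"

lemma rbound: "AE y in lebesgue. \<bar>\<rho> y\<bar> \<le> rbound"
  unfolding rbound_def by (rule someI_ex[OF rho_bdd])

definition cbound :: real where
  "cbound = max abound rbound"

lemma coefs: "coef cbound (cgrad i)" "coef cbound (cdiv i)" "coef cbound (cxx i j)" "coef cbound crho"
proof -
  note [simp] = measurable_restrict_space1[OF a_meas] measurable_restrict_space1[OF rho_meas]
  have cb: "cbound \<ge> 0" "abound \<le> cbound" "rbound \<le> cbound" using abound(1) by (auto simp: cbound_def)
  have A: "AE y in cellM. \<bar>a y $ i $ j\<bar> \<le> cbound" for i j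
    using AE_cellI[OF abound(2)] by eventually_elim (use cb in \<open>meson order_trans\<close>)
  have R: "AE y in cellM. \<bar>\<rho> y\<bar> \<le> cbound"
    using AE_cellI[OF rbound] by eventually_elim (use cb in linarith)
  have *: "coef cbound c"
    if entries: "\<And>\<alpha> \<beta>. c \<alpha> \<beta> = (\<lambda>y. 0) \<or> (\<exists>i j. c \<alpha> \<beta> = (\<lambda>y. a y $ i $ j)) \<or> c \<alpha> \<beta> = \<rho>" for c
    unfolding coef_def
  proof (intro allI)
    fix \<alpha> \<beta>
    consider "c \<alpha> \<beta> = (\<lambda>y. 0)" | i j where "c \<alpha> \<beta> = (\<lambda>y. a y $ i $ j)" | "c \<alpha> \<beta> = \<rho>"
      using entries[of \<alpha> \<beta>] by blast
    then show "c \<alpha> \<beta> \<in> borel_measurable cellM \<and> (AE y in cellM. \<bar>c \<alpha> \<beta> y\<bar> \<le> cbound)"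
      using A R cb by cases simp_all
  qed
  have e1: "cgrad i \<alpha> \<beta> = (\<lambda>y. 0) \<or> (\<exists>i' j'. cgrad i \<alpha> \<beta> = (\<lambda>y. a y $ i' $ j')) \<or> cgrad i \<alpha> \<beta> = \<rho>" for i \<alpha> \<beta>
    by (cases \<alpha>; cases \<beta>) (auto simp: cgrad_def[abs_def])
  have e2: "cdiv i \<alpha> \<beta> = (\<lambda>y. 0) \<or> (\<exists>i' j'. cdiv i \<alpha> \<beta> = (\<lambda>y. a y $ i' $ j')) \<or> cdiv i \<alpha> \<beta> = \<rho>" for i \<alpha> \<beta>
    by (cases \<alpha>; cases \<beta>) (auto simp: cdiv_def[abs_def])
  have e3: "cxx i j \<alpha> \<beta> = (\<lambda>y. 0) \<or> (\<exists>i' j'. cxx i j \<alpha> \<beta> = (\<lambda>y. a y $ i' $ j')) \<or> cxx i j \<alpha> \<beta> = \<rho>" for i j \<alpha> \<beta>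
    by (cases \<alpha>; cases \<beta>) (auto simp: cxx_def[abs_def])
  have e4: "crho \<alpha> \<beta> = (\<lambda>y. 0) \<or> (\<exists>i' j'. crho \<alpha> \<beta> = (\<lambda>y. a y $ i' $ j')) \<or> crho \<alpha> \<beta> = \<rho>" for \<alpha> \<beta>
    by (cases \<alpha>; cases \<beta>) (auto simp: crho_def[abs_def])
  show "coef cbound (cgrad i)" "coef cbound (cdiv i)" "coef cbound (cxx i j)" "coef cbound crho"
    by (rule *, rule e1 e2 e3 e4)+
qed

lemma pairings:
  assumes "H1 v" "testfun \<phi>"
  shows "intT (\<lambda>y. (a y *v wgrad v y) $ i * \<phi> y) = form (cgrad i) v \<phi>"
    and "intT (\<lambda>y. v y * (tgrad \<phi> y v* a y) $ i) = form (cdiv i) v \<phi>"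
    and "intT (\<lambda>y. a y $ i $ j * v y * \<phi> y) = form (cxx i j) v \<phi>"
    and "intT (\<lambda>y. \<rho> y * v y * \<phi> y) = form crho v \<phi>"
  using form_testfun[OF coefs(1) assms, of i] form_testfun[OF coefs(2) assms, of i]
    form_testfun[OF coefs(3) assms, of i j] form_testfun[OF coefs(4) assms]
  by (simp_all add: sum_option cgrad_def cdiv_def cxx_def crho_def jet_Some matrix_vector_mult_def
      vector_matrix_mult_def tgrad_def sum_distrib_right sum_distrib_left mult_ac)

text \<open>The right-hand side of the cell problem for \<open>\<chi>\<^sub>k\<close> only involves the first \<open>x\<close>-derivatives
  of \<open>\<chi>\<^sub>k\<^sub>-\<^sub>1\<close> and the second derivatives of \<open>\<chi>\<^sub>k\<^sub>-\<^sub>2\<close>.  Keeping these derivatives as independent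
  slots, indexed by pairs of options, makes the right-hand side linear in the slots with coefficients
  independent of \<open>(t, x)\<close>; so no mixed partial derivatives ever have to be exchanged.\<close>

definition slot_form :: "'d option \<times> 'd option \<Rightarrow> (real^'d \<Rightarrow> real) \<Rightarrow> (real^'d \<Rightarrow> real) \<Rightarrow> real" where
  "slot_form \<kappa> v \<phi> = (case \<kappa> of (Some i, None) \<Rightarrow> form (cgrad i) v \<phi> - form (cdiv i) v \<phi>
     | (Some i, Some j) \<Rightarrow> form (cxx i j) v \<phi> | (None, None) \<Rightarrow> - form crho v \<phi> | (None, Some j) \<Rightarrow> 0)"

text \<open>\<open>V\<close> plays the profile one index below and \<open>Z\<close> the one two
  below. The pairs \<open>(None, Some j)\<close> correspond to no derivative and hold zero, so that
  the index type can be a full product.\<close>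

definition slots :: "(real \<Rightarrow> real^'d \<Rightarrow> real^'d \<Rightarrow> real) \<Rightarrow> (real \<Rightarrow> real^'d \<Rightarrow> real^'d \<Rightarrow> real) \<Rightarrow>
    'd option \<times> 'd option \<Rightarrow> real \<Rightarrow> real^'d \<Rightarrow> real^'d \<Rightarrow> real" where
  "slots V Z \<kappa> = (case \<kappa> of (Some i, None) \<Rightarrow> sdx i V
     | (Some i, Some j) \<Rightarrow> sdx i (sdx j Z) | (None, None) \<Rightarrow> sdt (sdt Z) | (None, Some j) \<Rightarrow> (\<lambda>t x y. 0))"

definition rhs :: "('d option \<times> 'd option \<Rightarrow> real^'d \<Rightarrow> real) \<Rightarrow> (real^'d \<Rightarrow> real) \<Rightarrow> real" where
  "rhs p \<phi> = (\<Sum>\<kappa>\<in>UNIV. slot_form \<kappa> (p \<kappa>) \<phi>)"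

lemma slots_smooth: "smooth_H1 V \<Longrightarrow> smooth_H1 Z \<Longrightarrow> smooth_H1 (slots V Z \<kappa>)"
  by (auto simp: slots_def sdx sdt smooth_H1_zero split: prod.splits option.splits)

lemma rhs_eq:
  assumes V: "smooth_H1 V" and Z: "smooth_H1 Z" and \<phi>: "testfun \<phi>"
  shows "Axy a V \<phi> t x + Axx a Z \<phi> t x - Rtt \<rho> Z \<phi> t x = rhs (\<lambda>\<kappa>. slots V Z \<kappa> t x) \<phi>"
proof -
  note H = H1_testfun(1)[OF \<phi>]
  have 1: "Axy a V \<phi> t x = (\<Sum>i\<in>UNIV. form (cgrad i) (sdx i V t x) \<phi> - form (cdiv i) (sdx i V t x) \<phi>)"
    unfolding Axy_def pairings[OF smooth_H1_H1[OF V] \<phi>] form_smooth_deriv(2)[OF coefs(1) V H] form_smooth_deriv(2)[OF coefs(2) V H]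
    by (simp add: sum_subtractf)
  have 2: "Axx a Z \<phi> t x = (\<Sum>i\<in>UNIV. \<Sum>j\<in>UNIV. form (cxx i j) (sdx i (sdx j Z) t x) \<phi>)"
    unfolding Axx_def pairings[OF smooth_H1_H1[OF Z] \<phi>] form_smooth_deriv(2)[OF coefs(3) Z H] form_smooth_deriv(2)[OF coefs(3) sdx(1)[OF Z] H] ..
  have 3: "Rtt \<rho> Z \<phi> t x = form crho (sdt (sdt Z) t x) \<phi>"
    unfolding Rtt_def pairings[OF smooth_H1_H1[OF Z] \<phi>] form_smooth_deriv(1)[OF coefs(4) Z H] form_smooth_deriv(1)[OF coefs(4) sdt(1)[OF Z] H] ..
  have "rhs (\<lambda>\<kappa>. slots V Z \<kappa> t x) \<phi> = (\<Sum>\<alpha>\<in>UNIV. \<Sum>\<beta>\<in>UNIV. slot_form (\<alpha>, \<beta>) (slots V Z (\<alpha>, \<beta>) t x) \<phi>)"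
    unfolding rhs_def UNIV_Times_UNIV[symmetric] by (simp add: sum.cartesian_product)
  also have "\<dots> = Axy a V \<phi> t x + Axx a Z \<phi> t x - Rtt \<rho> Z \<phi> t x"
    unfolding 1 2 3 by (simp add: sum_option slot_form_def slots_def sum.distrib)
  finally show ?thesis by simp
qed

lemma slot_form_lincomb_left:
  "H1 u \<Longrightarrow> H1 v \<Longrightarrow> H1 w \<Longrightarrow> slot_form \<kappa> (\<lambda>y. b * u y + c * v y) w = b * slot_form \<kappa> u w + c * slot_form \<kappa> v w"
  by (auto simp: slot_form_def form_lincomb_left[OF coefs(1)] form_lincomb_left[OF coefs(2)]
      form_lincomb_left[OF coefs(3)] form_lincomb_left[OF coefs(4)] algebra_simps split: prod.splits option.splits)

lemma slot_form_lincomb_right: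
  "H1 u \<Longrightarrow> H1 v \<Longrightarrow> H1 w \<Longrightarrow> slot_form \<kappa> w (\<lambda>y. b * u y + c * v y) = b * slot_form \<kappa> w u + c * slot_form \<kappa> w v"
  by (auto simp: slot_form_def form_lincomb_right[OF coefs(1)] form_lincomb_right[OF coefs(2)]
      form_lincomb_right[OF coefs(3)] form_lincomb_right[OF coefs(4)] algebra_simps split: prod.splits option.splits)

text \<open>The leading 2 accounts for the first-order slots, which combine two forms.\<close>

definition fbound :: real where
  "fbound = 2 * ((real CARD('d option))\<^sup>2 * \<bar>cbound\<bar>)"

lemma slot_form_bound:
  assumes u: "H1 u" and v: "H1 v"
  shows "\<bar>slot_form \<kappa> u v\<bar> \<le> fbound * h1norm u * h1norm v"
proof -
  define B where "B = (real CARD('d option))\<^sup>2 * \<bar>cbound\<bar> * h1norm u * h1norm v"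
  have B: "B \<ge> 0" using h1norm_nonneg[OF u] h1norm_nonneg[OF v] by (simp add: B_def)
  have "\<bar>form (cgrad i) u v\<bar> \<le> B" "\<bar>form (cdiv i) u v\<bar> \<le> B" "\<bar>form (cxx i j) u v\<bar> \<le> B" "\<bar>form crho u v\<bar> \<le> B" for i j
    unfolding B_def by (rule form_bound[OF _ u v], rule coefs)+
  note b = this
  have "\<bar>form (cgrad i) u v - form (cdiv i) u v\<bar> \<le> 2 * B" "\<bar>form (cxx i j) u v\<bar> \<le> 2 * B" "\<bar>form crho u v\<bar> \<le> 2 * B" for i j
    using b(1)[of i] b(2)[of i] b(3)[of i j] b(4) B by linarith+
  then have "\<bar>slot_form \<kappa> u v\<bar> \<le> 2 * B"
    using B by (auto simp: slot_form_def split: prod.splits option.splits)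
  then show ?thesis by (simp add: B_def fbound_def)
qed

lemma rhs_adm:
  assumes p: "\<And>\<kappa>. H1 (p \<kappa>)"
  shows "adm (fbound * (\<Sum>\<kappa>\<in>UNIV. h1norm (p \<kappa>))) (rhs p)"
  unfolding adm_def
proof (intro conjI allI impI)
  fix \<phi> :: "real^'d \<Rightarrow> real" assume \<phi>: "testfun \<phi>"
  note H = H1_testfun(1)[OF \<phi>]
  show "rhs p (\<lambda>y. b * \<phi> y + c * \<psi> y) = b * rhs p \<phi> + c * rhs p \<psi>" if "testfun \<psi>" for \<psi> b c
    by (simp add: rhs_def slot_form_lincomb_right[OF H H1_testfun(1)[OF that] p] sum.distrib sum_distrib_left)
  have "\<bar>rhs p \<phi>\<bar> \<le> (\<Sum>\<kappa>\<in>UNIV. fbound * h1norm (p \<kappa>) * h1norm \<phi>)"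
    unfolding rhs_def by (intro order_trans[OF sum_abs] sum_mono slot_form_bound p H)
  then show "\<bar>rhs p \<phi>\<bar> \<le> fbound * (\<Sum>\<kappa>\<in>UNIV. h1norm (p \<kappa>)) * h1norm \<phi>"
    by (simp add: sum_distrib_left sum_distrib_right)
qed

lemmas rhs_solves = Sol_solves[OF rhs_adm]

text \<open>An instance of \<open>smooth_H1_operator\<close>: the norm estimate for
  \<open>Sol\<close> gives boundedness, and uniqueness in the cell problem gives linearity almost
  everywhere even though \<open>Sol\<close> is a choice.\<close>

lemma Sol_rhs_smooth:
  assumes "\<And>\<kappa>. smooth_H1 (P \<kappa>)"
  shows "smooth_H1 (\<lambda>t x y. - Sol (rhs (\<lambda>\<kappa>. P \<kappa> t x)) y)"
proof (rule smooth_H1_operator[where T = "\<lambda>p y. - Sol (rhs p) y" and C = "poinc * (2 * fbound)" and P = P, OF _ _ _ assms])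
  fix p :: "'d option \<times> 'd option \<Rightarrow> real^'d \<Rightarrow> real" assume p: "\<And>\<kappa>. H1 (p \<kappa>)"
  have HS: "H1 (Sol (rhs p))" using rhs_solves(1)[OF p] by (simp add: solves_def)
  then show "H1 (\<lambda>y. - Sol (rhs p) y)" using H1_cmult[of "Sol (rhs p)" "-1"] by simp
  show "h1norm (\<lambda>y. - Sol (rhs p) y) \<le> poinc * (2 * fbound) * (\<Sum>j\<in>UNIV. h1norm (p j))"
    using rhs_solves(2)[OF p] by (simp add: h1norm_minus[OF HS] mult.assoc)
  fix q :: "'d option \<times> 'd option \<Rightarrow> real^'d \<Rightarrow> real" and b c assume q: "\<And>\<kappa>. H1 (q \<kappa>)"
  have "solves (\<lambda>y. b * Sol (rhs p) y + c * Sol (rhs q) y) (\<lambda>\<phi>. b * rhs p \<phi> + c * rhs q \<phi>)"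
    by (rule solves_lincomb[OF rhs_solves(1)[OF p] rhs_solves(1)[OF q]])
  moreover have "rhs (\<lambda>j y. b * p j y + c * q j y) \<phi> = b * rhs p \<phi> + c * rhs q \<phi>" if "testfun \<phi>" for \<phi>
    by (simp add: rhs_def slot_form_lincomb_left[OF p q H1_testfun(1)[OF that]] sum.distrib sum_distrib_left)
  ultimately have "solves (\<lambda>y. b * Sol (rhs p) y + c * Sol (rhs q) y) (rhs (\<lambda>j y. b * p j y + c * q j y))"
    using solves_cong[of "rhs (\<lambda>j y. b * p j y + c * q j y)" "\<lambda>\<phi>. b * rhs p \<phi> + c * rhs q \<phi>"] by simp
  from solves_unique[OF rhs_solves(1)[OF H1_lincomb(1)[OF p q]] this]
  show "AE y in cellM. - Sol (rhs (\<lambda>j y. b * p j y + c * q j y)) y = b * - Sol (rhs p) y + c * - Sol (rhs q) y"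
    by eventually_elim simp
qed

section \<open>The correctors and their cell problems\<close>

lemma const_in_tx: "dx i (\<lambda>t x. c) = (\<lambda>t x. 0)" "dt (\<lambda>t x. c) = (\<lambda>t x. 0)"
  by (simp_all add: dx_def dt_def fun_eq_iff)

lemma operators_zero: "Axy a (\<lambda>t x y. 0) \<phi> t x = 0" "Axx a (\<lambda>t x y. 0) \<phi> t x = 0" "Rtt \<rho> (\<lambda>t x y. 0) \<phi> t x = 0"
  by (simp_all add: Axy_def Axx_def Rtt_def const_in_tx)

text \<open>Stands for the corrector of index \<open>n - 1\<close>, zero at index -1; with it the
  two recursive equations of \<open>chi\<close> merge into one.\<close>

definition chiprev :: "nat \<Rightarrow> (real \<Rightarrow> real^'d \<Rightarrow> real) \<Rightarrow> real \<Rightarrow> real^'d \<Rightarrow> real^'d \<Rightarrow> real" where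
  "chiprev n f = (if n = 0 then (\<lambda>t x y. 0) else chi a \<rho> (n - 1) f)"

lemma chi_Suc: "chi a \<rho> (Suc n) f = (\<lambda>t x y. - AyyInv a (\<lambda>\<phi> t x.
    Axy a (chi a \<rho> n f) \<phi> t x + Axx a (chiprev n f) \<phi> t x - Rtt \<rho> (chiprev n f) \<phi> t x) t x y)"
  by (cases n) (simp_all add: chiprev_def operators_zero)

abbreviation chi_rhs where
  "chi_rhs n f t x \<equiv> rhs (\<lambda>\<kappa>. slots (chi a \<rho> n f) (chiprev n f) \<kappa> t x)"

lemma chi_Suc_Sol:
  assumes "smooth_H1 (chi a \<rho> n f)" "smooth_H1 (chiprev n f)"
  shows "chi a \<rho> (Suc n) f = (\<lambda>t x y. - Sol (chi_rhs n f t x) y)"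
  unfolding chi_Suc AyyInv_eq using Sol_cong[OF rhs_eq[OF assms]] by presburger

text \<open>Both predecessors enter the next cell problem, so their smoothness is carried through
  one joint induction.\<close>

lemma chi_smooth:
  assumes "smooth_H1 (\<lambda>t x y. f t x)"
  shows "smooth_H1 (chi a \<rho> n f)" "smooth_H1 (chiprev n f)"
proof -
  have "smooth_H1 (chi a \<rho> n f) \<and> smooth_H1 (chiprev n f)"
  proof (induction n)
    case 0
    show ?case using assms by (simp add: chiprev_def smooth_H1_zero)
  next
    case (Suc n)
    then have "smooth_H1 (chi a \<rho> (Suc n) f)"
      by (simp add: chi_Suc_Sol Sol_rhs_smooth slots_smooth del: chi.simps)
    then show ?case using Suc by (simp add: chiprev_def)
  qed
  then show "smooth_H1 (chi a \<rho> n f)" "smooth_H1 (chiprev n f)" by blast+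
qed

lemma chi_solves:
  assumes "smooth_H1 (\<lambda>t x y. f t x)"
  shows "solves (\<lambda>y. - chi a \<rho> (Suc n) f t x y) (chi_rhs n f t x)"
  unfolding chi_Suc_Sol[OF chi_smooth[OF assms]] minus_minus
  using rhs_solves(1)[of "\<lambda>\<kappa>. slots (chi a \<rho> n f) (chiprev n f) \<kappa> t x"]
    smooth_H1_H1[OF slots_smooth[OF chi_smooth[OF assms]]] by simp

text \<open>An identity almost everywhere in \<open>y\<close> cannot be differentiated pointwise,
  since its null set moves with (t,x). Pairing with a fixed test function first gives identities
  between real functions, which can be differentiated once or twice.\<close>

lemma rhs_slots_sum:
  assumes A: "finite A" and V: "smooth_H1 V" and Z: "smooth_H1 Z"
    and Vn: "\<And>n. n \<in> A \<Longrightarrow> smooth_H1 (Vn n)" and Zn: "\<And>n. n \<in> A \<Longrightarrow> smooth_H1 (Zn n)"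
    and Veq: "\<And>t x. AE y in cellM. V t x y = (\<Sum>n\<in>A. Vn n t x y)"
    and Zeq: "\<And>t x. AE y in cellM. Z t x y = (\<Sum>n\<in>A. Zn n t x y)"
    and \<phi>: "testfun \<phi>"
  shows "rhs (\<lambda>\<kappa>. slots V Z \<kappa> t x) \<phi> = (\<Sum>n\<in>A. rhs (\<lambda>\<kappa>. slots (Vn n) (Zn n) \<kappa> t x) \<phi>)"
proof -
  note H = H1_testfun(1)[OF \<phi>]
  have base: "form c (W t x) \<phi> = (\<Sum>n\<in>A. form c (Wn n t x) \<phi>)"
    if c: "coef cbound c" and W: "smooth_H1 W" and Wn: "\<And>n. n \<in> A \<Longrightarrow> smooth_H1 (Wn n)"
      and eq: "\<And>t x. AE y in cellM. W t x y = (\<Sum>n\<in>A. Wn n t x y)" for c W Wn t x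
  proof -
    have "form c (W t x) \<phi> = form c (\<lambda>y. \<Sum>n\<in>A. Wn n t x y) \<phi>"
    proof (rule form_cong[OF c smooth_H1_H1[OF W] H _ H eq])
      show "H1 (\<lambda>y. \<Sum>n\<in>A. Wn n t x y)" by (rule H1_sum[OF A smooth_H1_H1[OF Wn]])
    qed simp
    also have "\<dots> = (\<Sum>n\<in>A. form c (Wn n t x) \<phi>)"
      by (rule form_sum_left[OF c _ H A]) (intro smooth_H1_H1 Wn)
    finally show ?thesis .
  qed
  have one: "form c (sdx i V t x) \<phi> = (\<Sum>n\<in>A. form c (sdx i (Vn n) t x) \<phi>)" if c: "coef cbound c" for c i
    by (rule form_smooth_sum_deriv(2)[OF c V Vn H base[OF c V Vn Veq]])
  have Zx: "form c (sdx j Z t x) \<phi> = (\<Sum>n\<in>A. form c (sdx j (Zn n) t x) \<phi>)" if c: "coef cbound c" for c j t x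
    by (rule form_smooth_sum_deriv(2)[OF c Z Zn H base[OF c Z Zn Zeq]])
  have Zt: "form c (sdt Z t x) \<phi> = (\<Sum>n\<in>A. form c (sdt (Zn n) t x) \<phi>)" if c: "coef cbound c" for c t x
    by (rule form_smooth_sum_deriv(1)[OF c Z Zn H base[OF c Z Zn Zeq]])
  have Zxx: "form c (sdx i (sdx j Z) t x) \<phi> = (\<Sum>n\<in>A. form c (sdx i (sdx j (Zn n)) t x) \<phi>)" if c: "coef cbound c" for c i j
    by (rule form_smooth_sum_deriv(2)[OF c sdx(1)[OF Z] sdx(1)[OF Zn] H Zx[OF c]])
  have Ztt: "form c (sdt (sdt Z) t x) \<phi> = (\<Sum>n\<in>A. form c (sdt (sdt (Zn n)) t x) \<phi>)" if c: "coef cbound c" for c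
    by (rule form_smooth_sum_deriv(1)[OF c sdt(1)[OF Z] sdt(1)[OF Zn] H Zt[OF c]])
  have "slot_form \<kappa> (slots V Z \<kappa> t x) \<phi> = (\<Sum>n\<in>A. slot_form \<kappa> (slots (Vn n) (Zn n) \<kappa> t x) \<phi>)" for \<kappa>
    by (auto simp: slot_form_def slots_def one[OF coefs(1)] one[OF coefs(2)] Zxx[OF coefs(3)] Ztt[OF coefs(4)]
        sum_subtractf sum_negf split: prod.splits option.splits)
  then show ?thesis unfolding rhs_def by (simp add: sum.swap[of _ UNIV A])
qed

end

section \<open>Residuals\<close>

text \<open>The profile of index \<open>l - m\<close>, taken as zero at negative index; the guard is
  there because subtraction on \<open>nat\<close> truncates. This absorbs the separate cases of
  \<open>wres\<close> at -2 and -1.\<close>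

definition shifted :: "(nat \<Rightarrow> real \<Rightarrow> real^'d \<Rightarrow> real^'d \<Rightarrow> real) \<Rightarrow> nat \<Rightarrow> nat \<Rightarrow> real \<Rightarrow> real^'d \<Rightarrow> real^'d \<Rightarrow> real" where
  "shifted u m l = (if m \<le> l then u (l - m) else (\<lambda>t x y. 0))"

context cell_problem
begin

abbreviation residual_rhs where
  "residual_rhs u l t x \<equiv> rhs (\<lambda>\<kappa>. slots (shifted u 1 l) (shifted u 2 l) \<kappa> t x)"

abbreviation expansion where
  "expansion u l t x y \<equiv> \<Sum>n = 1..l. chi a \<rho> n (piT (u (l - n))) t x y"

lemma wres_eq:
  "wres a \<rho> u (int l - 2) \<phi> t x = - (Ayy a (u l) \<phi> t x +
     (Axy a (shifted u 1 l) \<phi> t x + Axx a (shifted u 2 l) \<phi> t x - Rtt \<rho> (shifted u 2 l) \<phi> t x))"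
proof -
  consider "l = 0" | "l = 1" | m where "l = m + 2"
    by (metis One_nat_def add_2_eq_Suc' not0_implies_Suc)
  then show ?thesis
    by cases (simp_all add: wres_def shifted_def operators_zero)
qed

text \<open>Removing the mean leaves the gradient unchanged and provides the normalisation built
  into \<open>solves\<close>; the sign reflects that the residual contains \<open>Ayy\<close> with a
  minus.\<close>

lemma Ipi_zero_wres_iff:
  assumes u: "\<And>n. smooth_H1 (u n)"
  shows "Ipi_zero (wres a \<rho> u (int l - 2)) \<longleftrightarrow>
    (\<forall>t x. solves (\<lambda>y. - (u l t x y - piT (u l) t x)) (residual_rhs u l t x))"
proof -
  have sm: "smooth_H1 (shifted u m l)" for m using u smooth_H1_zero by (auto simp: shifted_def)
  define R where "R t x = residual_rhs u l t x" for t x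
  note UH = smooth_H1_H1[OF u]
  have w: "wres a \<rho> u (int l - 2) \<phi> t x = aform (u l t x) \<phi> - R t x \<phi>" if "testfun \<phi>" for \<phi> t x
    unfolding wres_eq rhs_eq[OF sm sm that] R_def Ayy_def Ayy_eq[OF UH that] by simp
  \<comment> \<open>Testing with 1 annihilates the form, so only the right-hand side contributes to
    the mean of the residual.\<close>
  have one: "wres a \<rho> u (int l - 2) (\<lambda>_. 1) t x = - R t x (\<lambda>_. 1)" for t x
    using w[OF testfun_const(1)[of 1]] UH by simp
  have W: "H1 (\<lambda>y. - (u l t x y - piT (u l) t x))" "mean (\<lambda>y. - (u l t x y - piT (u l) t x)) = 0"
    "testfun \<phi> \<Longrightarrow> - aform (\<lambda>y. - (u l t x y - piT (u l) t x)) \<phi> = aform (u l t x) \<phi>" for t x \<phi>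
  proof -
    define m where "m = mean (u l t x)"
    have eq: "(\<lambda>y. - (u l t x y - piT (u l) t x)) = (\<lambda>y. (-1) * u l t x y + 1 * m)"
      by (simp add: piT_def mean_intT[OF UH] m_def)
    show "H1 (\<lambda>y. - (u l t x y - piT (u l) t x))"
      unfolding eq by (rule H1_lincomb(1)[OF UH H1_const(1)])
    show "mean (\<lambda>y. - (u l t x y - piT (u l) t x)) = 0"
      unfolding eq using mean_lincomb[OF UH H1_const(1), of "-1" _ _ _ 1 m] by (simp add: m_def)
    show "- aform (\<lambda>y. - (u l t x y - piT (u l) t x)) \<phi> = aform (u l t x) \<phi>" if "testfun \<phi>"
    proof -
      note H = H1_testfun(1)[OF that]
      have "aform (\<lambda>y. m) \<phi> = 0" using aform_sym[OF H1_const(1) H, of m] H by simp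
      then show ?thesis unfolding eq aform_lincomb_left[OF UH H1_const(1) H] by simp
    qed
  qed
  have "Ipi_zero (wres a \<rho> u (int l - 2)) \<longleftrightarrow>
      (\<forall>t x \<phi>. testfun \<phi> \<longrightarrow> aform (u l t x) \<phi> = R t x \<phi> - R t x (\<lambda>_. 1) * mean \<phi>)"
    unfolding Ipi_zero_def one
    by (intro all_cong1 imp_cong refl) (auto simp: w mean_intT H1_testfun(1))
  also have "\<dots> \<longleftrightarrow> (\<forall>t x. solves (\<lambda>y. - (u l t x y - piT (u l) t x)) (R t x))"
    unfolding solves_def using W by auto
  finally show ?thesis unfolding R_def .
qed

text \<open>The expansions of the two predecessors are aligned so that each \<open>n\<close>
  contributes \<open>chi\<close> at \<open>n\<close> and \<open>chiprev\<close> at \<open>n\<close>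
  with the same slow factor, which together form the right-hand side of the cell problem for the
  corrector of index \<open>n + 1\<close>.\<close>

lemma residual_step:
  assumes u: "\<And>n. smooth_H1 (u n)"
    and prev: "\<And>l' t x. l' < l \<Longrightarrow> AE y in cellM. u l' t x y = (\<Sum>n\<le>l'. chi a \<rho> n (piT (u (l' - n))) t x y)"
  shows "solves (\<lambda>y. - expansion u l t x y)
    (residual_rhs u l t x)"
proof -
  have sm: "smooth_H1 (shifted u m l)" for m using u smooth_H1_zero by (auto simp: shifted_def)
  \<comment> \<open>The index \<open>l - Suc n\<close> fits both sums: it accompanies the corrector
    of index \<open>n\<close> in profile \<open>l - 1\<close> and the corrector of index
    \<open>n - 1\<close> in profile \<open>l - 2\<close>.\<close>
  define f where "f n = piT (u (l - Suc n))" for n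
  have f: "smooth_H1 (\<lambda>t x y. f n t x)" for n unfolding f_def by (rule smooth_H1_piT[OF u])
  have V: "AE y in cellM. shifted u 1 l t x y = (\<Sum>n<l. chi a \<rho> n (f n) t x y)" for t x
  proof (cases l)
    case (Suc m)
    then have "AE y in cellM. u m t x y = (\<Sum>n\<le>m. chi a \<rho> n (piT (u (m - n))) t x y)" using prev by simp
    then show ?thesis by (simp add: Suc shifted_def f_def lessThan_Suc_atMost del: chi.simps)
  qed (simp add: shifted_def)
  have Z: "AE y in cellM. shifted u 2 l t x y = (\<Sum>n<l. chiprev n (f n) t x y)" for t x
  proof (cases "2 \<le> l")
    case True
    then obtain m where l: "l = Suc (Suc m)" by (metis add_2_eq_Suc le_Suc_ex)
    then have "AE y in cellM. u m t x y = (\<Sum>n\<le>m. chi a \<rho> n (piT (u (m - n))) t x y)" using prev by simp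
    \<comment> \<open>The term at 0 vanishes by the convention at index -1; what remains is the
      expansion of profile \<open>m\<close> after a shift by one.\<close>
    moreover have "(\<Sum>n<l. chiprev n (f n) t x y) = (\<Sum>n\<le>m. chi a \<rho> n (piT (u (m - n))) t x y)" for y
      unfolding l by (subst sum.lessThan_Suc_shift) (simp add: chiprev_def f_def l lessThan_Suc_atMost del: chi.simps)
    ultimately show ?thesis by (simp add: l shifted_def)
  next
    case False
    then consider "l = 0" | "l = 1" by linarith
    then show ?thesis by cases (simp_all add: shifted_def chiprev_def)
  qed
  have "residual_rhs u l t x \<phi> =
      (\<Sum>n<l. chi_rhs n (f n) t x \<phi>)" if "testfun \<phi>" for \<phi>
    by (rule rhs_slots_sum[OF _ sm sm chi_smooth[OF f] V Z that]) simp
  moreover have "solves (\<lambda>y. \<Sum>n<l. - chi a \<rho> (Suc n) (f n) t x y)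
      (\<lambda>\<phi>. \<Sum>n<l. chi_rhs n (f n) t x \<phi>)"
    by (intro solves_sum chi_solves f) simp
  moreover have "(\<Sum>n<l. - chi a \<rho> (Suc n) (f n) t x y) = - expansion u l t x y" for y
  proof -
    have "expansion u l t x y = (\<Sum>n<l. chi a \<rho> (Suc n) (f n) t x y)"
      unfolding f_def by (simp only: One_nat_def sum.atLeast1_atMost_eq)
    then show ?thesis by (simp add: sum_negf del: chi.simps)
  qed
  ultimately show ?thesis
    using solves_cong[of "residual_rhs u l t x"] by simp
qed

lemma residual_iff:
  assumes u: "\<And>n. smooth_H1 (u n)"
    and prev: "\<And>l' t x. l' < l \<Longrightarrow> AE y in lebesgue.
      u l' t x y - piT (u l') t x = expansion u l' t x y"
  shows "Ipi_zero (wres a \<rho> u (int l - 2)) \<longleftrightarrow>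
    (\<forall>t x. AE y in lebesgue. u l t x y - piT (u l) t x = expansion u l t x y)"
proof -
  have chiH: "H1 (chi a \<rho> n (piT (u m)) t x)" for n m t x
    by (intro smooth_H1_H1 chi_smooth smooth_H1_piT u)
  note UH = smooth_H1_H1[OF u]
  \<comment> \<open>Both sides of the identity are periodic in \<open>y\<close> at every point, so
    almost everywhere in space and almost everywhere on the cell mean the same.\<close>
  have AE_iff: "(AE y in lebesgue. u l t x y - piT (u l) t x = expansion u l t x y) \<longleftrightarrow>
      (AE y in cellM. u l t x y - piT (u l) t x = expansion u l t x y)" for l t x
    using H1_periodic[OF UH] H1_periodic[OF chiH]
    by (intro AE_cell_iff_periodic[symmetric]) (simp add: periodic_def del: chi.simps)
  have prev': "AE y in cellM. u l' t x y = (\<Sum>n\<le>l'. chi a \<rho> n (piT (u (l' - n))) t x y)" if "l' < l" for l' t x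
  proof -
    \<comment> \<open>The term at 0 is the mean itself, as \<open>chi\<close> at 0 is the identity;
      splitting it off relates the full sum to the expansion of the oscillating part.\<close>
    have "(\<Sum>n\<le>l'. chi a \<rho> n (piT (u (l' - n))) t x y) = piT (u l') t x + expansion u l' t x y" for y
      by (simp add: atMost_atLeast0 sum.atLeast_Suc_atMost)
    then show ?thesis
      using prev[OF that, of t x] unfolding AE_iff by (auto elim!: eventually_mono)
  qed
  have S: "solves (\<lambda>y. - expansion u l t x y)
    (residual_rhs u l t x)" for t x
    by (rule residual_step[OF u prev'])
  have WH: "H1 (\<lambda>y. - (u l t x y - piT (u l) t x))" for t x
    using H1_cmult[OF H1_diff[OF UH H1_const(1)], of "-1"] by simp
  have "solves (\<lambda>y. - (u l t x y - piT (u l) t x)) (residual_rhs u l t x) \<longleftrightarrow>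
     (AE y in cellM. u l t x y - piT (u l) t x = expansion u l t x y)" for t x
  proof
    assume "solves (\<lambda>y. - (u l t x y - piT (u l) t x)) (residual_rhs u l t x)"
    from solves_unique[OF this S]
    show "AE y in cellM. u l t x y - piT (u l) t x = expansion u l t x y"
      by eventually_elim linarith
  next
    assume "AE y in cellM. u l t x y - piT (u l) t x = expansion u l t x y"
    then have "AE y in cellM. - (u l t x y - piT (u l) t x) = - expansion u l t x y"
      by eventually_elim simp
    from solves_cong_AE[OF S WH this]
    show "solves (\<lambda>y. - (u l t x y - piT (u l) t x)) (residual_rhs u l t x)" .
  qed
  then show ?thesis unfolding Ipi_zero_wres_iff[OF u] AE_iff by simp
qed

end

theorem theorem2p5:
  fixes a :: "real^'d \<Rightarrow> real^'d^'d" and \<rho> :: "real^'d \<Rightarrow> real" and m1 :: real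
    and u :: "nat \<Rightarrow> real \<Rightarrow> real^'d \<Rightarrow> real^'d \<Rightarrow> real" and k :: int
  assumes a_meas: "\<forall>i j. (\<lambda>y. a y $ i $ j) \<in> borel_measurable lebesgue"
    and a_per: "periodic a"
    and a_bdd: "\<exists>M. AE y in lebesgue. \<forall>i j. \<bar>a y $ i $ j\<bar> \<le> M"
    and a_sym: "AE y in lebesgue. \<forall>i j. a y $ i $ j = a y $ j $ i"
    and m1_pos: "m1 > 0"
    and a_ell: "AE y in lebesgue. \<forall>\<xi>. (a y *v \<xi>) \<bullet> \<xi> \<ge> m1 * (norm \<xi>)\<^sup>2"
    and rho_meas: "\<rho> \<in> borel_measurable lebesgue"
    and rho_per: "periodic \<rho>"
    and rho_bdd: "\<exists>M. AE y in lebesgue. \<bar>\<rho> y\<bar> \<le> M"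
    and rho_pos: "AE y in lebesgue. \<rho> y \<ge> m1"
    and k_ge: "k \<ge> -2"
    and u_smooth: "\<forall>n. smooth_H1 (u n)"
  shows "(\<forall>j::int. -2 \<le> j \<and> j \<le> k \<longrightarrow> Ipi_zero (wres a \<rho> u j)) \<longleftrightarrow>
         (\<forall>l::nat. int l \<le> k + 2 \<longrightarrow> (\<forall>t x. AE y in lebesgue.
            u l t x y - piT (u l) t x = (\<Sum>n = 1..l. chi a \<rho> n (piT (u (l - n))) t x y)))"
proof -
  interpret cell_problem a m1 \<rho>
    by unfold_locales (use assms in auto)
  define E where "E l \<longleftrightarrow> (\<forall>t x. AE y in lebesgue.
    u l t x y - piT (u l) t x = expansion u l t x y)" for l
  define I where "I l \<longleftrightarrow> Ipi_zero (wres a \<rho> u (int l - 2))" for l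
  have step: "I l \<longleftrightarrow> E l" if "\<And>l'. l' < l \<Longrightarrow> E l'" for l
    unfolding I_def E_def using u_smooth that by (intro residual_iff) (auto simp: E_def)
  have "(\<forall>j::int. -2 \<le> j \<and> j \<le> k \<longrightarrow> Ipi_zero (wres a \<rho> u j)) \<longleftrightarrow> (\<forall>l. int l \<le> k + 2 \<longrightarrow> I l)"
  proof (intro iffI allI impI)
    fix j :: int assume *: "\<forall>l. int l \<le> k + 2 \<longrightarrow> I l" and j: "-2 \<le> j \<and> j \<le> k"
    then show "Ipi_zero (wres a \<rho> u j)" using *[rule_format, of "nat (j + 2)"] by (simp add: I_def)
  qed (auto simp: I_def)
  also have "\<dots> \<longleftrightarrow> (\<forall>l. int l \<le> k + 2 \<longrightarrow> E l)"
  proof (intro iffI allI impI)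
    fix l assume I: "\<forall>l. int l \<le> k + 2 \<longrightarrow> I l" and "int l \<le> k + 2"
    \<comment> \<open>Only this direction is inductive: \<open>step\<close> at \<open>l\<close>
      needs the expansions below \<open>l\<close>, which in the converse direction are all
      given.\<close>
    then show "E l"
      by (induction l rule: less_induct) (metis less_imp_le of_nat_less_iff order_trans step)
  next
    fix l assume E: "\<forall>l. int l \<le> k + 2 \<longrightarrow> E l" and l: "int l \<le> k + 2"
    have "E l'" if "l' < l" for l' using E l that by auto
    then show "I l" using step E l by blast
  qed
  finally show ?thesis unfolding E_def .
qed

end
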